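(* Let $T=(T_1,\ldots,T_d)$ be a cyclic pure commuting row contraction on some finite-dimensional Hilbert space $\mathfrak{H}$. Let $\mathfrak{M},\mathfrak{N}\subset\mathfrak{H}$ be co-invariant subspaces for $T$ such that $\mathrm{Ann}_{\mathrm{c}}(P_{\mathfrak{M}}T|_{\mathfrak{M}})=\mathrm{Ann}_{\mathrm{c}}(P_{\mathfrak{N}}T|_{\mathfrak{N}})$. Then $\mathfrak{M}=\mathfrak{N}$.
   Context: Fix a positive integer $d$. The Drury--Arveson space $H^2_d$ is the Hilbert space of analytic functions $f=\sum_{\alpha\in\mathbb{N}^d}c_\alpha x^\alpha$ on the open unit ball $\mathbb{B}_d\subset\mathbb{C}^d$ with $\|f\|^2=\sum_{\alpha}\frac{\alpha!}{|\alpha|!}|c_\alpha|^2<\infty$; $x_1,\dots,x_d$ are the coordinate functions. $\mathcal{M}_d$ is its multiplier algebra, viewed as a weak-$*$ closed unital subalgebra of $B(H^2_d)$ via $\phi\mapsto M_\phi$, $M_\phi f=\phi f$. A $d$-tuple $T=(T_1,\dots,T_d)$ of bounded operators on $\mathfrak{H}$ is a row contraction if $\sum_{k=1}^d T_kT_k^*\le I$; it is commuting if the $T_k$ commute with each other; it is pure if $\lim_{n\to\infty}\sum_{|w|=n}\|T_w^*\xi\|^2=0$ for all $\xi\in\mathfrak{H}$, where $w=i_1\cdots i_n$ ranges over words of length $n$ in $\{1,\dots,d\}$ and $T_w=T_{i_1}\cdots T_{i_n}$. $T$ is cyclic if there is a vector $\xi$ such that $\mathfrak{H}$ is the closed linear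 span of $\{T_w\xi\}$ over all words $w$ (including the empty word). For a pure commuting row contraction $T$ there is a unique unital completely contractive weak-$*$ continuous homomorphism $\mathcal{M}_d\to B(\mathfrak{H})$ sending $M_{x_k}$ to $T_k$ for each $k$; the image of $\phi$ is written $\phi(T)$. $\mathrm{Ann}_{\mathrm{c}}(T)=\{\phi\in\mathcal{M}_d:\phi(T)=0\}$. A closed subspace $\mathfrak{M}$ is co-invariant for $T$ if $T_k^*\mathfrak{M}\subset\mathfrak{M}$ for all $k$; then $P_{\mathfrak{M}}T|_{\mathfrak{M}}=(P_{\mathfrak{M}}T_1|_{\mathfrak{M}},\ldots,P_{\mathfrak{M}}T_d|_{\mathfrak{M}})$ is again a pure commuting row contraction, where $P_{\mathfrak{M}}$ is the orthogonal projection onto $\mathfrak{M}$. *)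

theory Defs
  imports "HOL-Analysis.Analysis" "HOL-Library.Function_Algebras"
begin

section \<open>Complex Hilbert spaces\<close>

text \<open>
  A complex Hilbert space is given by a carrier set inside an ambient abelian group, together with
  a scalar multiplication and an inner product (linear in the first argument) of which only the
  values on the carrier matter. In this way an abstract Hilbert space, its closed subspaces (on
  which compressions act) and the Drury--Arveson space (a set of functions) are treated alike.
\<close>

record 'a hspace =
  hcarrier :: "'a set"
  hscale :: "complex \<Rightarrow> 'a \<Rightarrow> 'a"
  hinner :: "'a \<Rightarrow> 'a \<Rightarrow> complex"

definition hnorm :: "'a hspace \<Rightarrow> 'a \<Rightarrow> real" where
  "hnorm H x = sqrt (Re (hinner H x x))"

locale complex_hilbert_space = vector_space "hscale H"
  for H :: "'a::ab_group_add hspace" +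
  assumes subspace_carrier: "subspace (hcarrier H)"
    and inner_add: "\<lbrakk>x \<in> hcarrier H; y \<in> hcarrier H; z \<in> hcarrier H\<rbrakk>
      \<Longrightarrow> hinner H (x + y) z = hinner H x z + hinner H y z"
    and inner_scale: "\<lbrakk>x \<in> hcarrier H; y \<in> hcarrier H\<rbrakk>
      \<Longrightarrow> hinner H (hscale H c x) y = c * hinner H x y"
    and inner_commute: "\<lbrakk>x \<in> hcarrier H; y \<in> hcarrier H\<rbrakk>
      \<Longrightarrow> hinner H y x = cnj (hinner H x y)"
    and inner_pos: "\<lbrakk>x \<in> hcarrier H; x \<noteq> 0\<rbrakk> \<Longrightarrow> 0 < Re (hinner H x x)"
    and complete: "\<lbrakk>\<And>n. X n \<in> hcarrier H;
        \<And>e. e > 0 \<Longrightarrow> \<exists>N. \<forall>m\<ge>N. \<forall>n\<ge>N. hnorm H (X m - X n) < e\<rbrakk>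
      \<Longrightarrow> \<exists>L\<in>hcarrier H. (\<lambda>n. hnorm H (X n - L)) \<longlonglongrightarrow> 0"

definition finite_dimensional :: "'a::ab_group_add hspace \<Rightarrow> bool" where
  "finite_dimensional H \<longleftrightarrow>
     (\<exists>B. finite B \<and> B \<subseteq> hcarrier H \<and> module.span (hscale H) B = hcarrier H)"

definition hclosure :: "'a::ab_group_add hspace \<Rightarrow> 'a set \<Rightarrow> 'a set" where
  "hclosure H S = {x \<in> hcarrier H. \<forall>e>0. \<exists>y\<in>S. hnorm H (x - y) < e}"

definition closed_subspace :: "'a::ab_group_add hspace \<Rightarrow> 'a set \<Rightarrow> bool" where
  "closed_subspace H M \<longleftrightarrow>
     M \<subseteq> hcarrier H \<and> module.subspace (hscale H) M \<and> hclosure H M = M"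

definition sub_hspace :: "'a hspace \<Rightarrow> 'a set \<Rightarrow> 'a hspace" where
  "sub_hspace H M = H\<lparr>hcarrier := M\<rparr>"

definition hproj :: "'a::ab_group_add hspace \<Rightarrow> 'a set \<Rightarrow> 'a \<Rightarrow> 'a" where
  "hproj H M x = (THE y. y \<in> M \<and> (\<forall>z\<in>M. hinner H (x - y) z = 0))"


section \<open>Bounded operators\<close>

text \<open>
  An operator is a function on the ambient type that is set to 0 outside the carrier, so that
  two operators on \<open>H\<close> coincide iff they are equal as functions.
\<close>

definition bops :: "'a::ab_group_add hspace \<Rightarrow> ('a \<Rightarrow> 'a) set" where
  "bops H = {A.
     (\<forall>x\<in>hcarrier H. A x \<in> hcarrier H) \<and>
     (\<forall>x\<in>hcarrier H. \<forall>y\<in>hcarrier H. A (x + y) = A x + A y) \<and>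
     (\<forall>c. \<forall>x\<in>hcarrier H. A (hscale H c x) = hscale H c (A x)) \<and>
     (\<exists>C. \<forall>x\<in>hcarrier H. hnorm H (A x) \<le> C * hnorm H x) \<and>
     (\<forall>x. x \<notin> hcarrier H \<longrightarrow> A x = 0)}"

definition hid :: "'a::ab_group_add hspace \<Rightarrow> 'a \<Rightarrow> 'a" where
  "hid H = (\<lambda>x. if x \<in> hcarrier H then x else 0)"

definition hadj :: "'a::ab_group_add hspace \<Rightarrow> ('a \<Rightarrow> 'a) \<Rightarrow> 'a \<Rightarrow> 'a" where
  "hadj H A = (THE B. B \<in> bops H \<and>
     (\<forall>x\<in>hcarrier H. \<forall>y\<in>hcarrier H. hinner H (A x) y = hinner H x (B y)))"

definition op_le :: "'a::ab_group_add hspace \<Rightarrow> ('a \<Rightarrow> 'a) \<Rightarrow> ('a \<Rightarrow> 'a) \<Rightarrow> bool" where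
  "op_le H A B \<longleftrightarrow> (\<forall>x\<in>hcarrier H. hinner H (B x - A x) x \<in> \<real>\<^sub>\<ge>\<^sub>0)"

text \<open>
  The trace class functionals on \<open>B(H)\<close> are exactly the maps
  \<open>A \<mapsto> (\<Sum>n. \<langle>A f\<^sub>n, g\<^sub>n\<rangle>)\<close> with square summable sequences of vectors \<open>f\<close>, \<open>g\<close>;
  the weak-* topology is the coarsest one that makes all of them continuous.
\<close>

definition square_summable :: "'a hspace \<Rightarrow> (nat \<Rightarrow> 'a) \<Rightarrow> bool" where
  "square_summable H f \<longleftrightarrow>
     (\<forall>n. f n \<in> hcarrier H) \<and> summable (\<lambda>n. (hnorm H (f n))\<^sup>2)"

definition weak_star :: "'a::ab_group_add hspace \<Rightarrow> ('a \<Rightarrow> 'a) topology" where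
  "weak_star H = topology_generated_by
     {{A \<in> bops H. (\<Sum>n. hinner H (A (f n)) (g n)) \<in> U} | f g U.
        square_summable H f \<and> square_summable H g \<and> open U}"

text \<open>The norm of an \<open>n \<times> n\<close> matrix of operators, acting on the \<open>n\<close>-fold direct sum of \<open>H\<close>.\<close>

definition matrix_norm :: "'a::ab_group_add hspace \<Rightarrow> nat \<Rightarrow> (nat \<Rightarrow> nat \<Rightarrow> 'a \<Rightarrow> 'a) \<Rightarrow> real" where
  "matrix_norm H n A =
     Sup {sqrt (\<Sum>i<n. (hnorm H (\<Sum>j<n. A i j (x j)))\<^sup>2) | x.
            (\<forall>j<n. x j \<in> hcarrier H) \<and> (\<Sum>j<n. (hnorm H (x j))\<^sup>2) \<le> 1}"


section \<open>The Drury--Arveson space and its multiplier algebra\<close>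

text \<open>
  The dimension is \<open>d = CARD('d)\<close> and multi-indices are functions \<open>'d \<Rightarrow> nat\<close>. Functions on the open
  unit ball are represented by functions on \<open>\<complex>\<^sup>d\<close> that vanish outside the ball.
\<close>

definition mmonom :: "('d::finite \<Rightarrow> nat) \<Rightarrow> complex ^ 'd \<Rightarrow> complex" where
  "mmonom \<alpha> x = (\<Prod>i\<in>UNIV. (x $ i) ^ \<alpha> i)"

definition da_weight :: "('d::finite \<Rightarrow> nat) \<Rightarrow> real" where
  "da_weight \<alpha> = (\<Prod>i\<in>UNIV. fact (\<alpha> i)) / fact (\<Sum>i\<in>UNIV. \<alpha> i)"

definition has_power_series ::
    "(complex ^ 'd::finite \<Rightarrow> complex) \<Rightarrow> (('d \<Rightarrow> nat) \<Rightarrow> complex) \<Rightarrow> bool" where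
  "has_power_series f c \<longleftrightarrow>
     (\<forall>x\<in>ball 0 1. ((\<lambda>\<alpha>. c \<alpha> * mmonom \<alpha> x) has_sum f x) UNIV)"

text \<open>The coefficients of a power series converging on the ball are unique.\<close>

definition da_coeff :: "(complex ^ 'd::finite \<Rightarrow> complex) \<Rightarrow> ('d \<Rightarrow> nat) \<Rightarrow> complex" where
  "da_coeff f = (SOME c. has_power_series f c)"

definition da_space :: "(complex ^ 'd::finite \<Rightarrow> complex) set" where
  "da_space = {f. (\<forall>x. x \<notin> ball 0 1 \<longrightarrow> f x = 0) \<and>
     (\<exists>c. has_power_series f c \<and> (\<lambda>\<alpha>. da_weight \<alpha> * (cmod (c \<alpha>))\<^sup>2) summable_on UNIV)}"

definition drury_arveson :: "(complex ^ 'd::finite \<Rightarrow> complex) hspace" where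
  "drury_arveson = \<lparr>
     hcarrier = da_space,
     hscale = (\<lambda>c f x. c * f x),
     hinner = (\<lambda>f g. \<Sum>\<^sub>\<infinity>\<alpha>. of_real (da_weight \<alpha>) * da_coeff f \<alpha> * cnj (da_coeff g \<alpha>))\<rparr>"

definition mult_op ::
    "(complex ^ 'd::finite \<Rightarrow> complex) \<Rightarrow> (complex ^ 'd \<Rightarrow> complex) \<Rightarrow> (complex ^ 'd \<Rightarrow> complex)" where
  "mult_op \<phi> = (\<lambda>f. if f \<in> da_space then (\<lambda>x. \<phi> x * f x) else 0)"

definition multipliers :: "(complex ^ 'd::finite \<Rightarrow> complex) set" where
  "multipliers = {\<phi>. (\<forall>x. x \<notin> ball 0 1 \<longrightarrow> \<phi> x = 0) \<and> mult_op \<phi> \<in> bops drury_arveson}"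

text \<open>The weak-* topology on the multipliers, via the embedding \<open>\<phi> \<mapsto> M\<^sub>\<phi>\<close>.\<close>

definition multiplier_topology :: "(complex ^ 'd::finite \<Rightarrow> complex) topology" where
  "multiplier_topology = pullback_topology multipliers mult_op (weak_star drury_arveson)"

definition ball_one :: "complex ^ 'd::finite \<Rightarrow> complex" where
  "ball_one = (\<lambda>x. if x \<in> ball 0 1 then 1 else 0)"

definition ball_coord :: "'d::finite \<Rightarrow> complex ^ 'd \<Rightarrow> complex" where
  "ball_coord k = (\<lambda>x. if x \<in> ball 0 1 then x $ k else 0)"


section \<open>Operator tuples\<close>

definition row_contraction :: "'a::ab_group_add hspace \<Rightarrow> ('d::finite \<Rightarrow> 'a \<Rightarrow> 'a) \<Rightarrow> bool" where
  "row_contraction H T \<longleftrightarrow>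
     (\<forall>k. T k \<in> bops H) \<and> op_le H (\<lambda>x. \<Sum>k\<in>UNIV. T k (hadj H (T k) x)) (hid H)"

definition commuting :: "('d \<Rightarrow> 'a \<Rightarrow> 'a) \<Rightarrow> bool" where
  "commuting T \<longleftrightarrow> (\<forall>j k. T j \<circ> T k = T k \<circ> T j)"

text \<open>For a word \<open>w = [i\<^sub>1, \<dots>, i\<^sub>n]\<close> this is \<open>T\<^sub>w = T i\<^sub>1 \<circ> \<dots> \<circ> T i\<^sub>n\<close>.\<close>

definition word_op :: "'a::ab_group_add hspace \<Rightarrow> ('d \<Rightarrow> 'a \<Rightarrow> 'a) \<Rightarrow> 'd list \<Rightarrow> 'a \<Rightarrow> 'a" where
  "word_op H T w = foldr (\<lambda>i A. T i \<circ> A) w (hid H)"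

definition pure_tuple :: "'a::ab_group_add hspace \<Rightarrow> ('d::finite \<Rightarrow> 'a \<Rightarrow> 'a) \<Rightarrow> bool" where
  "pure_tuple H T \<longleftrightarrow> (\<forall>\<xi>\<in>hcarrier H.
     (\<lambda>n. \<Sum>w | length w = n. (hnorm H (hadj H (word_op H T w) \<xi>))\<^sup>2) \<longlonglongrightarrow> 0)"

definition cyclic_tuple :: "'a::ab_group_add hspace \<Rightarrow> ('d \<Rightarrow> 'a \<Rightarrow> 'a) \<Rightarrow> bool" where
  "cyclic_tuple H T \<longleftrightarrow> (\<exists>\<xi>\<in>hcarrier H.
     hclosure H (module.span (hscale H) (range (\<lambda>w. word_op H T w \<xi>))) = hcarrier H)"

definition coinvariant :: "'a::ab_group_add hspace \<Rightarrow> ('d \<Rightarrow> 'a \<Rightarrow> 'a) \<Rightarrow> 'a set \<Rightarrow> bool" where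
  "coinvariant H T M \<longleftrightarrow> closed_subspace H M \<and> (\<forall>k. hadj H (T k) ` M \<subseteq> M)"

definition compression ::
    "'a::ab_group_add hspace \<Rightarrow> 'a set \<Rightarrow> ('d \<Rightarrow> 'a \<Rightarrow> 'a) \<Rightarrow> 'd \<Rightarrow> 'a \<Rightarrow> 'a" where
  "compression H M T = (\<lambda>k x. if x \<in> M then hproj H M (T k x) else 0)"


section \<open>The functional calculus and annihilators\<close>

definition is_functional_calculus :: "'a::ab_group_add hspace \<Rightarrow> ('d::finite \<Rightarrow> 'a \<Rightarrow> 'a)
    \<Rightarrow> ((complex ^ 'd \<Rightarrow> complex) \<Rightarrow> 'a \<Rightarrow> 'a) \<Rightarrow> bool" where
  "is_functional_calculus H T \<Phi> \<longleftrightarrow>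
     \<Phi> ` multipliers \<subseteq> bops H \<and>
     (\<forall>\<phi>\<in>multipliers. \<forall>\<psi>\<in>multipliers. \<Phi> (\<lambda>x. \<phi> x + \<psi> x) = (\<lambda>h. \<Phi> \<phi> h + \<Phi> \<psi> h)) \<and>
     (\<forall>c. \<forall>\<phi>\<in>multipliers. \<Phi> (\<lambda>x. c * \<phi> x) = (\<lambda>h. hscale H c (\<Phi> \<phi> h))) \<and>
     (\<forall>\<phi>\<in>multipliers. \<forall>\<psi>\<in>multipliers. \<Phi> (\<lambda>x. \<phi> x * \<psi> x) = \<Phi> \<phi> \<circ> \<Phi> \<psi>) \<and>
     \<Phi> ball_one = hid H \<and>
     (\<forall>n \<phi>. (\<forall>i<n. \<forall>j<n. \<phi> i j \<in> multipliers) \<longrightarrow>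
        matrix_norm H n (\<lambda>i j. \<Phi> (\<phi> i j))
          \<le> matrix_norm drury_arveson n (\<lambda>i j. mult_op (\<phi> i j))) \<and>
     continuous_map multiplier_topology (weak_star H) \<Phi> \<and>
     (\<forall>k. \<Phi> (ball_coord k) = T k)"

text \<open>
  \<open>fun_calc H T \<phi>\<close> is \<open>\<phi>(T)\<close>. For a pure commuting row contraction \<open>T\<close> there is exactly one
  functional calculus on the multipliers; its values outside the multipliers are irrelevant, which
  is why it is picked by \<open>SOME\<close> instead of \<open>THE\<close>.
\<close>

definition fun_calc :: "'a::ab_group_add hspace \<Rightarrow> ('d::finite \<Rightarrow> 'a \<Rightarrow> 'a)
    \<Rightarrow> (complex ^ 'd \<Rightarrow> complex) \<Rightarrow> 'a \<Rightarrow> 'a" where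
  "fun_calc H T = (SOME \<Phi>. is_functional_calculus H T \<Phi>)"

definition Ann_c :: "'a::ab_group_add hspace \<Rightarrow> ('d::finite \<Rightarrow> 'a \<Rightarrow> 'a)
    \<Rightarrow> (complex ^ 'd \<Rightarrow> complex) set" where
  "Ann_c H T = {\<phi> \<in> multipliers. fun_calc H T \<phi> = (\<lambda>_. 0)}"

end

(*
Let \<xi> be cyclic and let M be co-invariant, so that its orthogonal complement is invariant. For a
polynomial p we have p(T_M) = P_M p(T)|M, hence p(T_M) = 0 iff p(T) H lies in the complement of M, and
as the p(T) commute and H = {p(T) \<xi>}, iff p(T) \<xi> lies in the complement of M. So this complement is
the set of all p(T) \<xi> with p in the annihilator of T_M.

The annihilators are defined through the functional calculus, so its existence for the compressions is
needed. In finite dimensions, purity makes the sum of ||T_w* x||^2 over all words w finite, and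
\<phi>(T) is the absolutely convergent series of the c_\<alpha> T^\<alpha>, which gives multiplicativity and
weak-* continuity. For complete contractivity, write I - sum T_k T_k* as a sum of rank one operators
v_i v_i*; the Poisson kernel K, K_i x = sum_\<alpha> (|\<alpha>|! / \<alpha>!) <T^\<alpha>* x, v_i> x^\<alpha>, is an isometry
into a direct sum of copies of the Drury-Arveson space and \<phi>(T) = sum_i K_i* M_\<phi> K_i.
*)
theory Submission
  imports Defs "HOL-Computational_Algebra.Primes"
begin

subsection \<open>Positive semidefinite forms\<close>

text \<open>\<open>fun_calc\<close> is a choice by \<open>SOME\<close>, so nothing can be said about
  the annihilators without a witness. Its convergence rests on a duality of weights. A multiplier
  \<phi> = M_\<phi> 1 lies in the Drury-Arveson space, so its coefficients are square summable
  against \<open>da_weight\<close>; the norms of T^\<alpha> are square summable against the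
  reciprocal weight, because \<open>1 / da_weight \<alpha>\<close> counts the words with letter
  counts \<alpha>. Cauchy-Schwarz pairs the two. The coefficients are again chosen by
  \<open>SOME\<close>, whence the uniqueness theorem for power series in several variables. In place
  of a square root of the defect operator there is a Cholesky factorization. The adjoints are
  carried as a separate family \<open>S\<close>: the adjoint of the compression of T_k to M is the
  restriction of that of T_k, so one family serves H and every co-invariant M, and contractivity and
  purity restrict verbatim. In the final argument the multiplier for a polynomial is fixed before M,
  so that the same one can be tested on both subspaces.\<close>

definition linear_functional_on ::
    "(complex \<Rightarrow> 'a::ab_group_add \<Rightarrow> 'a) \<Rightarrow> 'a set \<Rightarrow> ('a \<Rightarrow> complex) \<Rightarrow> bool" where
  "linear_functional_on s V l \<longleftrightarrow>
     (\<forall>x\<in>V. \<forall>y\<in>V. l (x + y) = l x + l y) \<and> (\<forall>c. \<forall>x\<in>V. l (s c x) = c * l x)"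

text \<open>Semidefinite rather than definite, because the main example besides inner products is
  the defect form <x, y> - sum <S_k x, S_k y>, which may be degenerate.\<close>

locale psd_form = vector_space s for s :: "complex \<Rightarrow> 'a::ab_group_add \<Rightarrow> 'a" +
  fixes V :: "'a set" and q :: "'a \<Rightarrow> 'a \<Rightarrow> complex"
  assumes subspace_V: "subspace V"
    and add_left: "\<lbrakk>x \<in> V; y \<in> V; z \<in> V\<rbrakk> \<Longrightarrow> q (x + y) z = q x z + q y z"
    and scale_left: "\<lbrakk>x \<in> V; y \<in> V\<rbrakk> \<Longrightarrow> q (s c x) y = c * q x y"
    and commute: "\<lbrakk>x \<in> V; y \<in> V\<rbrakk> \<Longrightarrow> q y x = cnj (q x y)"
    and nonneg: "x \<in> V \<Longrightarrow> 0 \<le> Re (q x x)"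
begin

lemma V_closed [simp, intro]:
  "0 \<in> V" "\<lbrakk>x \<in> V; y \<in> V\<rbrakk> \<Longrightarrow> x + y \<in> V" "x \<in> V \<Longrightarrow> s c x \<in> V"
  "\<lbrakk>x \<in> V; y \<in> V\<rbrakk> \<Longrightarrow> x - y \<in> V" "x \<in> V \<Longrightarrow> - x \<in> V"
  using subspace_V by (auto intro: subspace_0 subspace_add subspace_scale subspace_diff subspace_neg)

lemma V_sum [intro]: "(\<And>i. i \<in> I \<Longrightarrow> f i \<in> V) \<Longrightarrow> sum f I \<in> V"
  using subspace_V by (rule subspace_sum)

lemma add_right: "\<lbrakk>x \<in> V; y \<in> V; z \<in> V\<rbrakk> \<Longrightarrow> q z (x + y) = q z x + q z y"
  using commute[of "x + y" z] add_left[of x y z] commute[of x z] commute[of y z] by auto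

lemma scale_right: "\<lbrakk>x \<in> V; y \<in> V\<rbrakk> \<Longrightarrow> q x (s c y) = cnj c * q x y"
  using commute[of "s c y" x] scale_left[of y x c] commute[of y x] by auto

lemma zero_left [simp]: "y \<in> V \<Longrightarrow> q 0 y = 0"
  using scale_left[of 0 y 0] by simp

lemma zero_right [simp]: "y \<in> V \<Longrightarrow> q y 0 = 0"
  using scale_right[of y 0 0] by simp

lemma diff_left: "\<lbrakk>x \<in> V; y \<in> V; z \<in> V\<rbrakk> \<Longrightarrow> q (x - y) z = q x z - q y z"
  using add_left[of "x - y" y z] by simp

lemma diff_right: "\<lbrakk>x \<in> V; y \<in> V; z \<in> V\<rbrakk> \<Longrightarrow> q z (x - y) = q z x - q z y"
  using add_right[of "x - y" y z] by simp

lemma sum_left: "\<lbrakk>\<And>i. i \<in> I \<Longrightarrow> f i \<in> V; y \<in> V\<rbrakk> \<Longrightarrow> q (sum f I) y = (\<Sum>i\<in>I. q (f i) y)"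
  by (induction I rule: infinite_finite_induct) (auto simp: add_left V_sum)

lemma sum_right: "\<lbrakk>\<And>i. i \<in> I \<Longrightarrow> f i \<in> V; y \<in> V\<rbrakk> \<Longrightarrow> q y (sum f I) = (\<Sum>i\<in>I. q y (f i))"
  by (induction I rule: infinite_finite_induct) (auto simp: add_right V_sum)

lemma self_real: "x \<in> V \<Longrightarrow> q x x = of_real (Re (q x x))"
  using commute[of x x] by (simp add: complex_eq_iff)

lemma cauchy_schwarz:
  assumes "x \<in> V" "y \<in> V"
  shows "(cmod (q x y))\<^sup>2 \<le> Re (q x x) * Re (q y y)"
proof -
  define a where "a = Re (q x x)"
  define b where "b = Re (q y y)"
  define p where "p = q x y"
  have ex: "0 \<le> a - 2 * r * (cmod p)\<^sup>2 + r\<^sup>2 * (cmod p)\<^sup>2 * b" for r :: real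
  proof -
    \<comment> \<open>The factor p makes both cross terms equal to -r |p|^2.\<close>
    let ?t = "- of_real r * p"
    have "q (x + s t y) (x + s t y) = q x x + cnj t * q x y + t * cnj (q x y) + t * cnj t * q y y" for t
      using assms commute[of x y]
      by (simp add: add_left add_right scale_left scale_right distrib_left mult.assoc)
    from this[of ?t] have "q (x + s ?t y) (x + s ?t y) =
        q x x + cnj ?t * q x y + ?t * cnj (q x y) + ?t * cnj ?t * q y y" .
    also have "\<dots> = of_real a - 2 * of_real r * (p * cnj p) + (of_real r)\<^sup>2 * (p * cnj p) * of_real b"
      using self_real[OF assms(1)] self_real[OF assms(2)]
      by (simp add: a_def b_def p_def power2_eq_square algebra_simps)
    also have "\<dots> = of_real (a - 2 * r * (cmod p)\<^sup>2 + r\<^sup>2 * (cmod p)\<^sup>2 * b)"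
      by (simp add: complex_norm_square[symmetric])
    finally show ?thesis using nonneg[of "x + s ?t y"] assms by simp
  qed
  show ?thesis
  proof (cases "b = 0")
    case True
    have "p = 0"
    proof (rule ccontr)
      assume "p \<noteq> 0"
      then have "(cmod p)\<^sup>2 > 0" by simp
      \<comment> \<open>For b = 0 the bound is affine in r; this value of r turns it into 0 \<le>
        -1.\<close>
      with ex[of "(a + 1) / (2 * (cmod p)\<^sup>2)"] True show False by simp
    qed
    with True show ?thesis by (simp add: p_def b_def)
  next
    case False
    then have "b > 0" using nonneg[OF assms(2)] by (simp add: b_def)
    \<comment> \<open>The minimum of the quadratic in r is at r = 1 / b.\<close>
    then have "0 \<le> a - (cmod p)\<^sup>2 / b"
      using ex[of "1 / b"] by (simp add: power2_eq_square field_simps)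
    with \<open>b > 0\<close> show ?thesis by (simp add: field_simps p_def a_def b_def)
  qed
qed

lemma null_vector: "\<lbrakk>x \<in> V; y \<in> V; Re (q x x) = 0\<rbrakk> \<Longrightarrow> q x y = 0"
  using cauchy_schwarz[of x y] by simp

text \<open>Elimination of b: subtracting a rank one form leaves the Schur complement, which is
  semidefinite by Cauchy-Schwarz and has b as a null vector. If \<open>q b b = 0\<close>, division
  by zero makes l vanish, and b is a null vector already.\<close>

lemma cholesky_step:
  assumes b: "b \<in> V"
  defines "l \<equiv> \<lambda>x. q x b / of_real (sqrt (Re (q b b)))"
  defines "q' \<equiv> \<lambda>x y. q x y - l x * cnj (l y)"
  shows "linear_functional_on s V l" "psd_form s V q'" "\<And>x. x \<in> V \<Longrightarrow> q' b x = 0"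
proof -
  show l: "linear_functional_on s V l"
    using b by (auto simp: linear_functional_on_def l_def add_left scale_left add_divide_distrib)
  define r where "r = Re (q b b)"
  have r: "r \<ge> 0" using nonneg b by (simp add: r_def)
  have ll: "l x * cnj (l y) = q x b * q b y / of_real r" if "x \<in> V" "y \<in> V" for x y
  proof -
    have "of_real (sqrt r) * of_real (sqrt r) = (of_real r :: complex)"
      using r by (simp flip: of_real_mult)
    then show ?thesis using that b commute[of y b] by (simp add: l_def r_def)
  qed
  show "psd_form s V q'"
  proof unfold_locales
    fix x y assume xy: "x \<in> V" "y \<in> V"
    then show "q' y x = cnj (q' x y)" using commute[of x y] by (simp add: q'_def)
  next
    fix x assume x: "x \<in> V"
    have "Re (l x * cnj (l x)) = (cmod (q x b))\<^sup>2 / r"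
      using ll[OF x x] commute[OF x b]
      by (simp add: complex_norm_square[symmetric] flip: of_real_divide)
    also have "\<dots> \<le> Re (q x x)"
      using cauchy_schwarz[OF x b] r nonneg[OF x]
      by (cases "r = 0") (auto simp: r_def[symmetric] field_simps)
    finally show "0 \<le> Re (q' x x)" by (simp add: q'_def)
  qed (use l in \<open>auto simp: subspace_V q'_def linear_functional_on_def add_left scale_left algebra_simps\<close>)
  fix x assume x: "x \<in> V"
  show "q' b x = 0"
  proof (cases "r = 0")
    case True
    then show ?thesis using null_vector[OF b x] ll[OF b x] by (simp add: q'_def r_def)
  next
    case False
    then show ?thesis using ll[OF b x] self_real[OF b] by (simp add: q'_def r_def[symmetric])
  qed
qed

text \<open>Vectors eliminated earlier stay null vectors: the next functional k is a multiple of x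
  \<mapsto> q1 x b, which vanishes at every null vector of the current remainder q1.\<close>

lemma cholesky_on:
  assumes "finite B" "B \<subseteq> V"
  shows "\<exists>(m::nat) l. (\<forall>i<m. linear_functional_on s V (l i)) \<and>
     psd_form s V (\<lambda>x y. q x y - (\<Sum>i<m. l i x * cnj (l i y))) \<and>
     (\<forall>b\<in>B. \<forall>x\<in>V. q b x = (\<Sum>i<m. l i b * cnj (l i x)))"
  using assms
proof (induction B)
  case empty
  show ?case by (rule exI[of _ 0]) (use psd_form_axioms in auto)
next
  case (insert b B)
  then have "B \<subseteq> V" by simp
  from insert.IH[OF this] obtain m :: nat and l where lin: "\<forall>i<m. linear_functional_on s V (l i)"
    and psd: "psd_form s V (\<lambda>x y. q x y - (\<Sum>i<m. l i x * cnj (l i y)))"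
    and van: "\<forall>b\<in>B. \<forall>x\<in>V. q b x = (\<Sum>i<m. l i b * cnj (l i x))"
    by (elim exE conjE) (rule that; assumption)
  define q1 where "q1 = (\<lambda>x y. q x y - (\<Sum>i<m. l i x * cnj (l i y)))"
  interpret q1: psd_form s V q1 using psd by (simp add: q1_def)
  define k where "k = (\<lambda>x. q1 x b / of_real (sqrt (Re (q1 b b))))"
  have b: "b \<in> V" using insert by auto
  note st = q1.cholesky_step[OF b, folded k_def]
  define l' where "l' = l(m := k)"
  have l': "(\<Sum>i<Suc m. l' i x * cnj (l' i y)) = (\<Sum>i<m. l i x * cnj (l i y)) + k x * cnj (k y)" for x y
    by (simp add: l'_def)
  have k0: "k c = 0" if "c \<in> B" for c
    using van that b by (simp add: k_def q1_def)
  show ?case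
  proof (intro exI[of _ "Suc m"] exI[of _ l'] conjI allI impI ballI)
    show "linear_functional_on s V (l' i)" if "i < Suc m" for i
      using that lin st(1) by (auto simp: l'_def less_Suc_eq)
    show "psd_form s V (\<lambda>x y. q x y - (\<Sum>i<Suc m. l' i x * cnj (l' i y)))"
      using st(2) unfolding l' k_def q1_def diff_diff_eq .
    fix c x assume c: "c \<in> insert b B" and x: "x \<in> V"
    show "q c x = (\<Sum>i<Suc m. l' i c * cnj (l' i x))"
    proof (cases "c \<in> B")
      case True
      then show ?thesis unfolding l' using van x k0 by simp
    next
      case False
      have "q1 b x - k b * cnj (k x) = 0" using st(3)[OF x] unfolding k_def .
      with False c show ?thesis unfolding l' by (simp add: q1_def algebra_simps)
    qed
  qed
qed

text \<open>After a spanning set has been eliminated the remainder is zero by linearity. The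
  functionals play the role of the rows of a square root of the form.\<close>

lemma cholesky:
  assumes "finite B" "B \<subseteq> V" "span B = V"
  obtains m :: nat and l where "\<And>i. i < m \<Longrightarrow> linear_functional_on s V (l i)"
    "\<And>x y. \<lbrakk>x \<in> V; y \<in> V\<rbrakk> \<Longrightarrow> q x y = (\<Sum>i<m. l i x * cnj (l i y))"
proof -
  obtain m :: nat and l where lin: "\<forall>i<m. linear_functional_on s V (l i)"
    and psd: "psd_form s V (\<lambda>x y. q x y - (\<Sum>i<m. l i x * cnj (l i y)))"
    and van: "\<forall>b\<in>B. \<forall>x\<in>V. q b x = (\<Sum>i<m. l i b * cnj (l i x))"
    using cholesky_on[OF assms(1,2)] by blast
  define q1 where "q1 = (\<lambda>x y. q x y - (\<Sum>i<m. l i x * cnj (l i y)))"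
  interpret q1: psd_form s V q1 using psd by (simp add: q1_def)
  have "q1 x y = 0" if "x \<in> V" "y \<in> V" for x y
  proof -
    have "x \<in> span B" using that assms by simp
    then have "x \<in> V \<and> q1 x y = 0"
    proof (induction rule: span_induct_alt)
      case base
      then show ?case using that by simp
    next
      case (step c b x)
      then show ?case using assms(2) van that
        by (auto simp: q1.add_left q1.scale_left subset_iff) (simp add: q1_def)
    qed
    then show ?thesis by simp
  qed
  then show thesis using that[of m l] lin by (auto simp: q1_def)
qed

end


subsection \<open>Inner product spaces\<close>

locale inner_space = psd_form "hscale H" "hcarrier H" "hinner H"
  for H :: "'a::ab_group_add hspace" +
  assumes pos_def: "\<lbrakk>x \<in> hcarrier H; x \<noteq> 0\<rbrakk> \<Longrightarrow> 0 < Re (hinner H x x)"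

lemma (in complex_hilbert_space) inner_space: "inner_space H"
proof
  show "0 \<le> Re (hinner H x x)" if "x \<in> hcarrier H" for x
    using inner_pos[OF that] inner_scale[OF that that, of 0] by (cases "x = 0") auto
qed (auto intro: subspace_carrier inner_add inner_scale inner_commute inner_pos)

context inner_space
begin

lemma hnorm_power2: "x \<in> hcarrier H \<Longrightarrow> (hnorm H x)\<^sup>2 = Re (hinner H x x)"
  using nonneg by (simp add: hnorm_def)

lemma hinner_self: "x \<in> hcarrier H \<Longrightarrow> hinner H x x = of_real ((hnorm H x)\<^sup>2)"
  using self_real hnorm_power2 by simp

lemma hnorm_nonneg [simp]: "x \<in> hcarrier H \<Longrightarrow> 0 \<le> hnorm H x"
  using nonneg by (simp add: hnorm_def)

lemma hnorm_zero [simp]: "hnorm H 0 = 0"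
  by (simp add: hnorm_def)

lemma hnorm_eq_0_iff: "x \<in> hcarrier H \<Longrightarrow> hnorm H x = 0 \<longleftrightarrow> x = 0"
  using pos_def[of x] by (cases "x = 0") (auto simp: hnorm_def)

lemma hnorm_scale: "x \<in> hcarrier H \<Longrightarrow> hnorm H (hscale H c x) = cmod c * hnorm H x"
proof -
  assume x: "x \<in> hcarrier H"
  have "(hnorm H (hscale H c x))\<^sup>2 = Re ((c * cnj c) * hinner H x x)"
    using x by (simp only: hnorm_power2 V_closed scale_left scale_right mult.assoc mult.left_commute)
  also have "\<dots> = (cmod c * hnorm H x)\<^sup>2"
    using x by (simp add: hinner_self power_mult_distrib complex_norm_square[symmetric] del: of_real_power flip: of_real_mult)
  finally show ?thesis using x by (simp add: power2_eq_iff_nonneg)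
qed

lemma hinner_le: "\<lbrakk>x \<in> hcarrier H; y \<in> hcarrier H\<rbrakk> \<Longrightarrow> cmod (hinner H x y) \<le> hnorm H x * hnorm H y"
  by (rule power2_le_imp_le) (auto simp: power_mult_distrib hnorm_power2 cauchy_schwarz)

lemma hnorm_triangle: "\<lbrakk>x \<in> hcarrier H; y \<in> hcarrier H\<rbrakk> \<Longrightarrow> hnorm H (x + y) \<le> hnorm H x + hnorm H y"
proof -
  assume xy: "x \<in> hcarrier H" "y \<in> hcarrier H"
  have "(hnorm H (x + y))\<^sup>2 = (hnorm H x)\<^sup>2 + 2 * Re (hinner H x y) + (hnorm H y)\<^sup>2"
    using xy commute[of x y] by (simp add: hnorm_power2 add_left add_right)
  also have "Re (hinner H x y) \<le> hnorm H x * hnorm H y"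
    using hinner_le[OF xy] complex_Re_le_cmod order_trans by blast
  finally have "(hnorm H (x + y))\<^sup>2 \<le> (hnorm H x + hnorm H y)\<^sup>2"
    by (simp add: power2_sum algebra_simps)
  then show ?thesis by (rule power2_le_imp_le) (use xy in auto)
qed

lemma hnorm_sum: "(\<And>i. i \<in> I \<Longrightarrow> f i \<in> hcarrier H) \<Longrightarrow> hnorm H (sum f I) \<le> (\<Sum>i\<in>I. hnorm H (f i))"
proof (induction I rule: infinite_finite_induct)
  case (insert i I)
  then have "hnorm H (f i + sum f I) \<le> hnorm H (f i) + hnorm H (sum f I)"
    by (intro hnorm_triangle V_sum) auto
  with insert show ?case by auto
qed auto

lemma eq_if_hinner_eq:
  assumes "x \<in> hcarrier H" "y \<in> hcarrier H" "\<And>z. z \<in> hcarrier H \<Longrightarrow> hinner H x z = hinner H y z"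
  shows "x = y"
proof -
  have "hinner H (x - y) (x - y) = 0" using assms by (simp add: diff_left)
  then show ?thesis using assms pos_def[of "x - y"] by force
qed

section \<open>Bounded operators\<close>

lemma bops_in: "\<lbrakk>A \<in> bops H; x \<in> hcarrier H\<rbrakk> \<Longrightarrow> A x \<in> hcarrier H"
  and bops_add: "\<lbrakk>A \<in> bops H; x \<in> hcarrier H; y \<in> hcarrier H\<rbrakk> \<Longrightarrow> A (x + y) = A x + A y"
  and bops_scale: "\<lbrakk>A \<in> bops H; x \<in> hcarrier H\<rbrakk> \<Longrightarrow> A (hscale H c x) = hscale H c (A x)"
  and bops_off: "\<lbrakk>A \<in> bops H; x \<notin> hcarrier H\<rbrakk> \<Longrightarrow> A x = 0"
  by (auto simp: bops_def)

lemma bops_0: "A \<in> bops H \<Longrightarrow> A 0 = 0"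
  using bops_scale[of A 0 0] by simp

lemma bops_sum: "\<lbrakk>A \<in> bops H; \<And>i. i \<in> I \<Longrightarrow> f i \<in> hcarrier H\<rbrakk> \<Longrightarrow> A (sum f I) = (\<Sum>i\<in>I. A (f i))"
  by (induction I rule: infinite_finite_induct) (auto simp: bops_add V_sum bops_0)

lemma bops_bound:
  assumes "A \<in> bops H"
  obtains C where "C \<ge> 0" "\<And>x. x \<in> hcarrier H \<Longrightarrow> hnorm H (A x) \<le> C * hnorm H x"
proof -
  obtain C where C: "\<forall>x\<in>hcarrier H. hnorm H (A x) \<le> C * hnorm H x"
    using assms by (auto simp: bops_def)
  show thesis
  proof (rule that[of "\<bar>C\<bar>"])
    fix x assume x: "x \<in> hcarrier H"
    then have "C * hnorm H x \<le> \<bar>C\<bar> * hnorm H x" by (intro mult_right_mono) auto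
    with C x show "hnorm H (A x) \<le> \<bar>C\<bar> * hnorm H x" by force
  qed simp
qed

lemma bops_intro:
  assumes "\<And>x. x \<in> hcarrier H \<Longrightarrow> A x \<in> hcarrier H"
    "\<And>x y. \<lbrakk>x \<in> hcarrier H; y \<in> hcarrier H\<rbrakk> \<Longrightarrow> A (x + y) = A x + A y"
    "\<And>c x. x \<in> hcarrier H \<Longrightarrow> A (hscale H c x) = hscale H c (A x)"
    "\<And>x. x \<in> hcarrier H \<Longrightarrow> hnorm H (A x) \<le> C * hnorm H x"
    "\<And>x. x \<notin> hcarrier H \<Longrightarrow> A x = 0"
  shows "A \<in> bops H"
  unfolding bops_def using assms by (intro CollectI conjI exI[of _ C]) blast+

lemma bops_comp: "\<lbrakk>A \<in> bops H; B \<in> bops H\<rbrakk> \<Longrightarrow> A \<circ> B \<in> bops H"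
proof -
  assume A: "A \<in> bops H" and B: "B \<in> bops H"
  obtain C where C: "C \<ge> 0" "\<And>x. x \<in> hcarrier H \<Longrightarrow> hnorm H (A x) \<le> C * hnorm H x"
    using bops_bound[OF A] by blast
  obtain D where D: "D \<ge> 0" "\<And>x. x \<in> hcarrier H \<Longrightarrow> hnorm H (B x) \<le> D * hnorm H x"
    using bops_bound[OF B] by blast
  have "hnorm H (A (B x)) \<le> C * D * hnorm H x" if "x \<in> hcarrier H" for x
    using C(2)[OF bops_in[OF B that]] mult_left_mono[OF D(2)[OF that] C(1)] by (simp add: mult.assoc)
  with A B show ?thesis
    by (intro bops_intro[where C = "C * D"]) (simp_all add: bops_in bops_add bops_scale bops_off bops_0)
qed

lemma bops_add_op: "\<lbrakk>A \<in> bops H; B \<in> bops H\<rbrakk> \<Longrightarrow> (\<lambda>x. A x + B x) \<in> bops H"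
proof -
  assume A: "A \<in> bops H" and B: "B \<in> bops H"
  obtain C where C: "C \<ge> 0" "\<And>x. x \<in> hcarrier H \<Longrightarrow> hnorm H (A x) \<le> C * hnorm H x"
    using bops_bound[OF A] by blast
  obtain D where D: "D \<ge> 0" "\<And>x. x \<in> hcarrier H \<Longrightarrow> hnorm H (B x) \<le> D * hnorm H x"
    using bops_bound[OF B] by blast
  have "hnorm H (A x + B x) \<le> (C + D) * hnorm H x" if "x \<in> hcarrier H" for x
    using hnorm_triangle[OF bops_in[OF A that] bops_in[OF B that]] C(2)[OF that] D(2)[OF that]
    by (simp add: algebra_simps)
  with A B show ?thesis
    by (intro bops_intro[where C = "C + D"])
      (simp_all add: bops_in bops_add bops_scale bops_off scale_right_distrib)
qed

lemma bops_scale_op: "A \<in> bops H \<Longrightarrow> (\<lambda>x. hscale H c (A x)) \<in> bops H"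
proof -
  assume A: "A \<in> bops H"
  obtain C where C: "C \<ge> 0" "\<And>x. x \<in> hcarrier H \<Longrightarrow> hnorm H (A x) \<le> C * hnorm H x"
    using bops_bound[OF A] by blast
  have "hnorm H (hscale H c (A x)) \<le> (cmod c * C) * hnorm H x" if "x \<in> hcarrier H" for x
    using mult_left_mono[OF C(2)[OF that], of "cmod c"] hnorm_scale[OF bops_in[OF A that]]
    by (simp add: mult.assoc)
  with A show ?thesis
    by (intro bops_intro[where C = "cmod c * C"])
      (simp_all add: bops_in bops_add bops_scale bops_off scale_right_distrib mult.commute)
qed

lemma bops_hid: "hid H \<in> bops H"
  by (rule bops_intro[where C = 1]) (simp_all add: hid_def)

section \<open>Orthonormal bases\<close>

definition orthonormal_basis :: "'a set \<Rightarrow> 'a set \<Rightarrow> bool" where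
  "orthonormal_basis M E \<longleftrightarrow> finite E \<and> E \<subseteq> M \<and> E \<subseteq> hcarrier H \<and>
     (\<forall>e\<in>E. \<forall>f\<in>E. hinner H e f = of_bool (e = f)) \<and>
     (\<forall>x\<in>M. x = (\<Sum>e\<in>E. hscale H (hinner H x e) e))"

text \<open>Independence of B is not built in: a vector whose component u orthogonal to the previous
  ones is zero is dropped.\<close>

lemma gram_schmidt:
  assumes "finite B" "B \<subseteq> hcarrier H"
  shows "\<exists>E. finite E \<and> E \<subseteq> span B \<and> (\<forall>e\<in>E. \<forall>f\<in>E. hinner H e f = of_bool (e = f)) \<and> B \<subseteq> span E"
  using assms
proof (induction B)
  case empty
  then show ?case by (intro exI[of _ "{}"]) auto
next
  case (insert b B)
  then obtain E where E: "finite E" "E \<subseteq> span B" "\<forall>e\<in>E. \<forall>f\<in>E. hinner H e f = of_bool (e = f)" "B \<subseteq> span E"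
    by auto
  have "span B \<subseteq> hcarrier H" using insert.prems by (intro span_minimal subspace_V) auto
  then have EH: "e \<in> hcarrier H" if "e \<in> E" for e using E that by auto
  have b: "b \<in> hcarrier H" using insert by auto
  define p where "p = (\<Sum>e\<in>E. hscale H (hinner H b e) e)"
  define u where "u = b - p"
  have pH: "p \<in> hcarrier H" unfolding p_def using EH by (intro V_sum) auto
  have p: "p \<in> span E" unfolding p_def by (intro span_sum span_scale span_base)
  have EB: "E \<subseteq> span (insert b B)" using E(2) span_mono[of B "insert b B"] by auto
  then have "span E \<subseteq> span (insert b B)" by (rule span_minimal) simp
  then have pB: "p \<in> span (insert b B)" using p by auto
  have uH: "u \<in> hcarrier H" using b pH by (simp add: u_def)
  have orth: "hinner H u e = 0" if "e \<in> E" for e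
  proof -
    have "hinner H p e = (\<Sum>f\<in>E. if f = e then hinner H b e else 0)"
      unfolding p_def using that EH E(3)
      by (subst sum_left) (auto simp: scale_left intro!: sum.cong)
    also have "\<dots> = hinner H b e" using that E(1) by simp
    finally show ?thesis using b pH EH[OF that] by (simp add: u_def diff_left)
  qed
  show ?case
  proof (cases "u = 0")
    case True
    then have "b \<in> span E" using p by (simp add: u_def)
    then show ?thesis using E EB by (intro exI[of _ E]) auto
  next
    case False
    define v where "v = hscale H (1 / of_real (hnorm H u)) u"
    have un: "hnorm H u > 0" using False uH hnorm_eq_0_iff[of u] hnorm_nonneg[of u] by linarith
    have vH: "v \<in> hcarrier H" using uH by (simp add: v_def)
    have vv: "hinner H v v = 1"
      using uH un by (simp add: hinner_self hnorm_scale v_def norm_divide del: of_real_power of_real_mult)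
    have ve: "hinner H v e = 0" if "e \<in> E" for e
      using uH EH[OF that] orth[OF that] by (simp add: v_def scale_left)
    have ev: "hinner H e v = 0" if "e \<in> E" for e
      using commute[OF vH EH[OF that]] ve[OF that] by simp
    have "u \<in> span (insert b B)" unfolding u_def by (intro span_diff pB span_base) auto
    then have vB: "v \<in> span (insert b B)" unfolding v_def by (rule span_scale)
    have "u = hscale H (of_real (hnorm H u)) v" using un by (simp add: v_def)
    then have "b = p + hscale H (of_real (hnorm H u)) v" by (simp add: u_def algebra_simps)
    moreover have "p \<in> span (insert v E)" using p span_mono[of E "insert v E"] by auto
    ultimately have "b \<in> span (insert v E)" by (metis insertI1 span_add span_base span_scale)
    moreover have "B \<subseteq> span (insert v E)" using E(4) span_mono[of E "insert v E"] by blast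
    ultimately
    show ?thesis
      using E EB vB vv ve ev by (intro exI[of _ "insert v E"]) auto
  qed
qed

end


subsection \<open>Finite-dimensional spaces\<close>

locale findim_inner_space = inner_space +
  assumes findim: "finite_dimensional H"
begin

lemma orthonormal_basis_exists:
  assumes "subspace M" "M \<subseteq> hcarrier H"
  obtains E where "orthonormal_basis M E"
proof -
  obtain S where S: "finite S" "span S = hcarrier H"
    using findim by (auto simp: finite_dimensional_def)
  obtain B where B: "B \<subseteq> M" "independent B" "M \<subseteq> span B"
    using maximal_independent_subset[of M] by blast
  have "finite B" using independent_span_bound[OF S(1) B(2)] B(1) assms(2) S(2) by auto
  then obtain E where E: "finite E" "E \<subseteq> span B" "\<forall>e\<in>E. \<forall>f\<in>E. hinner H e f = of_bool (e = f)" "B \<subseteq> span E"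
    using gram_schmidt[of B] B assms by (meson order_trans)
  have EM: "E \<subseteq> M" using E(2) span_minimal[OF B(1) assms(1)] by auto
  have EH: "e \<in> hcarrier H" if "e \<in> E" for e using that EM assms by auto
  have "x = (\<Sum>e\<in>E. hscale H (hinner H x e) e)" if "x \<in> M" for x
  proof -
    have "x \<in> span E" using that B(3) span_minimal[OF E(4)] by auto
    then have "x \<in> hcarrier H \<and> x = (\<Sum>e\<in>E. hscale H (hinner H x e) e)"
    proof (induction rule: span_induct_alt)
      case base
      then show ?case using EH by simp
    next
      case (step c b x)
      then have b: "b \<in> hcarrier H" and x: "x \<in> hcarrier H" using EH by auto
      have "(\<Sum>e\<in>E. hscale H (hinner H (hscale H c b + x) e) e) =
         (\<Sum>e\<in>E. hscale H (c * hinner H b e) e) + (\<Sum>e\<in>E. hscale H (hinner H x e) e)"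
        using b x EH by (simp add: add_left scale_left scale_left_distrib sum.distrib)
      also have "(\<Sum>e\<in>E. hscale H (c * hinner H b e) e) = (\<Sum>e\<in>E. if e = b then hscale H c b else 0)"
        using E(3) step(1) by (intro sum.cong) auto
      also have "\<dots> = hscale H c b" using E(1) step(1) by simp
      finally show ?case using step b x by auto
    qed
    then show ?thesis by simp
  qed
  then show thesis using that[of E] E(1,3) EM EH unfolding orthonormal_basis_def by blast
qed

definition hbasis :: "'a set" where "hbasis = (SOME E. orthonormal_basis (hcarrier H) E)"

lemma hbasis: "orthonormal_basis (hcarrier H) hbasis"
  unfolding hbasis_def
  using orthonormal_basis_exists[OF subspace_V order_refl] by (metis someI_ex)

lemma finite_hbasis [simp]: "finite hbasis"
  and hbasis_in [simp]: "e \<in> hbasis \<Longrightarrow> e \<in> hcarrier H"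
  and hbasis_ortho: "\<lbrakk>e \<in> hbasis; f \<in> hbasis\<rbrakk> \<Longrightarrow> hinner H e f = of_bool (e = f)"
  and hbasis_expand: "x \<in> hcarrier H \<Longrightarrow> x = (\<Sum>e\<in>hbasis. hscale H (hinner H x e) e)"
  using hbasis by (auto simp: orthonormal_basis_def)

lemma hnorm_hbasis: "e \<in> hbasis \<Longrightarrow> hnorm H e = 1"
  by (simp add: hnorm_def hbasis_ortho)

lemma hnorm_coeff_le: "\<lbrakk>x \<in> hcarrier H; e \<in> hbasis\<rbrakk> \<Longrightarrow> cmod (hinner H x e) \<le> hnorm H x"
  using hinner_le[of x e] by (simp add: hnorm_hbasis)

text \<open>Expand x in \<open>hbasis\<close> and bound each coefficient by the norm of x. The
  constant is explicit because it later becomes \<open>tau\<close> and the factor in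
  \<open>energy_bound\<close>. Only values on the carrier enter, so the lemma also covers products
  of the maps \<open>S k\<close>, which are specified only there.\<close>

lemma linear_bound:
  assumes "\<And>x. x \<in> hcarrier H \<Longrightarrow> A x \<in> hcarrier H"
    "\<And>x y. \<lbrakk>x \<in> hcarrier H; y \<in> hcarrier H\<rbrakk> \<Longrightarrow> A (x + y) = A x + A y"
    "\<And>c x. x \<in> hcarrier H \<Longrightarrow> A (hscale H c x) = hscale H c (A x)"
    and x: "x \<in> hcarrier H"
  shows "hnorm H (A x) \<le> (\<Sum>e\<in>hbasis. hnorm H (A e)) * hnorm H x"
proof -
  have A0: "A 0 = 0" using assms(3)[of 0 0] by simp
  have sum: "A (sum f I) = (\<Sum>i\<in>I. A (f i))" if "\<And>i. i \<in> I \<Longrightarrow> f i \<in> hcarrier H" for f :: "'a \<Rightarrow> 'a" and I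
    using that by (induction I rule: infinite_finite_induct) (auto simp: assms(2) A0 V_sum)
  have "A x = A (\<Sum>e\<in>hbasis. hscale H (hinner H x e) e)"
    using hbasis_expand[OF x] by simp
  also have "\<dots> = (\<Sum>e\<in>hbasis. hscale H (hinner H x e) (A e))"
    by (simp add: sum assms(3))
  finally have "hnorm H (A x) \<le> (\<Sum>e\<in>hbasis. hnorm H (hscale H (hinner H x e) (A e)))"
    by (auto intro!: hnorm_sum assms(1))
  also have "\<dots> \<le> (\<Sum>e\<in>hbasis. hnorm H (A e) * hnorm H x)"
    using assms(1) hnorm_coeff_le[OF x]
    by (intro sum_mono) (metis hbasis_in hnorm_nonneg hnorm_scale mult.commute mult_left_mono)
  finally show ?thesis by (simp add: sum_distrib_right)
qed

lemma bopsI: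
  assumes "\<And>x. x \<in> hcarrier H \<Longrightarrow> A x \<in> hcarrier H"
    "\<And>x y. \<lbrakk>x \<in> hcarrier H; y \<in> hcarrier H\<rbrakk> \<Longrightarrow> A (x + y) = A x + A y"
    "\<And>c x. x \<in> hcarrier H \<Longrightarrow> A (hscale H c x) = hscale H c (A x)"
    "\<And>x. x \<notin> hcarrier H \<Longrightarrow> A x = 0"
  shows "A \<in> bops H"
  using assms(1-3) linear_bound[of A, OF assms(1-3)] assms(4) by (rule bops_intro)

section \<open>Functionals and adjoints\<close>

lemma riesz:
  assumes "linear_functional_on (hscale H) (hcarrier H) l"
  obtains v where "v \<in> hcarrier H" "\<And>x. x \<in> hcarrier H \<Longrightarrow> l x = hinner H x v"
proof
  define v where "v = (\<Sum>e\<in>hbasis. hscale H (cnj (l e)) e)"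
  show "v \<in> hcarrier H" unfolding v_def by (intro V_sum) auto
  fix x assume x: "x \<in> hcarrier H"
  have l0: "l 0 = 0" using assms V_closed(1) unfolding linear_functional_on_def
    by (metis add.right_neutral add_left_cancel)
  have sum: "l (sum f I) = (\<Sum>i\<in>I. l (f i))" if "\<And>i. i \<in> I \<Longrightarrow> f i \<in> hcarrier H" for f :: "'a \<Rightarrow> 'a" and I
    using that assms by (induction I rule: infinite_finite_induct) (auto simp: linear_functional_on_def l0 V_sum)
  have "l x = l (\<Sum>e\<in>hbasis. hscale H (hinner H x e) e)"
    using hbasis_expand[OF x] by simp
  also have "\<dots> = (\<Sum>e\<in>hbasis. hinner H x e * l e)"
    using assms by (simp add: sum linear_functional_on_def)
  also have "\<dots> = hinner H x v"
    unfolding v_def using x by (subst sum_right) (auto simp: scale_right mult.commute)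
  finally show "l x = hinner H x v" .
qed

text \<open>\<open>hadj\<close> is a definite description, so both halves are needed to use it. The
  witness is the expansion of the adjoint, whose coefficient at e is <y, A e>; uniqueness as a
  function holds because members of \<open>bops\<close> vanish off the carrier.\<close>

lemma hadj_exists:
  assumes "A \<in> bops H"
  shows "\<exists>!B. B \<in> bops H \<and> (\<forall>x\<in>hcarrier H. \<forall>y\<in>hcarrier H. hinner H (A x) y = hinner H x (B y))"
proof (rule ex_ex1I)
  define B where "B = (\<lambda>y. if y \<in> hcarrier H then \<Sum>e\<in>hbasis. hscale H (hinner H y (A e)) e else 0)"
  have "B \<in> bops H"
    by (rule bopsI) (simp_all add: B_def add_left scale_left scale_left_distrib bops_in[OF assms]
        sum.distrib scale_sum_right V_sum)
  moreover have "hinner H (A x) y = hinner H x (B y)" if "x \<in> hcarrier H" "y \<in> hcarrier H" for x y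
  proof -
    have "hinner H (A x) y = hinner H (A (\<Sum>e\<in>hbasis. hscale H (hinner H x e) e)) y"
      using hbasis_expand[OF that(1)] by simp
    also have "\<dots> = (\<Sum>e\<in>hbasis. hinner H x e * hinner H (A e) y)"
      using that by (subst bops_sum[OF assms], simp, subst sum_left)
        (auto simp: bops_scale[OF assms] bops_in[OF assms] scale_left)
    also have "\<dots> = hinner H x (B y)"
      using that commute[OF that(2) bops_in[OF assms]]
      by (simp add: B_def, subst sum_right) (auto simp: scale_right mult.commute)
    finally show ?thesis .
  qed
  ultimately show "\<exists>B. B \<in> bops H \<and> (\<forall>x\<in>hcarrier H. \<forall>y\<in>hcarrier H. hinner H (A x) y = hinner H x (B y))"
    by blast
next
  fix B C
  assume B: "B \<in> bops H \<and> (\<forall>x\<in>hcarrier H. \<forall>y\<in>hcarrier H. hinner H (A x) y = hinner H x (B y))"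
    and C: "C \<in> bops H \<and> (\<forall>x\<in>hcarrier H. \<forall>y\<in>hcarrier H. hinner H (A x) y = hinner H x (C y))"
  show "B = C"
  proof
    fix y
    show "B y = C y"
    proof (cases "y \<in> hcarrier H")
      case True
      have "hinner H (B y) x = hinner H (C y) x" if "x \<in> hcarrier H" for x
        using that True B C commute[of x "B y"] commute[of x "C y"] by (metis bops_in)
      then show ?thesis using True B C by (intro eq_if_hinner_eq) (auto intro: bops_in)
    qed (use B C bops_off in metis)
  qed
qed

lemma hadj_bops: "A \<in> bops H \<Longrightarrow> hadj H A \<in> bops H"
  and hinner_hadj: "\<lbrakk>A \<in> bops H; x \<in> hcarrier H; y \<in> hcarrier H\<rbrakk> \<Longrightarrow> hinner H (A x) y = hinner H x (hadj H A y)"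
  unfolding hadj_def using theI'[OF hadj_exists] by blast+

lemma hadj_unique:
  assumes "A \<in> bops H" "y \<in> hcarrier H" "z \<in> hcarrier H"
    "\<And>x. x \<in> hcarrier H \<Longrightarrow> hinner H (A x) y = hinner H x z"
  shows "hadj H A y = z"
proof (rule eq_if_hinner_eq)
  show *: "hadj H A y \<in> hcarrier H" using bops_in[OF hadj_bops[OF assms(1)] assms(2)] .
  fix x assume "x \<in> hcarrier H"
  then show "hinner H (hadj H A y) x = hinner H z x"
    using assms(4)[of x] hinner_hadj[OF assms(1) _ assms(2), of x] commute[of x] assms(3) * by metis
qed fact

section \<open>Orthogonal projections\<close>

lemma hproj_exists:
  assumes "subspace M" "M \<subseteq> hcarrier H" "x \<in> hcarrier H"
  shows "\<exists>!y. y \<in> M \<and> (\<forall>z\<in>M. hinner H (x - y) z = 0)"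
proof (rule ex_ex1I)
  obtain E where "orthonormal_basis M E"
    using orthonormal_basis_exists[OF assms(1,2)] .
  then have E: "finite E" "E \<subseteq> M" "E \<subseteq> hcarrier H" "\<forall>e\<in>E. \<forall>f\<in>E. hinner H e f = of_bool (e = f)"
     "\<forall>x\<in>M. x = (\<Sum>e\<in>E. hscale H (hinner H x e) e)"
    unfolding orthonormal_basis_def by blast+
  define y where "y = (\<Sum>e\<in>E. hscale H (hinner H x e) e)"
  have y: "y \<in> M" unfolding y_def using E(2) by (intro subspace_sum subspace_scale assms) auto
  have EH: "e \<in> hcarrier H" if "e \<in> E" for e using that E by auto
  have orth: "hinner H (x - y) e = 0" if "e \<in> E" for e
  proof -
    have "hinner H y e = (\<Sum>f\<in>E. if f = e then hinner H x e else 0)"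
      unfolding y_def using that EH E(4)
      by (subst sum_left) (auto simp: scale_left intro!: sum.cong)
    also have "\<dots> = hinner H x e" using that E(1) by simp
    finally show ?thesis using assms y EH[OF that] by (auto simp: diff_left)
  qed
  have "hinner H (x - y) z = 0" if "z \<in> M" for z
  proof -
    have "hinner H (x - y) z = hinner H (x - y) (\<Sum>e\<in>E. hscale H (hinner H z e) e)"
      using E(5) that by auto
    also have "\<dots> = 0" using y assms EH
      by (subst sum_right) (auto simp: scale_right orth subset_iff)
    finally show ?thesis .
  qed
  with y show "\<exists>y. y \<in> M \<and> (\<forall>z\<in>M. hinner H (x - y) z = 0)" by blast
next
  fix y z
  assume y: "y \<in> M \<and> (\<forall>w\<in>M. hinner H (x - y) w = 0)"
    and z: "z \<in> M \<and> (\<forall>w\<in>M. hinner H (x - z) w = 0)"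
  have yz: "y - z \<in> M" using y z assms(1) by (auto intro: subspace_diff)
  have "hinner H (y - z) (y - z) = hinner H ((x - z) - (x - y)) (y - z)" by simp
  also have "\<dots> = hinner H (x - z) (y - z) - hinner H (x - y) (y - z)"
    using y z yz assms by (intro diff_left) auto
  also have "\<dots> = 0" using y z yz by auto
  finally show "y = z" using pos_def[of "y - z"] yz assms(2) by force
qed

lemma hproj_in: "\<lbrakk>subspace M; M \<subseteq> hcarrier H; x \<in> hcarrier H\<rbrakk> \<Longrightarrow> hproj H M x \<in> M"
  and hproj_orth: "\<lbrakk>subspace M; M \<subseteq> hcarrier H; x \<in> hcarrier H; z \<in> M\<rbrakk> \<Longrightarrow> hinner H (x - hproj H M x) z = 0"
  unfolding hproj_def using theI'[OF hproj_exists] by blast+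

lemma hproj_unique:
  "\<lbrakk>subspace M; M \<subseteq> hcarrier H; x \<in> hcarrier H; y \<in> M; \<And>z. z \<in> M \<Longrightarrow> hinner H x z = hinner H y z\<rbrakk>
    \<Longrightarrow> hproj H M x = y"
  unfolding hproj_def
  by (rule the1_equality[OF hproj_exists]) (auto simp: diff_left subset_iff)

lemma hinner_hproj: "\<lbrakk>subspace M; M \<subseteq> hcarrier H; x \<in> hcarrier H; z \<in> M\<rbrakk> \<Longrightarrow> hinner H (hproj H M x) z = hinner H x z"
  using hproj_orth[of M x z] hproj_in[of M x] by (auto simp: diff_left subset_iff)

text \<open>This removes the closure from the definition of a cyclic tuple. The distance from x to M
  is attained at the projection of x, so a point that M approximates equals its projection.\<close>

lemma hclosure_full_imp_eq:
  assumes "subspace M" "M \<subseteq> hcarrier H" "hclosure H M = hcarrier H"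
  shows "M = hcarrier H"
proof
  show "hcarrier H \<subseteq> M"
  proof
    fix x assume x: "x \<in> hcarrier H"
    define u where "u = x - hproj H M x"
    have p: "hproj H M x \<in> M" using assms x by (intro hproj_in)
    then have uH: "u \<in> hcarrier H" using assms x by (auto simp: u_def)
    have le: "hnorm H u \<le> hnorm H (x - y)" if "y \<in> M" for y
    proof -
      have d: "hproj H M x - y \<in> M" using p that assms by (auto intro: subspace_diff)
      then have dH: "hproj H M x - y \<in> hcarrier H" using assms by auto
      have o: "hinner H u (hproj H M x - y) = 0" unfolding u_def using assms x d by (intro hproj_orth)
      have xy: "x - y = u + (hproj H M x - y)" by (simp add: u_def)
      have "(hnorm H (x - y))\<^sup>2 = (hnorm H u)\<^sup>2 + (hnorm H (hproj H M x - y))\<^sup>2"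
        unfolding xy using uH dH o commute[OF uH dH] by (simp add: hnorm_power2 add_left add_right)
      then have "(hnorm H u)\<^sup>2 \<le> (hnorm H (x - y))\<^sup>2" by simp
      moreover have "0 \<le> hnorm H (x - y)" using x that assms by (intro hnorm_nonneg) auto
      ultimately show ?thesis by (rule power2_le_imp_le)
    qed
    have "hnorm H u = 0"
    proof (rule ccontr)
      assume "hnorm H u \<noteq> 0"
      then have "hnorm H u > 0" using hnorm_nonneg[OF uH] by linarith
      moreover have "x \<in> hclosure H M" using assms x by simp
      ultimately obtain y where "y \<in> M" "hnorm H (x - y) < hnorm H u"
        by (auto simp: hclosure_def)
      with le show False by force
    qed
    then have "u = 0" using uH hnorm_eq_0_iff by simp
    then show "x \<in> M" using p by (simp add: u_def)
  qed
qed fact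

end


subsection \<open>Sums over multi-indices\<close>

definition bump :: "'d \<Rightarrow> ('d \<Rightarrow> nat) \<Rightarrow> 'd \<Rightarrow> nat" where
  "bump k \<alpha> = \<alpha>(k := Suc (\<alpha> k))"

definition midx :: "nat \<Rightarrow> ('d::finite \<Rightarrow> nat) set" where
  "midx n = {\<alpha>. (\<Sum>i\<in>UNIV. \<alpha> i) = n}"

lemma bump_apply: "bump k \<alpha> i = (if i = k then Suc (\<alpha> i) else \<alpha> i)"
  by (simp add: bump_def)

lemma inj_bump: "inj (bump k)"
  by (rule inj_on_inverseI[where g = "\<lambda>\<gamma>. \<gamma>(k := \<gamma> k - 1)"]) (auto simp: bump_def)

lemma range_bump: "range (bump k) = {\<gamma>. \<gamma> k \<noteq> 0}"
proof (intro equalityI subsetI)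
  fix \<gamma> :: "'a \<Rightarrow> nat" assume "\<gamma> \<in> {\<gamma>. \<gamma> k \<noteq> 0}"
  then have "\<gamma> = bump k (\<gamma>(k := \<gamma> k - 1))" by (auto simp: bump_def fun_eq_iff)
  then show "\<gamma> \<in> range (bump k)" by blast
qed (auto simp: bump_def)

lemma sum_bump: "(\<Sum>i\<in>UNIV. bump k \<alpha> i) = Suc (\<Sum>i\<in>UNIV. \<alpha> (i::'d::finite))"
  by (simp add: sum.remove[of UNIV k] bump_apply)

lemma prod_bump:
  "(\<Prod>i\<in>UNIV. x i ^ bump k \<alpha> i) = x k * (\<Prod>i\<in>UNIV. (x i :: 'b::comm_monoid_mult) ^ \<alpha> (i::'d::finite))"
proof -
  have "(\<Prod>i\<in>UNIV - {k}. x i ^ bump k \<alpha> i) = (\<Prod>i\<in>UNIV - {k}. x i ^ \<alpha> i)"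
    by (intro prod.cong) (auto simp: bump_apply)
  then show ?thesis by (simp add: prod.remove[of UNIV k] bump_apply mult.assoc)
qed

lemma finite_le_idx: "finite {\<alpha> :: 'd::finite \<Rightarrow> nat. \<alpha> \<le> \<gamma>}"
proof -
  have "{\<alpha>. \<alpha> \<le> \<gamma>} = PiE UNIV (\<lambda>i. {..\<gamma> i})" by (auto simp: le_fun_def PiE_def)
  then show ?thesis by (simp add: finite_PiE)
qed

lemma finite_midx [simp]: "finite (midx n)"
proof (rule finite_subset[OF _ finite_le_idx[of "\<lambda>_. n"]])
  show "midx n \<subseteq> {\<alpha>. \<alpha> \<le> (\<lambda>_. n)}"
    by (auto simp: midx_def le_fun_def intro: member_le_sum)
qed

lemma da_weight_pos: "da_weight \<alpha> > 0"
  by (simp add: da_weight_def prod_pos)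

lemma da_weight_bump:
  "da_weight (bump k \<alpha>) = da_weight \<alpha> * (real (Suc (\<alpha> k)) / real (Suc (\<Sum>i\<in>UNIV. \<alpha> i)))"
proof -
  have "(\<Prod>i\<in>UNIV - {k}. fact (bump k \<alpha> i)) = (\<Prod>i\<in>UNIV - {k}. fact (\<alpha> i) :: real)"
    by (intro prod.cong) (auto simp: bump_apply)
  then show ?thesis unfolding da_weight_def sum_bump
    by (simp add: prod.remove[of UNIV k] bump_apply mult_ac)
qed

text \<open>This is why multiplication by a coordinate function is contractive on the Drury-Arveson
  space.\<close>

lemma da_weight_bump_le: "da_weight (bump k \<alpha>) \<le> da_weight \<alpha>"
proof -
  have "\<alpha> k \<le> (\<Sum>i\<in>UNIV. \<alpha> i)" by (rule member_le_sum) auto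
  then have "real (Suc (\<alpha> k)) / real (Suc (\<Sum>i\<in>UNIV. \<alpha> i)) \<le> 1" by (simp del: of_nat_Suc of_nat_sum)
  then show ?thesis unfolding da_weight_bump
    using da_weight_pos[of \<alpha>] by (intro mult_left_le) auto
qed

text \<open>Pascal's rule for the multinomial coefficients \<open>1 / da_weight \<alpha>\<close>.\<close>

lemma sum_midx_Suc:
  fixes g :: "('d::finite \<Rightarrow> nat) \<Rightarrow> 'b::real_vector"
  shows "(\<Sum>\<gamma>\<in>midx (Suc n). inverse (da_weight \<gamma>) *\<^sub>R g \<gamma>) =
     (\<Sum>k\<in>UNIV. \<Sum>\<alpha>\<in>midx n. inverse (da_weight \<alpha>) *\<^sub>R g (bump k \<alpha>))"
proof -
  \<comment> \<open>The substitution \<gamma> = \<open>bump k \<alpha>\<close> produces the factor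
    \<gamma> k / (n + 1), which kills the indices outside the range of \<open>bump k\<close>. Over
    all k these factors add up to 1.\<close>
  have *: "(\<Sum>\<alpha>\<in>midx n. inverse (da_weight \<alpha>) *\<^sub>R g (bump k \<alpha>)) =
      (\<Sum>\<gamma>\<in>midx (Suc n). (real (\<gamma> k) / real (Suc n)) *\<^sub>R (inverse (da_weight \<gamma>) *\<^sub>R g \<gamma>))" for k
  proof -
    have "(\<Sum>\<gamma>\<in>midx (Suc n). (real (\<gamma> k) / real (Suc n)) *\<^sub>R (inverse (da_weight \<gamma>) *\<^sub>R g \<gamma>)) =
       (\<Sum>\<gamma>\<in>bump k ` midx n. (real (\<gamma> k) / real (Suc n)) *\<^sub>R (inverse (da_weight \<gamma>) *\<^sub>R g \<gamma>))"
    proof (rule sum.mono_neutral_right)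
      show "bump k ` midx n \<subseteq> midx (Suc n)" by (auto simp: midx_def sum_bump)
      have "\<gamma> k = 0" if "\<gamma> \<in> midx (Suc n)" "\<gamma> \<notin> bump k ` midx n" for \<gamma>
      proof (rule ccontr)
        assume "\<gamma> k \<noteq> 0"
        then obtain \<alpha> where "\<gamma> = bump k \<alpha>" using range_bump[of k] by auto
        with that show False by (auto simp: midx_def sum_bump)
      qed
      then show "\<forall>\<gamma>\<in>midx (Suc n) - bump k ` midx n.
          (real (\<gamma> k) / real (Suc n)) *\<^sub>R (inverse (da_weight \<gamma>) *\<^sub>R g \<gamma>) = 0" by auto
    qed simp
    also have "\<dots> = (\<Sum>\<alpha>\<in>midx n. (real (Suc (\<alpha> k)) / real (Suc n)) *\<^sub>R (inverse (da_weight (bump k \<alpha>)) *\<^sub>R g (bump k \<alpha>)))"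
      by (subst sum.reindex) (auto intro: inj_on_subset[OF inj_bump] simp: bump_apply)
    also have "\<dots> = (\<Sum>\<alpha>\<in>midx n. inverse (da_weight \<alpha>) *\<^sub>R g (bump k \<alpha>))"
      by (intro sum.cong) (auto simp: midx_def da_weight_bump inverse_eq_divide simp del: of_nat_Suc)
    finally show ?thesis by simp
  qed
  have "(\<Sum>k\<in>UNIV. \<Sum>\<alpha>\<in>midx n. inverse (da_weight \<alpha>) *\<^sub>R g (bump k \<alpha>)) =
    (\<Sum>\<gamma>\<in>midx (Suc n). (\<Sum>k\<in>UNIV. real (\<gamma> k) / real (Suc n)) *\<^sub>R (inverse (da_weight \<gamma>) *\<^sub>R g \<gamma>))"
    unfolding * scaleR_sum_left by (rule sum.swap)
  also have "\<dots> = (\<Sum>\<gamma>\<in>midx (Suc n). inverse (da_weight \<gamma>) *\<^sub>R g \<gamma>)"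
  proof (intro sum.cong refl)
    fix \<gamma> :: "'d \<Rightarrow> nat" assume "\<gamma> \<in> midx (Suc n)"
    then have "(\<Sum>k\<in>UNIV. real (\<gamma> k)) = real (Suc n)" by (simp add: midx_def flip: of_nat_sum)
    then show "(\<Sum>k\<in>UNIV. real (\<gamma> k) / real (Suc n)) *\<^sub>R (inverse (da_weight \<gamma>) *\<^sub>R g \<gamma>) = inverse (da_weight \<gamma>) *\<^sub>R g \<gamma>"
      by (simp add: sum_divide_distrib[symmetric] del: of_nat_Suc)
  qed
  finally show ?thesis by simp
qed

lemma midx_0: "midx 0 = {\<lambda>_. 0}"
  by (auto simp: midx_def)

lemma da_weight_0: "da_weight (\<lambda>_. 0) = 1"
  by (simp add: da_weight_def)

section \<open>Sums over words\<close>

lemma words_Suc: "{w :: 'd list. length w = Suc n} = (\<lambda>(k, w). k # w) ` (UNIV \<times> {w. length w = n})"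
  by (auto simp: length_Suc_conv)

lemma sum_words_Suc:
  "(\<Sum>w | length w = Suc n. f w) = (\<Sum>k\<in>UNIV. \<Sum>w | length w = n. f (k # (w :: 'd::finite list)))"
  unfolding words_Suc by (subst sum.reindex) (auto simp: inj_on_def sum.cartesian_product case_prod_beta)

lemma count_list_Cons: "count_list (k # w) = bump k (count_list w)"
  by (auto simp: bump_def fun_eq_iff)

text \<open>The number of words with letter counts \<alpha> is the multinomial coefficient
  \<open>1 / da_weight \<alpha>\<close>. No counting takes place: splitting off the first letter
  gives both sides the same recursion.\<close>

lemma sum_words:
  fixes g :: "('d::finite \<Rightarrow> nat) \<Rightarrow> 'b::real_vector"
  shows "(\<Sum>w | length w = n. g (count_list w)) = (\<Sum>\<alpha>\<in>midx n. inverse (da_weight \<alpha>) *\<^sub>R g \<alpha>)"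
proof (induction n arbitrary: g)
  case 0
  have "count_list [] = (\<lambda>_::'d. 0::nat)" by (simp add: fun_eq_iff)
  then show ?case by (simp add: midx_0 da_weight_0)
next
  case (Suc n)
  show ?case
    unfolding sum_words_Suc sum_midx_Suc count_list_Cons by (intro sum.cong refl Suc)
qed

lemma multinomial:
  "(\<Sum>\<alpha>\<in>midx n. inverse (da_weight \<alpha>) * (\<Prod>i\<in>UNIV. v i ^ \<alpha> i)) = (\<Sum>i\<in>UNIV. v (i::'d::finite) :: real) ^ n"
proof (induction n)
  case 0
  then show ?case by (simp add: midx_0 da_weight_0)
next
  case (Suc n)
  have "(\<Sum>\<alpha>\<in>midx (Suc n). inverse (da_weight \<alpha>) * (\<Prod>i\<in>UNIV. v i ^ \<alpha> i)) =
     (\<Sum>k\<in>UNIV. v k * (\<Sum>\<alpha>\<in>midx n. inverse (da_weight \<alpha>) * (\<Prod>i\<in>UNIV. v i ^ \<alpha> i)))"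
    using sum_midx_Suc[of "\<lambda>\<alpha>. \<Prod>i\<in>UNIV. v i ^ \<alpha> i" n]
    by (simp add: prod_bump sum_distrib_left mult.left_commute)
  then show ?case by (simp add: Suc sum_distrib_right)
qed

lemma graded_summable:
  fixes g :: "('d::finite \<Rightarrow> nat) \<Rightarrow> real"
  assumes "\<And>\<alpha>. 0 \<le> g \<alpha>" "summable (\<lambda>n. \<Sum>\<alpha>\<in>midx n. g \<alpha>)"
  shows "g summable_on UNIV"
proof (rule nonneg_bdd_above_summable_on)
  show "bdd_above (sum g ` {F. F \<subseteq> UNIV \<and> finite F})"
  proof (rule bdd_aboveI2)
    fix F :: "('d \<Rightarrow> nat) set" assume "F \<in> {F. F \<subseteq> UNIV \<and> finite F}"
    then have F: "finite F" by simp
    define N where "N = Suc (Max (insert 0 ((\<lambda>\<alpha>. \<Sum>i\<in>UNIV. \<alpha> i) ` F)))"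
    have FN: "F \<subseteq> (\<Union>n<N. midx n)"
    proof
      fix \<alpha> assume "\<alpha> \<in> F"
      then have "(\<Sum>i\<in>UNIV. \<alpha> i) < N" unfolding N_def using F by (auto simp: less_Suc_eq_le intro: Max_ge)
      then show "\<alpha> \<in> (\<Union>n<N. midx n)" by (auto simp: midx_def)
    qed
    have "sum g F \<le> sum g (\<Union>n<N. midx n)"
      using FN assms(1) by (intro sum_mono2) auto
    also have "\<dots> = (\<Sum>n<N. \<Sum>\<alpha>\<in>midx n. g \<alpha>)"
      by (rule sum.UNION_disjoint) (auto, auto simp: midx_def)
    also have "\<dots> \<le> (\<Sum>n. \<Sum>\<alpha>\<in>midx n. g \<alpha>)"
      by (rule sum_le_suminf) (auto intro: assms sum_nonneg)
    finally show "sum g F \<le> (\<Sum>n. \<Sum>\<alpha>\<in>midx n. g \<alpha>)" .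
  qed
qed (use assms in auto)

lemma graded_sums:
  fixes g :: "('d::finite \<Rightarrow> nat) \<Rightarrow> 'b::real_normed_vector"
  assumes "(g has_sum S) UNIV"
  shows "(\<lambda>n. \<Sum>\<alpha>\<in>midx n. g \<alpha>) sums S"
proof -
  have "((\<lambda>(n, \<alpha>). g \<alpha>) has_sum S) (Sigma UNIV midx)"
    using assms
    by (subst has_sum_reindex_bij_witness[where i = "\<lambda>\<alpha>. (\<Sum>i\<in>UNIV. \<alpha> i, \<alpha>)" and j = snd and h = g and T = UNIV and s' = S])
       (auto simp: midx_def)
  then have "((\<lambda>n. \<Sum>\<alpha>\<in>midx n. g \<alpha>) has_sum S) UNIV"
    by (rule has_sum_SigmaD) auto
  then show ?thesis by (rule has_sum_imp_sums)
qed


subsection \<open>Square summable coefficients\<close>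

definition l2_coeff :: "(('d::finite \<Rightarrow> nat) \<Rightarrow> complex) \<Rightarrow> bool" where
  "l2_coeff c \<longleftrightarrow> (\<lambda>\<alpha>. da_weight \<alpha> * (cmod (c \<alpha>))\<^sup>2) summable_on UNIV"

lemma weighted_product_le: "w > 0 \<Longrightarrow> a * b \<le> w * a\<^sup>2 + b\<^sup>2 / (w::real)"
proof -
  assume w: "w > 0"
  \<comment> \<open>Twice the difference between (w a)^2 + b^2 and w a b.\<close>
  have "0 \<le> (w * a - b)\<^sup>2 + (w * a)\<^sup>2 + b\<^sup>2" by simp
  then have "w * (a * b) \<le> w * (w * a\<^sup>2 + b\<^sup>2 / w)"
    using w by (simp add: power2_eq_square algebra_simps)
  with w show ?thesis by simp
qed

text \<open>The weight w is paired with its reciprocal. The lemma is applied with t the modulus of a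
  monomial (convergence on the ball), with t = w |b| (inner products) and with t =
  \<open>tau\<close> (operators).\<close>

lemma l2_coeff_dual:
  assumes "l2_coeff c" "(\<lambda>\<alpha>. (t \<alpha>)\<^sup>2 / da_weight \<alpha>) summable_on UNIV" "\<And>\<alpha>. 0 \<le> t \<alpha>"
  shows "(\<lambda>\<alpha>. cmod (c \<alpha>) * t \<alpha>) summable_on UNIV"
proof (rule summable_on_comparison_test)
  show "(\<lambda>\<alpha>. da_weight \<alpha> * (cmod (c \<alpha>))\<^sup>2 + (t \<alpha>)\<^sup>2 / da_weight \<alpha>) summable_on UNIV"
    using assms by (intro summable_on_add) (auto simp: l2_coeff_def)
qed (use assms in \<open>auto intro: weighted_product_le da_weight_pos\<close>)

lemma l2_coeff_add: assumes "l2_coeff a" "l2_coeff b" shows "l2_coeff (\<lambda>\<alpha>. a \<alpha> + b \<alpha>)"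
  unfolding l2_coeff_def
proof (rule summable_on_comparison_test)
  show "(\<lambda>\<alpha>. 2 * (da_weight \<alpha> * (cmod (a \<alpha>))\<^sup>2) + 2 * (da_weight \<alpha> * (cmod (b \<alpha>))\<^sup>2)) summable_on UNIV"
    using assms by (intro summable_on_add summable_on_cmult_right) (auto simp: l2_coeff_def)
  fix \<alpha>
  have "(cmod (a \<alpha> + b \<alpha>))\<^sup>2 \<le> (cmod (a \<alpha>) + cmod (b \<alpha>))\<^sup>2"
    by (intro power_mono norm_triangle_ineq) auto
  also have "\<dots> \<le> 2 * (cmod (a \<alpha>))\<^sup>2 + 2 * (cmod (b \<alpha>))\<^sup>2"
    using sum_squares_bound[of "cmod (a \<alpha>)" "cmod (b \<alpha>)"] by (simp add: power2_sum)
  finally show "da_weight \<alpha> * (cmod (a \<alpha> + b \<alpha>))\<^sup>2 \<le>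
      2 * (da_weight \<alpha> * (cmod (a \<alpha>))\<^sup>2) + 2 * (da_weight \<alpha> * (cmod (b \<alpha>))\<^sup>2)"
    using mult_left_mono[of _ _ "da_weight \<alpha>"] da_weight_pos[of \<alpha>] by (fastforce simp: algebra_simps)
qed (simp add: da_weight_pos less_imp_le)

lemma l2_coeff_cmult: assumes "l2_coeff a" shows "l2_coeff (\<lambda>\<alpha>. c * a \<alpha>)"
proof -
  have "(\<lambda>\<alpha>. (cmod c)\<^sup>2 * (da_weight \<alpha> * (cmod (a \<alpha>))\<^sup>2)) summable_on UNIV"
    using assms by (intro summable_on_cmult_right) (auto simp: l2_coeff_def)
  then show ?thesis by (simp add: l2_coeff_def norm_mult power_mult_distrib mult_ac)
qed

lemma l2_coeff_inner:
  assumes "l2_coeff a" "l2_coeff b"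
  shows "(\<lambda>\<alpha>. of_real (da_weight \<alpha>) * a \<alpha> * cnj (b \<alpha>)) summable_on UNIV"
proof -
  have "(\<lambda>\<alpha>. cmod (a \<alpha>) * (da_weight \<alpha> * cmod (b \<alpha>))) summable_on UNIV"
  proof (rule l2_coeff_dual[OF assms(1)])
    have "(da_weight \<alpha> * cmod (b \<alpha>))\<^sup>2 / da_weight \<alpha> = da_weight \<alpha> * (cmod (b \<alpha>))\<^sup>2" for \<alpha>
      using da_weight_pos[of \<alpha>] by (simp add: power2_eq_square)
    then show "(\<lambda>\<alpha>. (da_weight \<alpha> * cmod (b \<alpha>))\<^sup>2 / da_weight \<alpha>) summable_on UNIV"
      using assms(2) by (simp add: l2_coeff_def)
  qed (simp add: da_weight_pos less_imp_le)
  then have "(\<lambda>\<alpha>. norm (of_real (da_weight \<alpha>) * a \<alpha> * cnj (b \<alpha>))) summable_on UNIV"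
    by (simp add: norm_mult abs_of_pos[OF da_weight_pos] mult_ac)
  then show ?thesis by (rule Infinite_Sum.abs_summable_summable)
qed

lemma mmonom_bump: "mmonom (bump k \<alpha>) x = (x $ k) * mmonom \<alpha> x"
  unfolding mmonom_def by (rule prod_bump)

lemma mmonom_add: "mmonom (\<alpha> + \<beta>) x = mmonom \<alpha> x * mmonom \<beta> x"
  by (simp add: mmonom_def power_add prod.distrib)

lemma norm_power2_vec: "(norm (x :: complex ^ 'd::finite))\<^sup>2 = (\<Sum>i\<in>UNIV. (cmod (x $ i))\<^sup>2)"
  by (simp add: norm_vec_def L2_set_def sum_nonneg)

text \<open>By the multinomial theorem the part of degree n is |x|^(2n), so the sum is the geometric
  series 1 / (1 - |x|^2), the reproducing kernel at (x, x).\<close>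

lemma monomials_summable:
  assumes "x \<in> ball (0 :: complex ^ 'd::finite) 1"
  shows "(\<lambda>\<alpha>. (cmod (mmonom \<alpha> x))\<^sup>2 / da_weight \<alpha>) summable_on UNIV"
proof (rule graded_summable)
  have "(\<Sum>\<alpha>\<in>midx n. (cmod (mmonom \<alpha> x))\<^sup>2 / da_weight \<alpha>) = ((norm x)\<^sup>2) ^ n" for n
  proof -
    have "(cmod (mmonom \<alpha> x))\<^sup>2 = (\<Prod>i\<in>UNIV. (cmod (x $ i))\<^sup>2 ^ \<alpha> i)" for \<alpha>
      by (simp add: mmonom_def prod_norm[symmetric] norm_power prod_power_distrib mult.commute flip: power_mult)
    then show ?thesis
      using multinomial[of "\<lambda>i. (cmod (x $ i))\<^sup>2" n] by (simp add: norm_power2_vec divide_inverse mult.commute)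
  qed
  moreover have "summable (\<lambda>n. ((norm x)\<^sup>2) ^ n)"
    using assms by (intro summable_geometric) (simp add: power_less_one_iff abs_square_less_1)
  ultimately show "summable (\<lambda>n. \<Sum>\<alpha>\<in>midx n. (cmod (mmonom \<alpha> x))\<^sup>2 / da_weight \<alpha>)" by simp
qed (simp add: da_weight_pos less_imp_le)

lemma l2_coeff_power_series:
  assumes "l2_coeff c" "x \<in> ball 0 1"
  shows "(\<lambda>\<alpha>. norm (c \<alpha> * mmonom \<alpha> x)) summable_on UNIV"
  using l2_coeff_dual[OF assms(1) monomials_summable[OF assms(2)]] by (simp add: norm_mult)


subsection \<open>Uniqueness of power series coefficients\<close>

lemma inj_primes: "\<exists>p :: 'd::finite \<Rightarrow> nat. inj p \<and> (\<forall>i. prime (p i))"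
proof -
  obtain h :: "'d \<Rightarrow> nat" where h: "inj h"
    using finite_imp_inj_to_nat_seg[of "UNIV :: 'd set"] by auto
  define p where "p = enumerate {p::nat. prime p} \<circ> h"
  have inf: "infinite {p::nat. prime p}" by (rule primes_infinite)
  have "inj (enumerate {p::nat. prime p})"
    using strict_mono_enumerate[OF inf] by (rule strict_mono_imp_inj_on)
  then have "inj p" unfolding p_def using h by (intro inj_compose)
  moreover have "prime (p i)" for i
    using enumerate_in_set[OF inf, of "h i"] by (simp add: p_def)
  ultimately show ?thesis by blast
qed

lemma inj_prime_products:
  fixes p :: "'d::finite \<Rightarrow> nat"
  assumes p: "inj p" "\<And>i. prime (p i)"
  shows "inj (\<lambda>\<alpha> :: 'd \<Rightarrow> nat. \<Prod>i\<in>UNIV. p i ^ \<alpha> i)"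
proof (rule injI)
  fix \<alpha> \<beta> :: "'d \<Rightarrow> nat"
  assume eq: "(\<Prod>i\<in>UNIV. p i ^ \<alpha> i) = (\<Prod>i\<in>UNIV. p i ^ \<beta> i)"
  have mult: "multiplicity (p i) (\<Prod>i\<in>UNIV. p i ^ \<gamma> i) = \<gamma> i" for i and \<gamma> :: "'d \<Rightarrow> nat"
  proof -
    have "(\<Prod>i\<in>UNIV. p i ^ \<gamma> i) = (\<Prod>r\<in>range p. r ^ \<gamma> (inv p r))"
      by (subst prod.reindex) (auto simp: p)
    moreover have "multiplicity (p i) (\<Prod>r\<in>range p. r ^ \<gamma> (inv p r)) = \<gamma> i"
      using p by (subst multiplicity_prod_prime_powers) auto
    ultimately show ?thesis by simp
  qed
  show "\<alpha> = \<beta>"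
  proof
    show "\<alpha> i = \<beta> i" for i using mult[of i \<alpha>] mult[of i \<beta>] eq by (simp only:)
  qed
qed

text \<open>
  At the points \<open>(1 / p\<^sub>1\<^sup>k, \<dots>, 1 / p\<^sub>d\<^sup>k)\<close> with distinct primes \<open>p\<^sub>i\<close> a power series becomes a Dirichlet
  series, and unique factorization separates the monomials by size.
\<close>

lemma power_series_zero:
  fixes c :: "('d::finite \<Rightarrow> nat) \<Rightarrow> complex"
  assumes "has_power_series (\<lambda>_. 0) c"
  shows "c = (\<lambda>_. 0)"
proof (rule ccontr)
  assume "c \<noteq> (\<lambda>_. 0)"
  then have ne: "\<exists>\<alpha>. c \<alpha> \<noteq> 0" by (auto simp: fun_eq_iff)
  obtain p :: "'d \<Rightarrow> nat" where p: "inj p" "\<And>i. prime (p i)" using inj_primes by blast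
  have p2: "p i \<ge> 2" for i using p(2) by (rule prime_ge_2_nat)
  define N where "N = (\<lambda>\<alpha> :: 'd \<Rightarrow> nat. \<Prod>i\<in>UNIV. p i ^ \<alpha> i)"
  have Npos: "N \<alpha> > 0" for \<alpha> unfolding N_def using p2 by (intro prod_pos) (auto intro: less_le_trans[of 0 2])
  have injN: "N \<alpha> = N \<beta> \<longleftrightarrow> \<alpha> = \<beta>" for \<alpha> \<beta>
    using inj_prime_products[OF p] unfolding N_def by (auto simp: inj_def)
  \<comment> \<open>Among the monomials that occur, the one with the least \<open>N\<close>
    dominates for large k.\<close>
  obtain \<alpha>0 where a0: "c \<alpha>0 \<noteq> 0" and min: "\<And>\<alpha>. c \<alpha> \<noteq> 0 \<Longrightarrow> N \<alpha>0 \<le> N \<alpha>"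
    using ex_has_least_nat[of "\<lambda>\<alpha>. c \<alpha> \<noteq> 0" _ N] ne by blast
  define n0 where "n0 = real (N \<alpha>0)"
  have n0: "n0 > 0" using Npos by (simp add: n0_def)
  \<comment> \<open>Primes are at least 2, so the point for exponent k has norm at most CARD('d) /
    2^k; from K on it lies in the ball.\<close>
  obtain K where K: "real CARD('d) < 2 ^ K" using real_arch_pow[of 2 "real CARD('d)"] by auto
  \<comment> \<open>Scaling by n0^k makes the term at \<alpha>0 the constant
    \<open>c \<alpha>0\<close>.\<close>
  have series: "((\<lambda>\<alpha>. c \<alpha> * of_real ((n0 / real (N \<alpha>)) ^ k)) has_sum 0) UNIV" if "k \<ge> K" for k
  proof -
    define x :: "complex ^ 'd" where "x = (\<chi> i. 1 / of_nat (p i) ^ k)"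
    have "norm x \<le> (\<Sum>i\<in>UNIV. cmod (x $ i))" unfolding norm_vec_def by (rule L2_set_le_sum) simp
    also have "\<dots> \<le> (\<Sum>i\<in>(UNIV::'d set). 1 / 2 ^ k)"
    proof (intro sum_mono)
      fix i
      have "(2::real) ^ k \<le> real (p i) ^ k" using p2[of i] by (intro power_mono) auto
      then have "1 / real (p i) ^ k \<le> 1 / 2 ^ k" by (intro divide_left_mono) (use p2[of i] in auto)
      then show "cmod (x $ i) \<le> 1 / 2 ^ k" by (simp add: x_def norm_divide norm_power)
    qed
    also have "\<dots> = real CARD('d) / 2 ^ k" by simp
    also have "\<dots> < 1"
    proof -
      have "real CARD('d) < 2 ^ k"
        using K that power_increasing[of K k "2::real"] by linarith
      then show ?thesis by (simp only: divide_less_eq_1) simp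
    qed
    finally have "x \<in> ball 0 1" by simp
    then have "((\<lambda>\<alpha>. c \<alpha> * mmonom \<alpha> x) has_sum 0) UNIV"
      using assms by (auto simp: has_power_series_def)
    moreover have "mmonom \<alpha> x = of_real ((1 / real (N \<alpha>)) ^ k)" for \<alpha>
      by (simp add: mmonom_def x_def N_def power_divide prod_dividef prod_power_distrib mult.commute flip: power_mult)
    ultimately have "((\<lambda>\<alpha>. c \<alpha> * of_real ((1 / real (N \<alpha>)) ^ k)) has_sum 0) UNIV" by simp
    then have "((\<lambda>\<alpha>. of_real (n0 ^ k) * (c \<alpha> * of_real ((1 / real (N \<alpha>)) ^ k))) has_sum (of_real (n0 ^ k) * 0)) UNIV"
      by (rule has_sum_cmult_right)
    then show ?thesis by (simp add: power_divide mult_ac)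
  qed
  define b where "b = (\<lambda>\<alpha>. cmod (c \<alpha>) * (n0 / real (N \<alpha>)) ^ K)"
  have "(\<lambda>\<alpha>. norm (c \<alpha> * of_real ((n0 / real (N \<alpha>)) ^ K))) summable_on UNIV"
    using series[of K] by (auto simp: summable_on_iff_abs_summable_on_complex[symmetric] dest: has_sum_imp_summable)
  then have "b summable_on UNIV"
    using n0 by (simp add: b_def norm_mult norm_power norm_divide)
  then have bsum: "b summable_on (UNIV - {\<alpha>0})" by (rule summable_on_subset_banach) simp
  define S where "S = infsum b (UNIV - {\<alpha>0})"
  \<comment> \<open>\<open>N\<close> is injective with integer values, so every other monomial that
    occurs has \<open>N\<close> at least n0 + 1, and r bounds all the ratios at once.\<close>
  define r where "r = n0 / (n0 + 1)"
  have r: "0 \<le> r" "r < 1" using n0 by (auto simp: r_def)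
  have bound: "cmod (c \<alpha>0) \<le> r ^ j * S" for j
  proof -
    let ?f = "\<lambda>\<alpha>. c \<alpha> * of_real ((n0 / real (N \<alpha>)) ^ (K + j))"
    have "(?f has_sum (0 - ?f \<alpha>0)) (UNIV - {\<alpha>0})"
      by (intro has_sum_Diff[OF series] has_sum_finiteI) auto
    moreover have "0 - ?f \<alpha>0 = - c \<alpha>0" using n0 by (simp add: n0_def)
    ultimately have 1: "(?f has_sum (- c \<alpha>0)) (UNIV - {\<alpha>0})" by (simp only:)
    have 2: "((\<lambda>\<alpha>. r ^ j * b \<alpha>) has_sum (r ^ j * S)) (UNIV - {\<alpha>0})"
      using bsum unfolding S_def by (intro has_sum_cmult_right has_sum_infsum)
    have "cmod (- c \<alpha>0) \<le> r ^ j * S"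
    proof (rule norm_infsum_le[OF 1 2])
      fix \<alpha> assume "\<alpha> \<in> UNIV - {\<alpha>0}"
      then have ne: "\<alpha> \<noteq> \<alpha>0" by simp
      show "cmod (?f \<alpha>) \<le> r ^ j * b \<alpha>"
      proof (cases "c \<alpha> = 0")
        case False
        then have "N \<alpha>0 < N \<alpha>" using min[of \<alpha>] injN[of \<alpha> \<alpha>0] ne by force
        then have "n0 + 1 \<le> real (N \<alpha>)" by (simp add: n0_def)
        then have "n0 / real (N \<alpha>) \<le> r" unfolding r_def using n0 by (intro divide_left_mono) auto
        then have "(n0 / real (N \<alpha>)) ^ j \<le> r ^ j" using n0 by (intro power_mono) auto
        then have "b \<alpha> * (n0 / real (N \<alpha>)) ^ j \<le> b \<alpha> * r ^ j"
          using n0 by (intro mult_left_mono) (auto simp: b_def)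
        then show ?thesis using n0 by (simp add: b_def norm_mult norm_power norm_divide power_add mult_ac)
      qed (simp add: b_def)
    qed
    then show ?thesis by simp
  qed
  have "(\<lambda>j. r ^ j * S) \<longlonglongrightarrow> 0 * S"
    using r by (intro tendsto_mult_right LIMSEQ_realpow_zero) auto
  then have "cmod (c \<alpha>0) \<le> 0 * S"
    by (rule LIMSEQ_le_const) (use bound in auto)
  with a0 show False by simp
qed

lemma has_power_series_unique:
  assumes "has_power_series f a" "has_power_series f b"
  shows "a = b"
proof -
  have "has_power_series (\<lambda>_. 0) (\<lambda>\<alpha>. a \<alpha> - b \<alpha>)"
    unfolding has_power_series_def
  proof
    fix x :: "complex ^ 'a" assume x: "x \<in> ball 0 1"
    have "((\<lambda>\<alpha>. a \<alpha> * mmonom \<alpha> x - b \<alpha> * mmonom \<alpha> x) has_sum (f x - f x)) UNIV"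
      unfolding diff_conv_add_uminus
      using assms x by (intro has_sum_add has_sum_uminus[THEN iffD2]) (auto simp: has_power_series_def)
    then show "((\<lambda>\<alpha>. (a \<alpha> - b \<alpha>) * mmonom \<alpha> x) has_sum 0) UNIV" by (simp add: left_diff_distrib)
  qed
  from power_series_zero[OF this] show ?thesis by (simp add: fun_eq_iff)
qed

lemma da_coeff_eq: "has_power_series f c \<Longrightarrow> da_coeff f = c"
  unfolding da_coeff_def by (rule some_equality) (auto intro: has_power_series_unique)


subsection \<open>The Drury--Arveson space\<close>

lemma drury_arveson_simps [simp]:
  "hcarrier drury_arveson = da_space"
  "hscale drury_arveson = (\<lambda>c f x. c * f x)"
  "hinner drury_arveson f g = (\<Sum>\<^sub>\<infinity>\<alpha>. of_real (da_weight \<alpha>) * da_coeff f \<alpha> * cnj (da_coeff g \<alpha>))"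
  by (simp_all add: drury_arveson_def)

lemma da_spaceI:
  "\<lbrakk>\<And>x. x \<notin> ball 0 1 \<Longrightarrow> f x = 0; has_power_series f c; l2_coeff c\<rbrakk> \<Longrightarrow> f \<in> da_space"
  by (auto simp: da_space_def l2_coeff_def)

lemma da_space_off: "\<lbrakk>f \<in> da_space; x \<notin> ball 0 1\<rbrakk> \<Longrightarrow> f x = 0"
  by (auto simp: da_space_def)

lemma da_space_series: "f \<in> da_space \<Longrightarrow> has_power_series f (da_coeff f)"
  and da_space_l2: "f \<in> da_space \<Longrightarrow> l2_coeff (da_coeff f)"
  by (auto simp: da_space_def l2_coeff_def dest: da_coeff_eq)

lemma da_space_has_sum:
  "\<lbrakk>f \<in> da_space; x \<in> ball 0 1\<rbrakk> \<Longrightarrow> ((\<lambda>\<alpha>. da_coeff f \<alpha> * mmonom \<alpha> x) has_sum f x) UNIV"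
  using da_space_series unfolding has_power_series_def by blast

lemma da_space_eqI:
  assumes "f \<in> da_space" "g \<in> da_space" "da_coeff f = da_coeff g"
  shows "f = g"
proof
  fix x
  show "f x = g x"
    using da_space_has_sum[OF assms(1), of x] da_space_has_sum[OF assms(2), of x]
      da_space_off[OF assms(1), of x] da_space_off[OF assms(2), of x] assms(3) has_sum_unique
    by (cases "x \<in> ball 0 1") auto
qed

definition da_fun :: "(('d::finite \<Rightarrow> nat) \<Rightarrow> complex) \<Rightarrow> complex ^ 'd \<Rightarrow> complex" where
  "da_fun c = (\<lambda>x. if x \<in> ball 0 1 then \<Sum>\<^sub>\<infinity>\<alpha>. c \<alpha> * mmonom \<alpha> x else 0)"

lemma da_fun_series:
  assumes "l2_coeff c"
  shows "has_power_series (da_fun c) c"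
  unfolding has_power_series_def
proof
  fix x :: "complex ^ 'a" assume x: "x \<in> ball 0 1"
  show "((\<lambda>\<alpha>. c \<alpha> * mmonom \<alpha> x) has_sum da_fun c x) UNIV"
    using has_sum_infsum[OF Infinite_Sum.abs_summable_summable[OF l2_coeff_power_series[OF assms x]]] x
    by (simp add: da_fun_def)
qed

lemma da_fun_in: "l2_coeff c \<Longrightarrow> da_fun c \<in> da_space"
  by (rule da_spaceI[OF _ da_fun_series]) (auto simp: da_fun_def)

lemma da_coeff_da_fun: "l2_coeff c \<Longrightarrow> da_coeff (da_fun c) = c"
  by (intro da_coeff_eq da_fun_series)

lemma has_power_series_add:
  "\<lbrakk>has_power_series f a; has_power_series g b\<rbrakk> \<Longrightarrow> has_power_series (\<lambda>x. f x + g x) (\<lambda>\<alpha>. a \<alpha> + b \<alpha>)"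
  by (auto simp: has_power_series_def ring_distribs intro: has_sum_add)

lemma has_power_series_cmult:
  "has_power_series f a \<Longrightarrow> has_power_series (\<lambda>x. c * f x) (\<lambda>\<alpha>. c * a \<alpha>)"
  by (auto simp: has_power_series_def mult.assoc intro: has_sum_cmult_right)

lemma da_add:
  assumes "f \<in> da_space" "g \<in> da_space"
  shows "(\<lambda>x. f x + g x) \<in> da_space" "da_coeff (\<lambda>x. f x + g x) = (\<lambda>\<alpha>. da_coeff f \<alpha> + da_coeff g \<alpha>)"
proof -
  have *: "has_power_series (\<lambda>x. f x + g x) (\<lambda>\<alpha>. da_coeff f \<alpha> + da_coeff g \<alpha>)"
    by (intro has_power_series_add da_space_series assms)
  show "(\<lambda>x. f x + g x) \<in> da_space"
    using assms by (intro da_spaceI[OF _ *] l2_coeff_add da_space_l2) (auto simp: da_space_off)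
  show "da_coeff (\<lambda>x. f x + g x) = (\<lambda>\<alpha>. da_coeff f \<alpha> + da_coeff g \<alpha>)" by (rule da_coeff_eq[OF *])
qed

lemma da_cmult:
  assumes "f \<in> da_space"
  shows "(\<lambda>x. c * f x) \<in> da_space" "da_coeff (\<lambda>x. c * f x) = (\<lambda>\<alpha>. c * da_coeff f \<alpha>)"
proof -
  have *: "has_power_series (\<lambda>x. c * f x) (\<lambda>\<alpha>. c * da_coeff f \<alpha>)"
    by (intro has_power_series_cmult da_space_series assms)
  show "(\<lambda>x. c * f x) \<in> da_space"
    using assms by (intro da_spaceI[OF _ *] l2_coeff_cmult da_space_l2) (auto simp: da_space_off)
  show "da_coeff (\<lambda>x. c * f x) = (\<lambda>\<alpha>. c * da_coeff f \<alpha>)" by (rule da_coeff_eq[OF *])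
qed

lemma da_zero: "(\<lambda>x. 0) \<in> da_space"
  by (rule da_spaceI[of _ "\<lambda>_. 0"]) (auto simp: has_power_series_def l2_coeff_def)

lemma da_self: "f \<in> da_space \<Longrightarrow>
  ((\<lambda>\<alpha>. da_weight \<alpha> * (cmod (da_coeff f \<alpha>))\<^sup>2) has_sum Re (hinner drury_arveson f f)) UNIV"
proof -
  assume f: "f \<in> da_space"
  have eq: "of_real (da_weight \<alpha>) * da_coeff f \<alpha> * cnj (da_coeff f \<alpha>) =
      complex_of_real (da_weight \<alpha> * (cmod (da_coeff f \<alpha>))\<^sup>2)" for \<alpha>
    by (simp only: of_real_mult complex_norm_square mult.assoc)
  have "((\<lambda>\<alpha>. of_real (da_weight \<alpha>) * da_coeff f \<alpha> * cnj (da_coeff f \<alpha>)) has_sum hinner drury_arveson f f) UNIV"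
    using l2_coeff_inner[OF da_space_l2[OF f] da_space_l2[OF f]] by (simp add: has_sum_infsum)
  from has_sum_Re[OF this] show ?thesis unfolding eq by simp
qed

lemma da_vector_space: "vector_space (\<lambda>c f (x :: complex ^ 'd::finite). c * f x :: complex)"
  by unfold_locales (simp_all add: fun_eq_iff algebra_simps)

text \<open>Definiteness uses uniqueness of coefficients: norm zero makes all coefficients vanish,
  and these determine the function.\<close>

lemma da_inner_space: "inner_space (drury_arveson :: (complex ^ 'd::finite \<Rightarrow> complex) hspace)"
proof -
  interpret vector_space "hscale (drury_arveson :: (complex ^ 'd \<Rightarrow> complex) hspace)"
    unfolding drury_arveson_simps by (rule da_vector_space)
  show ?thesis
  proof (unfold_locales, goal_cases)
    case 1
    show ?case
      unfolding subspace_def by (auto simp: da_zero da_add da_cmult plus_fun_def zero_fun_def)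
  next
    case (2 x y z)
    then show ?case
      using l2_coeff_inner[OF da_space_l2 da_space_l2, of x z] l2_coeff_inner[OF da_space_l2 da_space_l2, of y z]
      by (simp add: plus_fun_def da_add ring_distribs infsum_add)
  next
    case (3 x y c)
    then show ?case
      using l2_coeff_inner[OF da_space_l2 da_space_l2, of x y]
      by (simp add: da_cmult mult.assoc mult.left_commute infsum_cmult_right)
  next
    case (4 x y)
    show ?case by (simp add: infsum_cnj[symmetric] mult_ac del: infsum_cnj)
  next
    case (5 x)
    then show ?case using da_self[of x] by (intro has_sum_nonneg[OF da_self]) (auto simp: da_weight_pos less_imp_le)
  next
    case (6 x)
    then have x: "x \<in> da_space" by simp
    have nn: "0 \<le> Re (hinner drury_arveson x x)"
      by (rule has_sum_nonneg[OF da_self[OF x]]) (auto simp: da_weight_pos less_imp_le)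
    have "Re (hinner drury_arveson x x) \<noteq> 0"
    proof
      assume "Re (hinner drury_arveson x x) = 0"
      then have z: "da_weight \<alpha> * (cmod (da_coeff x \<alpha>))\<^sup>2 = 0" for \<alpha>
        by (intro nonneg_has_sum_le_0D[OF da_self[OF x]])
          (auto simp: less_imp_le[OF da_weight_pos] simp del: drury_arveson_simps(3))
      have "da_coeff x \<alpha> = 0" for \<alpha> using z[of \<alpha>] da_weight_pos[of \<alpha>] by simp
      then have "da_coeff x = (\<lambda>_. 0)" by (simp add: fun_eq_iff)
      moreover have "da_coeff (\<lambda>x::complex ^ 'd. 0) = (\<lambda>_. 0)"
        by (rule da_coeff_eq) (simp add: has_power_series_def)
      ultimately have "x = (\<lambda>_. 0)" by (intro da_space_eqI x da_zero) simp
      with 6 show False by (simp add: zero_fun_def)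
    qed
    with nn show ?case by linarith
  qed
qed

interpretation DA: inner_space "drury_arveson :: (complex ^ 'd::finite \<Rightarrow> complex) hspace"
  by (rule da_inner_space)


subsection \<open>Multipliers\<close>

lemma mult_op_apply: "f \<in> da_space \<Longrightarrow> mult_op \<phi> f = (\<lambda>x. \<phi> x * f x)"
  by (simp add: mult_op_def)

lemma ball_one_series: "has_power_series ball_one (\<lambda>\<alpha>. of_bool (\<alpha> = (\<lambda>_. 0)))"
  unfolding has_power_series_def
proof
  fix x :: "complex ^ 'd" assume "x \<in> ball 0 1"
  then show "((\<lambda>\<alpha>. of_bool (\<alpha> = (\<lambda>_. 0)) * mmonom \<alpha> x) has_sum ball_one x) UNIV"
    by (intro has_sum_finite_neutralI[of "{\<lambda>_. 0}"]) (auto simp: mmonom_def ball_one_def)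
qed

lemma ball_one_da: "ball_one \<in> da_space"
  by (rule da_spaceI[OF _ ball_one_series])
    (auto simp: ball_one_def l2_coeff_def intro!: has_sum_imp_summable[OF has_sum_finite_neutralI[of "{\<lambda>_. 0}"]])

lemma da_coeff_ball_one: "da_coeff ball_one = (\<lambda>\<alpha>. of_bool (\<alpha> = (\<lambda>_. 0)))"
  by (rule da_coeff_eq[OF ball_one_series])

lemma multiplier_off: "\<lbrakk>\<phi> \<in> multipliers; x \<notin> ball 0 1\<rbrakk> \<Longrightarrow> \<phi> x = 0"
  by (auto simp: multipliers_def)

lemma multiplier_bops: "\<phi> \<in> multipliers \<Longrightarrow> mult_op \<phi> \<in> bops drury_arveson"
  by (auto simp: multipliers_def)

lemma multiplier_mult: "\<lbrakk>\<phi> \<in> multipliers; f \<in> da_space\<rbrakk> \<Longrightarrow> (\<lambda>x. \<phi> x * f x) \<in> da_space"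
  using DA.bops_in[OF multiplier_bops, of \<phi> f] by (simp add: mult_op_apply)

lemma mult_op_one: "\<phi> \<in> multipliers \<Longrightarrow> mult_op \<phi> ball_one = \<phi>"
proof
  fix x assume "\<phi> \<in> multipliers"
  then show "mult_op \<phi> ball_one x = \<phi> x"
    using multiplier_off[of \<phi> x] by (cases "x \<in> ball 0 1") (simp_all add: mult_op_apply ball_one_da, simp_all add: ball_one_def)
qed

text \<open>The constant function 1 lies in the space and M_\<phi> 1 = \<phi>. This gives a
  multiplier the square summable coefficients on which the functional calculus is built.\<close>

lemma multiplier_da: "\<phi> \<in> multipliers \<Longrightarrow> \<phi> \<in> da_space"
  using DA.bops_in[OF multiplier_bops, of \<phi> ball_one] by (simp add: mult_op_one ball_one_da)

lemma multipliers_add: "\<lbrakk>\<phi> \<in> multipliers; \<psi> \<in> multipliers\<rbrakk> \<Longrightarrow> (\<lambda>x. \<phi> x + \<psi> x) \<in> multipliers"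
proof -
  assume a: "\<phi> \<in> multipliers" "\<psi> \<in> multipliers"
  have "mult_op (\<lambda>x. \<phi> x + \<psi> x) = (\<lambda>f. mult_op \<phi> f + mult_op \<psi> f)"
    by (auto simp: mult_op_def fun_eq_iff ring_distribs)
  then show ?thesis using a DA.bops_add_op[OF multiplier_bops multiplier_bops, of \<phi> \<psi>]
    by (auto simp: multipliers_def)
qed

lemma multipliers_cmult: "\<phi> \<in> multipliers \<Longrightarrow> (\<lambda>x. c * \<phi> x) \<in> multipliers"
proof -
  assume a: "\<phi> \<in> multipliers"
  have "mult_op (\<lambda>x. c * \<phi> x) = (\<lambda>f. hscale drury_arveson c (mult_op \<phi> f))"
    by (auto simp: mult_op_def fun_eq_iff)
  then show ?thesis using a DA.bops_scale_op[OF multiplier_bops, of \<phi> c]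
    by (auto simp: multipliers_def)
qed

lemma multipliers_mult: "\<lbrakk>\<phi> \<in> multipliers; \<psi> \<in> multipliers\<rbrakk> \<Longrightarrow> (\<lambda>x. \<phi> x * \<psi> x) \<in> multipliers"
proof -
  assume a: "\<phi> \<in> multipliers" "\<psi> \<in> multipliers"
  have "mult_op (\<lambda>x. \<phi> x * \<psi> x) = mult_op \<phi> \<circ> mult_op \<psi>"
    using multiplier_mult[OF a(2)] da_zero
    by (auto simp: mult_op_def fun_eq_iff zero_fun_def)
  then show ?thesis using a DA.bops_comp[OF multiplier_bops multiplier_bops, of \<phi> \<psi>]
    by (auto simp: multipliers_def)
qed

lemma hid_drury_arveson: "mult_op ball_one = hid drury_arveson"
  by (auto simp: mult_op_def hid_def fun_eq_iff ball_one_def da_space_off)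

lemma ball_one_multiplier: "ball_one \<in> multipliers"
  by (auto simp: multipliers_def hid_drury_arveson DA.bops_hid) (simp add: ball_one_def)

text \<open>The coefficients of x_k f in terms of those of f; the case distinction guards the
  truncated subtraction.\<close>

definition shift_coeff :: "'d \<Rightarrow> (('d \<Rightarrow> nat) \<Rightarrow> complex) \<Rightarrow> ('d \<Rightarrow> nat) \<Rightarrow> complex" where
  "shift_coeff k c \<gamma> = (if \<gamma> k = 0 then 0 else c (\<gamma>(k := \<gamma> k - 1)))"

lemma shift_coeff_bump: "shift_coeff k c (bump k \<alpha>) = c \<alpha>"
  by (simp add: shift_coeff_def bump_def)

lemma has_sum_bump:
  fixes h :: "('d \<Rightarrow> nat) \<Rightarrow> 'b::{comm_monoid_add,topological_space}"
  assumes "\<And>\<gamma>. \<gamma> k = 0 \<Longrightarrow> h \<gamma> = 0"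
  shows "((\<lambda>\<alpha>. h (bump k \<alpha>)) has_sum S) UNIV \<longleftrightarrow> (h has_sum S) UNIV"
proof -
  have "((\<lambda>\<alpha>. h (bump k \<alpha>)) has_sum S) UNIV \<longleftrightarrow> (h has_sum S) (range (bump k))"
    using has_sum_reindex[OF inj_bump, of h k S] by (simp add: o_def)
  also have "\<dots> \<longleftrightarrow> (h has_sum S) UNIV"
    by (rule has_sum_cong_neutral) (auto simp: range_bump assms)
  finally show ?thesis .
qed

lemma shift_power_series:
  assumes "has_power_series f c"
  shows "has_power_series (\<lambda>x. ball_coord k x * f x) (shift_coeff k c)"
  unfolding has_power_series_def
proof
  fix x :: "complex ^ 'a" assume x: "x \<in> ball 0 1"
  have "((\<lambda>\<alpha>. x $ k * (c \<alpha> * mmonom \<alpha> x)) has_sum (x $ k * f x)) UNIV"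
    using assms x by (intro has_sum_cmult_right) (auto simp: has_power_series_def)
  then have "((\<lambda>\<alpha>. shift_coeff k c (bump k \<alpha>) * mmonom (bump k \<alpha>) x) has_sum (x $ k * f x)) UNIV"
    by (simp add: shift_coeff_bump mmonom_bump mult_ac)
  then show "((\<lambda>\<alpha>. shift_coeff k c \<alpha> * mmonom \<alpha> x) has_sum (ball_coord k x * f x)) UNIV"
    using x by (subst (asm) has_sum_bump) (auto simp: shift_coeff_def ball_coord_def)
qed

lemma shift_l2:
  assumes "l2_coeff c"
  shows "l2_coeff (shift_coeff k c)"
    "(\<Sum>\<^sub>\<infinity>\<alpha>. da_weight \<alpha> * (cmod (shift_coeff k c \<alpha>))\<^sup>2) \<le> (\<Sum>\<^sub>\<infinity>\<alpha>. da_weight \<alpha> * (cmod (c \<alpha>))\<^sup>2)"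
proof -
  define h where "h = (\<lambda>\<alpha>. da_weight \<alpha> * (cmod (shift_coeff k c \<alpha>))\<^sup>2)"
  have le: "h (bump k \<alpha>) \<le> da_weight \<alpha> * (cmod (c \<alpha>))\<^sup>2" for \<alpha>
    by (simp add: h_def shift_coeff_bump da_weight_bump_le mult_right_mono)
  have nn: "0 \<le> h \<alpha>" for \<alpha> by (simp add: h_def da_weight_pos less_imp_le)
  have s: "(\<lambda>\<alpha>. h (bump k \<alpha>)) summable_on UNIV"
    by (rule summable_on_comparison_test[OF assms[unfolded l2_coeff_def]]) (use le nn in auto)
  then have "((\<lambda>\<alpha>. h (bump k \<alpha>)) has_sum (\<Sum>\<^sub>\<infinity>\<alpha>. h (bump k \<alpha>))) UNIV" by simp
  then have hs: "(h has_sum (\<Sum>\<^sub>\<infinity>\<alpha>. h (bump k \<alpha>))) UNIV"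
    by (subst (asm) has_sum_bump) (auto simp: h_def shift_coeff_def)
  then show "l2_coeff (shift_coeff k c)"
    unfolding l2_coeff_def h_def[symmetric] by (rule has_sum_imp_summable)
  have "(\<Sum>\<^sub>\<infinity>\<alpha>. h (bump k \<alpha>)) \<le> (\<Sum>\<^sub>\<infinity>\<alpha>. da_weight \<alpha> * (cmod (c \<alpha>))\<^sup>2)"
    by (rule infsum_mono[OF s assms[unfolded l2_coeff_def]]) (rule le)
  then show "(\<Sum>\<^sub>\<infinity>\<alpha>. da_weight \<alpha> * (cmod (shift_coeff k c \<alpha>))\<^sup>2) \<le> (\<Sum>\<^sub>\<infinity>\<alpha>. da_weight \<alpha> * (cmod (c \<alpha>))\<^sup>2)"
    unfolding h_def[symmetric] using infsumI[OF hs] by simp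
qed

lemma da_hnorm_power2: "f \<in> da_space \<Longrightarrow> (hnorm drury_arveson f)\<^sup>2 = (\<Sum>\<^sub>\<infinity>\<alpha>. da_weight \<alpha> * (cmod (da_coeff f \<alpha>))\<^sup>2)"
  by (simp add: DA.hnorm_power2 infsumI[OF da_self] del: drury_arveson_simps(3))

lemma ball_coord_multiplier: "ball_coord k \<in> multipliers"
proof -
  have in_da: "(\<lambda>x. ball_coord k x * f x) \<in> da_space" if "f \<in> da_space" for f
    using that by (intro da_spaceI[OF _ shift_power_series[OF da_space_series] shift_l2(1)] da_space_l2)
      (auto simp: da_space_off)
  have "mult_op (ball_coord k) \<in> bops drury_arveson"
  proof (rule DA.bops_intro[where C = 1])
    fix f :: "complex ^ 'a \<Rightarrow> complex" assume "f \<in> hcarrier drury_arveson"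
    then have f: "f \<in> da_space" by simp
    have c: "da_coeff (\<lambda>x. ball_coord k x * f x) = shift_coeff k (da_coeff f)"
      by (rule da_coeff_eq[OF shift_power_series[OF da_space_series[OF f]]])
    have "(hnorm drury_arveson (mult_op (ball_coord k) f))\<^sup>2 \<le> (hnorm drury_arveson f)\<^sup>2"
      using shift_l2(2)[OF da_space_l2[OF f]] by (simp add: mult_op_apply f da_hnorm_power2 in_da c)
    then show "hnorm drury_arveson (mult_op (ball_coord k) f) \<le> 1 * hnorm drury_arveson f"
      using f DA.hnorm_nonneg[of f] by (auto intro: power2_le_imp_le)
    show "mult_op (ball_coord k) f \<in> hcarrier drury_arveson"
      by (simp add: mult_op_apply f in_da)
    fix c
    show "mult_op (ball_coord k) (hscale drury_arveson c f) = hscale drury_arveson c (mult_op (ball_coord k) f)"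
      by (simp add: mult_op_apply f da_cmult mult_ac)
  next
    fix f g :: "complex ^ 'a \<Rightarrow> complex" assume "f \<in> hcarrier drury_arveson" "g \<in> hcarrier drury_arveson"
    then show "mult_op (ball_coord k) (f + g) = mult_op (ball_coord k) f + mult_op (ball_coord k) g"
      using da_add[of f g] by (simp add: mult_op_apply plus_fun_def ring_distribs)
  qed (simp add: mult_op_def)
  then show ?thesis by (auto simp: multipliers_def ball_coord_def)
qed

lemma da_coeff_ball_coord: "da_coeff (ball_coord k) = (\<lambda>\<alpha>. of_bool (\<alpha> = bump k (\<lambda>_. 0)))"
proof -
  have "da_coeff (\<lambda>x. ball_coord k x * ball_one x) = shift_coeff k (da_coeff ball_one)"
    by (rule da_coeff_eq[OF shift_power_series[OF da_space_series[OF ball_one_da]]])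
  moreover have "(\<lambda>x. ball_coord k x * ball_one x) = ball_coord k"
    by (auto simp: fun_eq_iff ball_coord_def ball_one_def)
  moreover have "shift_coeff k (da_coeff ball_one) = (\<lambda>\<alpha>. of_bool (\<alpha> = bump k (\<lambda>_. 0)))"
  proof
    fix \<gamma> :: "'a \<Rightarrow> nat"
    show "shift_coeff k (da_coeff ball_one) \<gamma> = of_bool (\<gamma> = bump k (\<lambda>_. 0))"
    proof (cases "\<gamma> \<in> range (bump k)")
      case True
      then show ?thesis by (auto simp: shift_coeff_bump da_coeff_ball_one inj_eq[OF inj_bump])
    next
      case False
      then have "\<gamma> k = 0" and "\<gamma> \<noteq> bump k (\<lambda>_. 0)" by (simp add: range_bump) (use False in blast)
      then show ?thesis by (simp add: shift_coeff_def)
    qed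
  qed
  ultimately show ?thesis by simp
qed


subsection \<open>Products of power series\<close>

text \<open>Since the sum runs over \<alpha> \<le> \<gamma> only, the pointwise subtraction of
  naturals is exact.\<close>

definition cauchy_prod ::
    "(('d \<Rightarrow> nat) \<Rightarrow> complex) \<Rightarrow> (('d \<Rightarrow> nat) \<Rightarrow> complex) \<Rightarrow> ('d \<Rightarrow> nat) \<Rightarrow> complex" where
  "cauchy_prod a b \<gamma> = (\<Sum>\<alpha> | \<alpha> \<le> \<gamma>. a \<alpha> * b (\<gamma> - \<alpha>))"

lemma summable_on_product:
  fixes a :: "'a \<Rightarrow> real" and b :: "'b \<Rightarrow> real"
  assumes "a summable_on A" "b summable_on B" "\<And>x. 0 \<le> a x" "\<And>y. 0 \<le> b y"
  shows "(\<lambda>(x, y). a x * b y) summable_on (A \<times> B)"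
proof (rule summable_on_SigmaI)
  show "((\<lambda>y. case (x, y) of (x, y) \<Rightarrow> a x * b y) has_sum (a x * infsum b B)) B" for x
    using assms by (auto intro!: has_sum_cmult_right has_sum_infsum)
qed (use assms in \<open>auto intro!: summable_on_cmult_left\<close>)

text \<open>The factor u may be any function of \<alpha> + \<beta>. With u a monomial at a point
  this multiplies functions; with u = <T^\<gamma> x, y> it multiplies operators.\<close>

lemma cauchy_prod_has_sum:
  fixes a b u :: "('d::finite \<Rightarrow> nat) \<Rightarrow> complex"
  assumes "((\<lambda>(\<alpha>, \<beta>). a \<alpha> * b \<beta> * u (\<alpha> + \<beta>)) has_sum S) (UNIV \<times> UNIV)"
  shows "((\<lambda>\<gamma>. cauchy_prod a b \<gamma> * u \<gamma>) has_sum S) UNIV"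
proof -
  have "\<alpha> + (\<gamma> - \<alpha>) = \<gamma>" if "\<alpha> \<le> \<gamma>" for \<alpha> \<gamma> :: "'d \<Rightarrow> nat"
    using that by (simp add: le_fun_def fun_eq_iff)
  then have "((\<lambda>(\<gamma>, \<alpha>). a \<alpha> * b (\<gamma> - \<alpha>) * u \<gamma>) has_sum S) (Sigma UNIV (\<lambda>\<gamma>. {\<alpha>. \<alpha> \<le> \<gamma>}))"
    using assms
    by (subst has_sum_reindex_bij_witness[where i = "\<lambda>(\<alpha>, \<beta>). (\<alpha> + \<beta>, \<alpha>)" and j = "\<lambda>(\<gamma>, \<alpha>). (\<alpha>, \<gamma> - \<alpha>)"
          and h = "\<lambda>(\<alpha>, \<beta>). a \<alpha> * b \<beta> * u (\<alpha> + \<beta>)" and T = "UNIV \<times> UNIV" and s' = S])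
       (auto simp: le_fun_def)
  then show ?thesis
    by (rule has_sum_SigmaD)
      (auto simp: cauchy_prod_def sum_distrib_right intro!: has_sum_finiteI finite_le_idx)
qed

lemma da_coeff_mult:
  assumes f: "f \<in> da_space" and g: "g \<in> da_space"
  shows "has_power_series (\<lambda>x. f x * g x) (cauchy_prod (da_coeff f) (da_coeff g))"
  unfolding has_power_series_def
proof
  fix x :: "complex ^ 'a" assume x: "x \<in> ball 0 1"
  define a where "a = (\<lambda>\<alpha>. da_coeff f \<alpha> * mmonom \<alpha> x)"
  define b where "b = (\<lambda>\<alpha>. da_coeff g \<alpha> * mmonom \<alpha> x)"
  have a: "(\<lambda>\<alpha>. norm (a \<alpha>)) summable_on UNIV" and b: "(\<lambda>\<alpha>. norm (b \<alpha>)) summable_on UNIV"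
    using l2_coeff_power_series[OF da_space_l2 x] f g by (simp_all add: a_def b_def)
  have "(\<lambda>p. norm (case p of (\<alpha>, \<beta>) \<Rightarrow> a \<alpha> * b \<beta>)) summable_on (UNIV \<times> UNIV)"
    using summable_on_product[OF a b] by (simp add: norm_mult case_prod_unfold)
  then have ab: "(\<lambda>(\<alpha>, \<beta>). a \<alpha> * b \<beta>) summable_on (UNIV \<times> UNIV)"
    by (rule Infinite_Sum.abs_summable_summable)
  then obtain S where S: "((\<lambda>(\<alpha>, \<beta>). a \<alpha> * b \<beta>) has_sum S) (UNIV \<times> UNIV)"
    by (auto simp: summable_on_def)
  have "((\<lambda>\<alpha>. a \<alpha> * g x) has_sum S) UNIV"
    using S by (rule has_sum_SigmaD) (auto intro!: has_sum_cmult_right simp: b_def da_space_has_sum[OF g x])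
  moreover have "((\<lambda>\<alpha>. a \<alpha> * g x) has_sum (f x * g x)) UNIV"
    by (intro has_sum_cmult_left) (simp add: a_def da_space_has_sum[OF f x])
  ultimately have "S = f x * g x" by (rule has_sum_unique)
  moreover have "(\<lambda>(\<alpha>, \<beta>). a \<alpha> * b \<beta>) =
      (\<lambda>(\<alpha>, \<beta>). da_coeff f \<alpha> * da_coeff g \<beta> * mmonom (\<alpha> + \<beta>) x)"
    by (simp add: a_def b_def mmonom_add mult_ac)
  ultimately show "((\<lambda>\<gamma>. cauchy_prod (da_coeff f) (da_coeff g) \<gamma> * mmonom \<gamma> x) has_sum (f x * g x)) UNIV"
    using S by (intro cauchy_prod_has_sum) (simp only:)
qed


subsection \<open>Pure commuting row contractions on finite-dimensional spaces\<close>

lemma has_sum_finite_sum: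
  fixes f :: "'i \<Rightarrow> 'a \<Rightarrow> 'b::topological_comm_monoid_add"
  assumes "\<And>i. i \<in> I \<Longrightarrow> (f i has_sum s i) A"
  shows "((\<lambda>x. \<Sum>i\<in>I. f i x) has_sum (\<Sum>i\<in>I. s i)) A"
  using assms by (induction I rule: infinite_finite_induct) (auto intro: has_sum_add)

lemma count_list_surj: "\<exists>w. count_list w = (\<alpha> :: 'd::finite \<Rightarrow> nat)"
proof -
  obtain w where w: "mset w = Abs_multiset \<alpha>" using ex_mset by blast
  have "count (Abs_multiset \<alpha>) = \<alpha>" by (rule Abs_multiset_inverse) simp
  then have "count_list w = \<alpha>" using w by (simp add: count_mset[symmetric] fun_eq_iff)
  then show ?thesis by blast
qed

lemma count_list_Nil: "count_list [] = (\<lambda>_. 0)"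
  by (simp add: fun_eq_iff)

lemma count_list_append_fun: "count_list (u @ v) = count_list u + count_list v"
  by (simp add: fun_eq_iff)

text \<open>\<open>S\<close> is the family of adjoints, specified on the carrier only. As a
  parameter it can stay the same when \<open>H\<close> and \<open>T\<close> are replaced by a
  co-invariant subspace and the compression.\<close>

locale op_tuple = findim_inner_space H
  for H :: "'a::ab_group_add hspace" +
  fixes T S :: "'d::finite \<Rightarrow> 'a \<Rightarrow> 'a"
  assumes T_bops: "T k \<in> bops H"
    and S_in: "x \<in> hcarrier H \<Longrightarrow> S k x \<in> hcarrier H"
    and adj: "\<lbrakk>x \<in> hcarrier H; y \<in> hcarrier H\<rbrakk> \<Longrightarrow> hinner H (T k x) y = hinner H x (S k y)"
begin

lemma eq_if_hinner_right:
  assumes "x \<in> hcarrier H" "y \<in> hcarrier H" "\<And>z. z \<in> hcarrier H \<Longrightarrow> hinner H z x = hinner H z y"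
  shows "x = y"
proof (rule eq_if_hinner_eq[OF assms(1,2)])
  fix z assume z: "z \<in> hcarrier H"
  then show "hinner H x z = hinner H y z"
    using assms(3)[OF z] commute[OF z assms(1)] commute[OF z assms(2)] by simp
qed

lemma word_op_Nil: "word_op H T [] = hid H"
  and word_op_Cons: "word_op H T (k # w) = T k \<circ> word_op H T w"
  by (simp_all add: word_op_def)

lemma word_op_bops: "word_op H T w \<in> bops H"
  by (induction w) (auto simp only: word_op_Nil word_op_Cons bops_hid bops_comp T_bops)

lemma T_in [simp]: "x \<in> hcarrier H \<Longrightarrow> T k x \<in> hcarrier H"
  by (rule bops_in[OF T_bops])

lemma word_op_in [simp]: "x \<in> hcarrier H \<Longrightarrow> word_op H T w x \<in> hcarrier H"
  by (rule bops_in[OF word_op_bops])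

lemma word_op_append: "word_op H T (u @ v) = word_op H T u \<circ> word_op H T v"
proof (induction u)
  case Nil
  have "hid H (word_op H T v x) = word_op H T v x" for x
    by (cases "x \<in> hcarrier H") (auto simp: hid_def bops_in[OF word_op_bops] bops_off[OF word_op_bops])
  then show ?case by (simp add: word_op_Nil fun_eq_iff)
qed (simp add: word_op_Cons o_assoc)

lemma word_op_cong:
  assumes "commuting T" and "count_list u = count_list v"
  shows "word_op H T u = word_op H T v"
proof -
  have "mset (rev u) = mset (rev v)"
    using assms(2) by (simp add: multiset_eq_iff count_mset)
  then have "fold (\<lambda>i A. T i \<circ> A) (rev u) = fold (\<lambda>i A. T i \<circ> A) (rev v)"
    by (rule fold_multiset_equiv[rotated]) (use assms(1) in \<open>auto simp: fun_eq_iff commuting_def\<close>)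
  then show ?thesis unfolding word_op_def foldr_conv_fold by (rule fun_cong)
qed

text \<open>Linearity of \<open>S\<close> is a consequence of the adjoint relation.\<close>

lemma S_add: "\<lbrakk>x \<in> hcarrier H; y \<in> hcarrier H\<rbrakk> \<Longrightarrow> S k (x + y) = S k x + S k y"
  by (rule eq_if_hinner_right) (simp_all add: S_in add_right flip: adj)

lemma S_scale: "x \<in> hcarrier H \<Longrightarrow> S k (hscale H c x) = hscale H c (S k x)"
  by (rule eq_if_hinner_right) (simp_all add: S_in scale_right flip: adj)

lemma fold_S_in [simp]: "x \<in> hcarrier H \<Longrightarrow> fold S w x \<in> hcarrier H"
  by (induction w arbitrary: x) (auto intro: S_in)

text \<open>Taking adjoints reverses products, and \<open>fold\<close> applies the first letter
  first; so both sides use the same word.\<close>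

lemma adj_word:
  "\<lbrakk>x \<in> hcarrier H; y \<in> hcarrier H\<rbrakk> \<Longrightarrow> hinner H (word_op H T w x) y = hinner H x (fold S w y)"
proof (induction w arbitrary: y)
  case Nil
  then show ?case by (simp add: word_op_Nil hid_def)
next
  case (Cons k w)
  then show ?case by (simp add: word_op_Cons adj bops_in[OF word_op_bops] S_in)
qed

lemma fold_S_add: "\<lbrakk>x \<in> hcarrier H; y \<in> hcarrier H\<rbrakk> \<Longrightarrow> fold S w (x + y) = fold S w x + fold S w y"
  by (rule eq_if_hinner_right) (simp_all add: add_right flip: adj_word)

lemma fold_S_scale: "x \<in> hcarrier H \<Longrightarrow> fold S w (hscale H c x) = hscale H c (fold S w x)"
  by (rule eq_if_hinner_right) (simp_all add: scale_right flip: adj_word)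

end

text \<open>Contractivity is the inequality sum T_k T_k* \<le> I evaluated at x. In terms of
  \<open>S\<close>, both it and purity pass to co-invariant subspaces without change.\<close>

locale pure_row = op_tuple H T S
  for H :: "'a::ab_group_add hspace" and T S :: "'d::finite \<Rightarrow> 'a \<Rightarrow> 'a" +
  assumes T_comm: "commuting T"
    and contr: "x \<in> hcarrier H \<Longrightarrow> (\<Sum>k\<in>UNIV. (hnorm H (S k x))\<^sup>2) \<le> (hnorm H x)\<^sup>2"
    and pure: "x \<in> hcarrier H \<Longrightarrow> (\<lambda>n. \<Sum>w | length w = n. (hnorm H (fold S w x))\<^sup>2) \<longlonglongrightarrow> 0"
begin

text \<open>The monomial T^\<alpha>, with an arbitrary word representing \<alpha>; because T
  commutes, \<open>monop_word\<close> shows independence of the choice. \<open>madj\<close> is its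
  adjoint.\<close>

definition monop :: "('d \<Rightarrow> nat) \<Rightarrow> 'a \<Rightarrow> 'a" where
  "monop \<alpha> = word_op H T (SOME w. count_list w = \<alpha>)"

definition madj :: "('d \<Rightarrow> nat) \<Rightarrow> 'a \<Rightarrow> 'a" where
  "madj \<alpha> = fold S (SOME w. count_list w = \<alpha>)"

lemma some_word: "count_list (SOME w. count_list w = \<alpha>) = (\<alpha> :: 'd \<Rightarrow> nat)"
  by (rule someI_ex[OF count_list_surj])

lemma monop_bops: "monop \<alpha> \<in> bops H"
  unfolding monop_def by (rule word_op_bops)

lemma monop_in [simp]: "x \<in> hcarrier H \<Longrightarrow> monop \<alpha> x \<in> hcarrier H"
  by (rule bops_in[OF monop_bops])

lemma madj_in [simp]: "x \<in> hcarrier H \<Longrightarrow> madj \<alpha> x \<in> hcarrier H"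
  by (simp add: madj_def)

lemma adj_monop: "\<lbrakk>x \<in> hcarrier H; y \<in> hcarrier H\<rbrakk> \<Longrightarrow> hinner H (monop \<alpha> x) y = hinner H x (madj \<alpha> y)"
  unfolding monop_def madj_def by (rule adj_word)

lemma monop_word: "monop (count_list w) = word_op H T w"
  unfolding monop_def by (rule word_op_cong[OF T_comm some_word])

text \<open>That the maps \<open>S k\<close> commute on the carrier is not assumed but inherited
  from \<open>T\<close> through the adjoint relation.\<close>

lemma madj_word: "x \<in> hcarrier H \<Longrightarrow> madj (count_list w) x = fold S w x"
  by (rule eq_if_hinner_right) (simp_all add: monop_word flip: adj_monop adj_word)

lemma monop_add: "monop (\<alpha> + \<beta>) = monop \<alpha> \<circ> monop \<beta>"
proof -
  obtain u v where "\<alpha> = count_list u" "\<beta> = count_list v" using count_list_surj by metis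
  then show ?thesis by (simp add: monop_word word_op_append flip: count_list_append_fun)
qed

lemma monop_0: "monop (\<lambda>_. 0) = hid H"
  using monop_word[of "[]"] by (simp only: word_op_Nil count_list_Nil)

lemma monop_unit: "monop (bump k (\<lambda>_. 0)) = T k"
proof -
  have "T k (hid H x) = T k x" for x
    by (cases "x \<in> hcarrier H") (auto simp: hid_def bops_0[OF T_bops] bops_off[OF T_bops])
  then have "word_op H T [k] = T k" by (simp add: word_op_Nil word_op_Cons fun_eq_iff)
  then show ?thesis using monop_word[of "[k]"] unfolding count_list_Cons count_list_Nil by simp
qed

lemma madj_0: "x \<in> hcarrier H \<Longrightarrow> madj (\<lambda>_. 0) x = x"
  using madj_word[of x "[]"] by (simp add: count_list_Nil)

lemma madj_bump: "x \<in> hcarrier H \<Longrightarrow> madj (bump k \<alpha>) x = S k (madj \<alpha> x)"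
proof -
  assume x: "x \<in> hcarrier H"
  obtain w where w: "\<alpha> = count_list w" using count_list_surj by metis
  have "bump k \<alpha> = count_list (w @ [k])" by (auto simp: fun_eq_iff bump_def w)
  then show ?thesis using x by (simp add: w madj_word)
qed

lemma madj_add: "\<lbrakk>x \<in> hcarrier H; y \<in> hcarrier H\<rbrakk> \<Longrightarrow> madj \<alpha> (x + y) = madj \<alpha> x + madj \<alpha> y"
  and madj_scale: "x \<in> hcarrier H \<Longrightarrow> madj \<alpha> (hscale H c x) = hscale H c (madj \<alpha> x)"
  by (simp_all add: madj_def fold_S_add fold_S_scale)

text \<open>The quadratic form of \<Phi>^n(I), where \<Phi>(X) = sum T_k X T_k*.\<close>

definition energy :: "nat \<Rightarrow> 'a \<Rightarrow> real" where
  "energy n x = (\<Sum>w | length w = n. (hnorm H (fold S w x))\<^sup>2)"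

lemma energy_nonneg: "0 \<le> energy n x"
  by (simp add: energy_def sum_nonneg)

lemma energy_midx: "x \<in> hcarrier H \<Longrightarrow>
  energy n x = (\<Sum>\<alpha>\<in>midx n. (hnorm H (madj \<alpha> x))\<^sup>2 / da_weight \<alpha>)"
  using sum_words[of "\<lambda>\<alpha>. (hnorm H (madj \<alpha> x))\<^sup>2" n]
  by (simp add: energy_def madj_word divide_inverse mult.commute)

lemma energy_add: "energy (m + n) x = (\<Sum>w | length w = m. energy n (fold S w x))"
proof (induction m arbitrary: x)
  case (Suc m)
  have "energy (Suc m + n) x = (\<Sum>k\<in>UNIV. energy (m + n) (S k x))"
    by (simp add: energy_def sum_words_Suc)
  also have "\<dots> = (\<Sum>w | length w = Suc m. energy n (fold S w x))"
    by (simp add: Suc sum_words_Suc)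
  finally show ?case .
qed simp

text \<open>The factor \<open>card hbasis\<close> comes from squaring the sum in
  \<open>linear_bound\<close>. The constant in front of the squared norm tends to 0 with n, as
  purity is applied to finitely many basis vectors.\<close>

lemma energy_bound:
  assumes x: "x \<in> hcarrier H"
  shows "energy n x \<le> (real (card hbasis) * (\<Sum>e\<in>hbasis. energy n e)) * (hnorm H x)\<^sup>2"
proof -
  have "(hnorm H (fold S w x))\<^sup>2 \<le> (real (card hbasis) * (\<Sum>e\<in>hbasis. (hnorm H (fold S w e))\<^sup>2)) * (hnorm H x)\<^sup>2" for w
  proof -
    have "hnorm H (fold S w x) \<le> (\<Sum>e\<in>hbasis. hnorm H (fold S w e)) * hnorm H x"
      by (rule linear_bound) (simp_all add: fold_S_add fold_S_scale x)
    then have "(hnorm H (fold S w x))\<^sup>2 \<le> ((\<Sum>e\<in>hbasis. hnorm H (fold S w e)) * hnorm H x)\<^sup>2"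
      using x by (intro power_mono) auto
    also have "\<dots> = (\<Sum>e\<in>hbasis. hnorm H (fold S w e))\<^sup>2 * (hnorm H x)\<^sup>2"
      by (rule power_mult_distrib)
    also have "(\<Sum>e\<in>hbasis. hnorm H (fold S w e))\<^sup>2 \<le> (\<Sum>e\<in>hbasis. (hnorm H (fold S w e))\<^sup>2) * card hbasis"
      by (rule sum_squared_le_sum_of_squares)
    finally show ?thesis by (simp add: mult.commute mult_right_mono)
  qed
  then have "energy n x \<le> (\<Sum>w | length w = n. (real (card hbasis) * (\<Sum>e\<in>hbasis. (hnorm H (fold S w e))\<^sup>2)) * (hnorm H x)\<^sup>2)"
    unfolding energy_def by (rule sum_mono)
  also have "\<dots> = (real (card hbasis) * (\<Sum>e\<in>hbasis. energy n e)) * (hnorm H x)\<^sup>2"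
    unfolding energy_def sum_distrib_left sum_distrib_right by (rule sum.swap)
  finally show ?thesis .
qed

text \<open>
  In finite dimensions purity is uniform on the unit ball, so that the energy is eventually halved
  and hence decays geometrically.
\<close>

lemma energy_summable:
  assumes x: "x \<in> hcarrier H"
  shows "summable (\<lambda>n. energy n x)"
proof -
  define C where "C = (\<lambda>n. real (card hbasis) * (\<Sum>e\<in>hbasis. energy n e))"
  have "C \<longlonglongrightarrow> real (card hbasis) * (\<Sum>e\<in>hbasis. 0)"
    unfolding C_def energy_def by (intro tendsto_mult tendsto_const tendsto_sum pure) auto
  then have "C \<longlonglongrightarrow> 0" by simp
  then have "eventually (\<lambda>n. C n < 1 / 2) sequentially" by (rule order_tendstoD) simp
  then obtain m where m: "C m < 1 / 2" by (auto simp: eventually_sequentially)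
  have half: "energy (n + m) x \<le> 1 / 2 * energy n x" for n
  proof -
    have "energy (n + m) x \<le> (\<Sum>w | length w = n. 1 / 2 * (hnorm H (fold S w x))\<^sup>2)"
      unfolding energy_add
    proof (rule sum_mono)
      fix w :: "'d list"
      have "energy m (fold S w x) \<le> C m * (hnorm H (fold S w x))\<^sup>2"
        unfolding C_def using x by (intro energy_bound) simp
      also have "\<dots> \<le> 1 / 2 * (hnorm H (fold S w x))\<^sup>2"
        using m by (intro mult_right_mono) auto
      finally show "energy m (fold S w x) \<le> 1 / 2 * (hnorm H (fold S w x))\<^sup>2" .
    qed
    then show ?thesis unfolding energy_def sum_distrib_left .
  qed
  \<comment> \<open>The halving bounds each partial sum s by A + s / 2, hence by 2 A.\<close>
  define A where "A = (\<Sum>n<m. energy n x)"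
  show ?thesis
  proof (rule summableI_nonneg_bounded[of _ "2 * A"])
    fix N
    have "(\<Sum>n<N. energy n x) \<le> (\<Sum>n<N + m. energy n x)"
      by (rule sum_mono2) (auto simp: energy_nonneg)
    also have "\<dots> = A + (\<Sum>n<N. energy (n + m) x)"
      unfolding A_def by (induction N) auto
    also have "(\<Sum>n<N. energy (n + m) x) \<le> 1 / 2 * (\<Sum>n<N. energy n x)"
      unfolding sum_distrib_left by (rule sum_mono) (rule half)
    finally show "(\<Sum>n<N. energy n x) \<le> 2 * A" by simp
  qed (rule energy_nonneg)
qed

text \<open>A bound for the norm of T^\<alpha> and its adjoint, written through basis vectors so
  that their energies control its squares.\<close>

definition tau :: "('d \<Rightarrow> nat) \<Rightarrow> real" where
  "tau \<alpha> = (\<Sum>e\<in>hbasis. hnorm H (madj \<alpha> e))"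

lemma tau_nonneg: "0 \<le> tau \<alpha>"
  by (simp add: tau_def sum_nonneg)

lemma madj_bound: "x \<in> hcarrier H \<Longrightarrow> hnorm H (madj \<alpha> x) \<le> tau \<alpha> * hnorm H x"
  unfolding tau_def by (rule linear_bound) (simp_all add: madj_add madj_scale)

lemma hinner_monop_bound:
  assumes "x \<in> hcarrier H" "y \<in> hcarrier H"
  shows "cmod (hinner H (monop \<alpha> x) y) \<le> tau \<alpha> * (hnorm H x * hnorm H y)"
proof -
  have "cmod (hinner H (monop \<alpha> x) y) \<le> hnorm H x * hnorm H (madj \<alpha> y)"
    using assms by (simp add: adj_monop hinner_le)
  also have "\<dots> \<le> hnorm H x * (tau \<alpha> * hnorm H y)"
    using assms by (intro mult_left_mono madj_bound) auto
  finally show ?thesis by (simp add: mult_ac)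
qed

lemma monop_bound:
  assumes x: "x \<in> hcarrier H"
  shows "hnorm H (monop \<alpha> x) \<le> tau \<alpha> * hnorm H x"
proof (cases "hnorm H (monop \<alpha> x) = 0")
  case True
  then show ?thesis using x tau_nonneg by simp
next
  case False
  then have pos: "hnorm H (monop \<alpha> x) > 0" using hnorm_nonneg[OF monop_in[OF x], of \<alpha>] by linarith
  have "hnorm H (monop \<alpha> x) * hnorm H (monop \<alpha> x) = cmod (hinner H (monop \<alpha> x) (monop \<alpha> x))"
    using x by (simp add: hinner_self power2_eq_square norm_mult abs_of_pos[OF pos])
  also have "\<dots> \<le> (tau \<alpha> * hnorm H x) * hnorm H (monop \<alpha> x)"
    using hinner_monop_bound[OF x monop_in[OF x]] by (simp add: mult.assoc)
  finally show ?thesis using pos by simp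
qed

text \<open>Up to the factor \<open>card hbasis\<close>, the part of degree n is at most the total
  energy of the basis vectors at level n.\<close>

lemma tau_summable: "(\<lambda>\<alpha>. (tau \<alpha>)\<^sup>2 / da_weight \<alpha>) summable_on UNIV"
proof (rule graded_summable)
  show "summable (\<lambda>n. \<Sum>\<alpha>\<in>midx n. (tau \<alpha>)\<^sup>2 / da_weight \<alpha>)"
  proof (rule summable_comparison_test')
    show "summable (\<lambda>n. real (card hbasis) * (\<Sum>e\<in>hbasis. energy n e))"
      by (intro summable_mult summable_sum energy_summable) simp
    fix n :: nat
    have "(\<Sum>\<alpha>\<in>midx n. (tau \<alpha>)\<^sup>2 / da_weight \<alpha>) \<le>
      (\<Sum>\<alpha>\<in>midx n. real (card hbasis) * (\<Sum>e\<in>hbasis. (hnorm H (madj \<alpha> e))\<^sup>2 / da_weight \<alpha>))"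
    proof (rule sum_mono)
      fix \<alpha>
      have "(tau \<alpha>)\<^sup>2 \<le> (\<Sum>e\<in>hbasis. (hnorm H (madj \<alpha> e))\<^sup>2) * card hbasis"
        unfolding tau_def by (rule sum_squared_le_sum_of_squares)
      then have "(tau \<alpha>)\<^sup>2 / da_weight \<alpha> \<le> ((\<Sum>e\<in>hbasis. (hnorm H (madj \<alpha> e))\<^sup>2) * card hbasis) / da_weight \<alpha>"
        using da_weight_pos[of \<alpha>] by (intro divide_right_mono) auto
      then show "(tau \<alpha>)\<^sup>2 / da_weight \<alpha> \<le> real (card hbasis) * (\<Sum>e\<in>hbasis. (hnorm H (madj \<alpha> e))\<^sup>2 / da_weight \<alpha>)"
        by (simp add: sum_divide_distrib[symmetric] mult.commute)
    qed
    also have "\<dots> = real (card hbasis) * (\<Sum>e\<in>hbasis. energy n e)"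
      by (simp add: energy_midx sum_distrib_left[symmetric] sum.swap[of _ hbasis])
    finally show "norm (\<Sum>\<alpha>\<in>midx n. (tau \<alpha>)\<^sup>2 / da_weight \<alpha>) \<le> real (card hbasis) * (\<Sum>e\<in>hbasis. energy n e)"
      by (subst real_norm_def, subst abs_of_nonneg) (auto intro!: sum_nonneg divide_nonneg_pos da_weight_pos)
  qed
qed (simp add: da_weight_pos less_imp_le)

lemma coeff_tau_summable: "l2_coeff c \<Longrightarrow> (\<lambda>\<alpha>. cmod (c \<alpha>) * tau \<alpha>) summable_on UNIV"
  by (rule l2_coeff_dual[OF _ tau_summable tau_nonneg])


subsection \<open>The functional calculus as a power series\<close>

lemma calc_summable:
  assumes "l2_coeff c" "x \<in> hcarrier H" "y \<in> hcarrier H"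
  shows "(\<lambda>\<alpha>. c \<alpha> * hinner H (monop \<alpha> x) y) summable_on UNIV"
proof (rule Infinite_Sum.abs_summable_summable, rule summable_on_comparison_test)
  show "(\<lambda>\<alpha>. cmod (c \<alpha>) * tau \<alpha> * (hnorm H x * hnorm H y)) summable_on UNIV"
    by (intro summable_on_cmult_left coeff_tau_summable assms)
  show "norm (c \<alpha> * hinner H (monop \<alpha> x) y) \<le> cmod (c \<alpha>) * tau \<alpha> * (hnorm H x * hnorm H y)" for \<alpha>
    using mult_left_mono[OF hinner_monop_bound[OF assms(2,3)], of "cmod (c \<alpha>)" \<alpha>]
    by (simp add: norm_mult mult.assoc)
qed simp

text \<open>The sum of c_\<alpha> T^\<alpha> x, formed coordinate by coordinate because the ambient
  type carries no topology. For square summable c the coordinate series converge absolutely, so the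
  definition covers all of the Drury-Arveson space.\<close>

definition calc :: "(('d \<Rightarrow> nat) \<Rightarrow> complex) \<Rightarrow> 'a \<Rightarrow> 'a" where
  "calc c x = (if x \<in> hcarrier H
     then \<Sum>e\<in>hbasis. hscale H (\<Sum>\<^sub>\<infinity>\<alpha>. c \<alpha> * hinner H (monop \<alpha> x) e) e else 0)"

lemma calc_in [simp]: "x \<in> hcarrier H \<Longrightarrow> calc c x \<in> hcarrier H"
  by (auto simp: calc_def intro!: V_sum)

lemma calc_has_sum:
  assumes "l2_coeff c" and x: "x \<in> hcarrier H" and y: "y \<in> hcarrier H"
  shows "((\<lambda>\<alpha>. c \<alpha> * hinner H (monop \<alpha> x) y) has_sum hinner H (calc c x) y) UNIV"
proof -
  have "((\<lambda>\<alpha>. \<Sum>e\<in>hbasis. cnj (hinner H y e) * (c \<alpha> * hinner H (monop \<alpha> x) e)) has_sum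
     (\<Sum>e\<in>hbasis. cnj (hinner H y e) * (\<Sum>\<^sub>\<infinity>\<alpha>. c \<alpha> * hinner H (monop \<alpha> x) e))) UNIV"
    by (intro has_sum_finite_sum has_sum_cmult_right has_sum_infsum calc_summable assms) simp
  moreover have "(\<Sum>e\<in>hbasis. cnj (hinner H y e) * (c \<alpha> * hinner H (monop \<alpha> x) e)) = c \<alpha> * hinner H (monop \<alpha> x) y" for \<alpha>
  proof -
    have "hinner H (monop \<alpha> x) y = hinner H (monop \<alpha> x) (\<Sum>e\<in>hbasis. hscale H (hinner H y e) e)"
      using hbasis_expand[OF y] by simp
    also have "\<dots> = (\<Sum>e\<in>hbasis. cnj (hinner H y e) * hinner H (monop \<alpha> x) e)"
      using x by (subst sum_right) (auto simp: scale_right)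
    finally show ?thesis by (simp add: sum_distrib_left mult_ac)
  qed
  moreover have "(\<Sum>e\<in>hbasis. cnj (hinner H y e) * (\<Sum>\<^sub>\<infinity>\<alpha>. c \<alpha> * hinner H (monop \<alpha> x) e)) = hinner H (calc c x) y"
  proof -
    have "hinner H e y = cnj (hinner H y e)" if "e \<in> hbasis" for e
      using commute[OF y hbasis_in[OF that]] .
    then show ?thesis
      using x y by (simp add: calc_def, subst sum_left) (auto simp: scale_left mult.commute)
  qed
  ultimately show ?thesis by simp
qed

lemma calc_eqI:
  assumes "l2_coeff c" "x \<in> hcarrier H" "z \<in> hcarrier H"
    "\<And>y. y \<in> hcarrier H \<Longrightarrow> ((\<lambda>\<alpha>. c \<alpha> * hinner H (monop \<alpha> x) y) has_sum hinner H z y) UNIV"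
  shows "calc c x = z"
  using calc_has_sum[OF assms(1,2)] assms(4) has_sum_unique
  by (intro eq_if_hinner_eq calc_in assms) blast

lemma calc_bops: assumes "l2_coeff c" shows "calc c \<in> bops H"
proof (rule bopsI)
  fix x y assume xy: "x \<in> hcarrier H" "y \<in> hcarrier H"
  show "calc c (x + y) = calc c x + calc c y"
    using xy has_sum_add[OF calc_has_sum[OF assms xy(1)] calc_has_sum[OF assms xy(2)]]
    by (intro calc_eqI assms) (auto simp: add_left bops_add[OF monop_bops] ring_distribs)
next
  fix a x assume x: "x \<in> hcarrier H"
  show "calc c (hscale H a x) = hscale H a (calc c x)"
    using x has_sum_cmult_right[OF calc_has_sum[OF assms x], of _ a]
    by (intro calc_eqI assms) (auto simp: scale_left bops_scale[OF monop_bops] mult_ac)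
qed (auto simp: calc_def intro!: V_sum)

lemma calc_off: "x \<notin> hcarrier H \<Longrightarrow> calc c x = 0"
  by (simp add: calc_def)

lemma calc_add:
  assumes "l2_coeff a" "l2_coeff b"
  shows "calc (\<lambda>\<alpha>. a \<alpha> + b \<alpha>) x = calc a x + calc b x"
proof (cases "x \<in> hcarrier H")
  case x: True
  show ?thesis
    using x has_sum_add[OF calc_has_sum[OF assms(1) x] calc_has_sum[OF assms(2) x]]
    by (intro calc_eqI l2_coeff_add assms) (auto simp: add_left ring_distribs)
qed (simp add: calc_off)

lemma calc_cmult:
  assumes "l2_coeff a"
  shows "calc (\<lambda>\<alpha>. c * a \<alpha>) x = hscale H c (calc a x)"
proof (cases "x \<in> hcarrier H")
  case x: True
  show ?thesis
    using x has_sum_cmult_right[OF calc_has_sum[OF assms x], of _ c]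
    by (intro calc_eqI l2_coeff_cmult assms) (auto simp: scale_left mult_ac)
qed (simp add: calc_off)

lemma calc_delta: "calc (\<lambda>\<alpha>. of_bool (\<alpha> = \<beta>)) = monop \<beta>"
proof
  fix x
  show "calc (\<lambda>\<alpha>. of_bool (\<alpha> = \<beta>)) x = monop \<beta> x"
  proof (cases "x \<in> hcarrier H")
    case True
    then show ?thesis
      by (intro calc_eqI has_sum_finite_neutralI[of "{\<beta>}"])
        (auto simp: l2_coeff_def intro!: has_sum_imp_summable[OF has_sum_finite_neutralI[of "{\<beta>}"]])
  qed (simp add: calc_off bops_off[OF monop_bops])
qed

lemma calc_mult:
  assumes a: "l2_coeff a" and b: "l2_coeff b" and ab: "l2_coeff (cauchy_prod a b)"
  shows "calc (cauchy_prod a b) x = calc a (calc b x)"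
proof (cases "x \<in> hcarrier H")
  case x: True
  show ?thesis
  proof (rule calc_eqI[OF ab x])
    fix y assume y: "y \<in> hcarrier H"
    define F where "F = (\<lambda>(\<alpha>, \<beta>). a \<alpha> * b \<beta> * hinner H (monop (\<alpha> + \<beta>) x) y)"
    \<comment> \<open>With T^\<alpha> moved to the right, the sum over \<beta> for fixed \<alpha> is
      the series of \<open>calc b x\<close> tested against one vector. Domination by products of
      \<open>tau\<close> permits summing in this order.\<close>
    have mon: "hinner H (monop (\<alpha> + \<beta>) x) y = hinner H (monop \<beta> x) (madj \<alpha> y)" for \<alpha> \<beta>
      using x y by (simp add: monop_add adj_monop)
    have "(\<lambda>(\<alpha>, \<beta>). (cmod (a \<alpha>) * tau \<alpha>) * (cmod (b \<beta>) * tau \<beta>)) summable_on (UNIV \<times> UNIV)"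
      by (intro summable_on_product coeff_tau_summable a b) (auto simp: tau_nonneg)
    then have "(\<lambda>p. (case p of (\<alpha>, \<beta>) \<Rightarrow> (cmod (a \<alpha>) * tau \<alpha>) * (cmod (b \<beta>) * tau \<beta>)) * (hnorm H x * hnorm H y))
        summable_on (UNIV \<times> UNIV)"
      by (rule summable_on_cmult_left)
    then have "(\<lambda>p. norm (F p)) summable_on (UNIV \<times> UNIV)"
    proof (rule summable_on_comparison_test)
      fix p :: "('d \<Rightarrow> nat) \<times> ('d \<Rightarrow> nat)"
      obtain \<alpha> \<beta> where p: "p = (\<alpha>, \<beta>)" by (cases p)
      have "cmod (hinner H (monop \<beta> x) (madj \<alpha> y)) \<le> hnorm H (monop \<beta> x) * hnorm H (madj \<alpha> y)"
        using x y by (intro hinner_le) auto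
      also have "\<dots> \<le> (tau \<beta> * hnorm H x) * (tau \<alpha> * hnorm H y)"
        using x y tau_nonneg by (intro mult_mono monop_bound madj_bound) auto
      finally have "norm (F p) \<le> cmod (a \<alpha>) * cmod (b \<beta>) * ((tau \<beta> * hnorm H x) * (tau \<alpha> * hnorm H y))"
        unfolding F_def p mon by (simp add: norm_mult mult_left_mono)
      then show "norm (F p) \<le> (case p of (\<alpha>, \<beta>) \<Rightarrow> (cmod (a \<alpha>) * tau \<alpha>) * (cmod (b \<beta>) * tau \<beta>)) * (hnorm H x * hnorm H y)"
        by (simp add: p mult_ac)
    qed simp
    then have "F summable_on (UNIV \<times> UNIV)" by (rule Infinite_Sum.abs_summable_summable)
    then obtain s where s: "(F has_sum s) (UNIV \<times> UNIV)" by (auto simp: summable_on_def)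
    then have "((\<lambda>\<alpha>. a \<alpha> * hinner H (calc b x) (madj \<alpha> y)) has_sum s) UNIV"
    proof (rule has_sum_SigmaD)
      fix \<alpha>
      have "((\<lambda>\<beta>. a \<alpha> * (b \<beta> * hinner H (monop \<beta> x) (madj \<alpha> y))) has_sum (a \<alpha> * hinner H (calc b x) (madj \<alpha> y))) UNIV"
        using x y by (intro has_sum_cmult_right calc_has_sum b) auto
      then show "((\<lambda>\<beta>. F (\<alpha>, \<beta>)) has_sum (a \<alpha> * hinner H (calc b x) (madj \<alpha> y))) UNIV"
        by (simp add: F_def mon mult.assoc)
    qed
    then have "((\<lambda>\<alpha>. a \<alpha> * hinner H (monop \<alpha> (calc b x)) y) has_sum s) UNIV"
      using x y by (simp add: adj_monop)
    from has_sum_unique[OF this calc_has_sum[OF a calc_in[OF x] y]]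
    have "s = hinner H (calc a (calc b x)) y" .
    then show "((\<lambda>\<gamma>. cauchy_prod a b \<gamma> * hinner H (monop \<gamma> x) y) has_sum hinner H (calc a (calc b x)) y) UNIV"
      using s unfolding F_def by (intro cauchy_prod_has_sum) simp
  qed (simp add: x)
qed (simp add: calc_off bops_0[OF calc_bops[OF a]])

lemma calc_da_mult:
  assumes "f \<in> da_space" "g \<in> da_space" "(\<lambda>t. f t * g t) \<in> da_space"
  shows "calc (da_coeff (\<lambda>t. f t * g t)) x = calc (da_coeff f) (calc (da_coeff g) x)"
proof -
  have "da_coeff (\<lambda>t. f t * g t) = cauchy_prod (da_coeff f) (da_coeff g)"
    by (rule da_coeff_eq[OF da_coeff_mult[OF assms(1,2)]])
  then show ?thesis using calc_mult da_space_l2 assms by metis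
qed

end


subsection \<open>Matrices of operators\<close>

context inner_space
begin

text \<open>\<open>matrix_norm\<close> is a supremum of reals and bounds its members only if they
  are bounded above; a crude entrywise bound suffices.\<close>

lemma matrix_norm_bdd:
  fixes n :: nat
  assumes A: "\<And>i j. \<lbrakk>i < n; j < n\<rbrakk> \<Longrightarrow> A i j \<in> bops H"
  shows "bdd_above {sqrt (\<Sum>i<n. (hnorm H (\<Sum>j<n. A i j (x j)))\<^sup>2) | x.
            (\<forall>j<n. x j \<in> hcarrier H) \<and> (\<Sum>j<n. (hnorm H (x j))\<^sup>2) \<le> 1}"
proof -
  have "\<forall>i j. \<exists>C. i < n \<longrightarrow> j < n \<longrightarrow> C \<ge> 0 \<and> (\<forall>x\<in>hcarrier H. hnorm H (A i j x) \<le> C * hnorm H x)"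
    using bops_bound[OF A] by metis
  then obtain C where C: "\<And>i j. \<lbrakk>i < n; j < n\<rbrakk> \<Longrightarrow> C i j \<ge> 0"
    "\<And>i j x. \<lbrakk>i < n; j < n; x \<in> hcarrier H\<rbrakk> \<Longrightarrow> hnorm H (A i j x) \<le> C i j * hnorm H x"
    by metis
  show ?thesis
  proof (rule bdd_aboveI)
    fix r
    assume "r \<in> {sqrt (\<Sum>i<n. (hnorm H (\<Sum>j<n. A i j (x j)))\<^sup>2) | x.
            (\<forall>j<n. x j \<in> hcarrier H) \<and> (\<Sum>j<n. (hnorm H (x j))\<^sup>2) \<le> 1}"
    then obtain x where r: "r = sqrt (\<Sum>i<n. (hnorm H (\<Sum>j<n. A i j (x j)))\<^sup>2)"
      and x: "\<And>j. j < n \<Longrightarrow> x j \<in> hcarrier H" and le: "(\<Sum>j<n. (hnorm H (x j))\<^sup>2) \<le> 1" by blast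
    have x1: "hnorm H (x j) \<le> 1" if "j < n" for j
    proof -
      have "(hnorm H (x j))\<^sup>2 \<le> (\<Sum>j<n. (hnorm H (x j))\<^sup>2)"
        by (rule member_le_sum) (use that in auto)
      then have "(hnorm H (x j))\<^sup>2 \<le> 1\<^sup>2" using le by simp
      then show ?thesis by (rule power2_le_imp_le) simp
    qed
    have "hnorm H (\<Sum>j<n. A i j (x j)) \<le> (\<Sum>j<n. C i j)" if i: "i < n" for i
    proof -
      have "hnorm H (\<Sum>j<n. A i j (x j)) \<le> (\<Sum>j<n. hnorm H (A i j (x j)))"
        using x bops_in[OF A] i by (intro hnorm_sum) auto
      also have "\<dots> \<le> (\<Sum>j<n. C i j)"
      proof (rule sum_mono)
        fix j assume "j \<in> {..<n}"
        then have j: "j < n" by simp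
        have "hnorm H (A i j (x j)) \<le> C i j * hnorm H (x j)" using C(2) i j x by simp
        also have "\<dots> \<le> C i j" using C(1)[OF i j] x1[OF j] by (rule mult_left_le[rotated])
        finally show "hnorm H (A i j (x j)) \<le> C i j" .
      qed
      finally show ?thesis .
    qed
    then show "r \<le> sqrt (\<Sum>i<n. (\<Sum>j<n. C i j)\<^sup>2)"
      unfolding r using x bops_in[OF A] by (intro real_sqrt_le_mono sum_mono power_mono) (auto intro!: hnorm_nonneg V_sum)
  qed
qed

lemma matrix_norm_upper:
  assumes "\<And>i j. \<lbrakk>i < n; j < n\<rbrakk> \<Longrightarrow> A i j \<in> bops H"
    "\<And>j. j < n \<Longrightarrow> x j \<in> hcarrier H" "(\<Sum>j<n. (hnorm H (x j))\<^sup>2) \<le> 1"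
  shows "L2_set (\<lambda>i. hnorm H (\<Sum>j<n. A i j (x j))) {..<n} \<le> matrix_norm H n A"
  unfolding matrix_norm_def L2_set_def
  by (rule cSup_upper[OF _ matrix_norm_bdd]) (use assms in blast)+

lemma matrix_norm_nonneg:
  assumes "\<And>i j. \<lbrakk>i < n; j < n\<rbrakk> \<Longrightarrow> A i j \<in> bops H"
  shows "0 \<le> matrix_norm H n A"
proof -
  have "0 \<le> L2_set (\<lambda>i. hnorm H (\<Sum>j<n. A i j 0)) {..<n}" by (rule L2_set_nonneg)
  also have "\<dots> \<le> matrix_norm H n A"
    using assms by (intro matrix_norm_upper) auto
  finally show ?thesis .
qed

lemma matrix_norm_bound:
  assumes A: "\<And>i j. \<lbrakk>i < n; j < n\<rbrakk> \<Longrightarrow> A i j \<in> bops H"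
    and x: "\<And>j. j < n \<Longrightarrow> x j \<in> hcarrier H"
  shows "L2_set (\<lambda>i. hnorm H (\<Sum>j<n. A i j (x j))) {..<n} \<le> matrix_norm H n A * L2_set (\<lambda>j. hnorm H (x j)) {..<n}"
proof -
  define r where "r = L2_set (\<lambda>j. hnorm H (x j)) {..<n}"
  show ?thesis
  proof (cases "r = 0")
    case True
    then have "x j = 0" if "j < n" for j
      using that x hnorm_eq_0_iff by (auto simp: r_def L2_set_eq_0_iff)
    then have "(\<Sum>j<n. A i j (x j)) = 0" if "i < n" for i
      using that bops_0[OF A] by simp
    then have "L2_set (\<lambda>i. hnorm H (\<Sum>j<n. A i j (x j))) {..<n} = 0"
      by (simp add: L2_set_def)
    with True show ?thesis by (simp add: r_def)
  next
    case False
    then have r: "r > 0" unfolding r_def using L2_set_nonneg[of "\<lambda>j. hnorm H (x j)" "{..<n}"] by linarith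
    define y where "y = (\<lambda>j. hscale H (of_real (1 / r)) (x j))"
    have yH: "y j \<in> hcarrier H" if "j < n" for j using x[OF that] by (simp add: y_def)
    have hy: "hnorm H (y j) = 1 / r * hnorm H (x j)" if "j < n" for j
      using x[OF that] r unfolding y_def by (simp only: hnorm_scale norm_of_real) simp
    have "(\<Sum>j<n. (hnorm H (y j))\<^sup>2) = (\<Sum>j<n. (hnorm H (x j))\<^sup>2) / r\<^sup>2"
      by (simp add: hy power_divide sum_divide_distrib)
    also have "(\<Sum>j<n. (hnorm H (x j))\<^sup>2) = r\<^sup>2"
      by (simp add: r_def L2_set_def sum_nonneg)
    finally have y1: "(\<Sum>j<n. (hnorm H (y j))\<^sup>2) \<le> 1" using r by simp
    have "hnorm H (\<Sum>j<n. A i j (y j)) = 1 / r * hnorm H (\<Sum>j<n. A i j (x j))" if i: "i < n" for i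
    proof -
      have "(\<Sum>j<n. A i j (y j)) = (\<Sum>j<n. hscale H (of_real (1 / r)) (A i j (x j)))"
        by (intro sum.cong) (auto simp: y_def bops_scale[OF A[OF i]] x)
      also have "\<dots> = hscale H (of_real (1 / r)) (\<Sum>j<n. A i j (x j))" by (rule scale_sum_right[symmetric])
      finally have "hnorm H (\<Sum>j<n. A i j (y j)) = cmod (of_real (1 / r)) * hnorm H (\<Sum>j<n. A i j (x j))"
        using bops_in[OF A[OF i]] x by (auto simp only: intro!: hnorm_scale V_sum)
      then show ?thesis using r by (simp only: norm_of_real) simp
    qed
    then have "L2_set (\<lambda>i. hnorm H (\<Sum>j<n. A i j (y j))) {..<n} = L2_set (\<lambda>i. 1 / r * hnorm H (\<Sum>j<n. A i j (x j))) {..<n}"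
      by (intro L2_set_cong) auto
    also have "\<dots> = 1 / r * L2_set (\<lambda>i. hnorm H (\<Sum>j<n. A i j (x j))) {..<n}"
      using r by (intro L2_set_right_distrib[symmetric]) simp
    finally have "1 / r * L2_set (\<lambda>i. hnorm H (\<Sum>j<n. A i j (x j))) {..<n} \<le> matrix_norm H n A"
      using matrix_norm_upper[of n A y] A yH y1 by simp
    then show ?thesis using r by (simp add: r_def[symmetric] field_simps)
  qed
qed

end


subsection \<open>The Poisson kernel and the von Neumann inequality\<close>

context pure_row
begin

text \<open>Contractivity says that the defect form is semidefinite; Cholesky splits it into
  functionals, and Riesz turns these into vectors.\<close>

lemma defect_exists:
  obtains m :: nat and v where "\<And>i. i < m \<Longrightarrow> v i \<in> hcarrier H"
    "\<And>x y. \<lbrakk>x \<in> hcarrier H; y \<in> hcarrier H\<rbrakk> \<Longrightarrow>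
       hinner H x y - (\<Sum>k\<in>UNIV. hinner H (S k x) (S k y)) = (\<Sum>i<m. hinner H x (v i) * cnj (hinner H y (v i)))"
proof -
  define q where "q = (\<lambda>x y. hinner H x y - (\<Sum>k\<in>UNIV. hinner H (S k x) (S k y)))"
  interpret q: psd_form "hscale H" "hcarrier H" q
  proof unfold_locales
    fix x assume x: "x \<in> hcarrier H"
    show "0 \<le> Re (q x x)" using contr[OF x] x by (simp add: q_def hnorm_power2 S_in)
  next
    fix x y assume "x \<in> hcarrier H" "y \<in> hcarrier H"
    then show "q y x = cnj (q x y)"
      unfolding q_def complex_cnj_diff cnj_sum by (simp add: S_in flip: commute)
  qed (auto simp: q_def subspace_V add_left scale_left S_in S_add S_scale sum.distrib sum_distrib_left algebra_simps)
  obtain B where B: "finite B" "B \<subseteq> hcarrier H" "span B = hcarrier H"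
    using findim by (auto simp: finite_dimensional_def)
  obtain m :: nat and l where l: "\<And>i. i < m \<Longrightarrow> linear_functional_on (hscale H) (hcarrier H) (l i)"
    "\<And>x y. \<lbrakk>x \<in> hcarrier H; y \<in> hcarrier H\<rbrakk> \<Longrightarrow> q x y = (\<Sum>i<m. l i x * cnj (l i y))"
    using q.cholesky[OF B] by blast
  have "\<forall>i. \<exists>v. i < m \<longrightarrow> v \<in> hcarrier H \<and> (\<forall>x\<in>hcarrier H. l i x = hinner H x v)"
    using riesz[OF l(1)] by metis
  then obtain v where v: "\<And>i. i < m \<Longrightarrow> v i \<in> hcarrier H"
    "\<And>i x. \<lbrakk>i < m; x \<in> hcarrier H\<rbrakk> \<Longrightarrow> l i x = hinner H x (v i)" by metis
  show thesis
    by (rule that[of m v]) (use v l(2) in \<open>auto simp: q_def\<close>)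
qed

end

text \<open>The defect vectors are parameters so that the Poisson kernel can be defined from them;
  \<open>defect_exists\<close> provides an instance.\<close>

locale pure_row_defect = pure_row +
  fixes m :: nat and v :: "nat \<Rightarrow> 'a"
  assumes v_in [simp]: "i < m \<Longrightarrow> v i \<in> hcarrier H"
    and defect: "\<lbrakk>x \<in> hcarrier H; y \<in> hcarrier H\<rbrakk> \<Longrightarrow>
       hinner H x y - (\<Sum>k\<in>UNIV. hinner H (S k x) (S k y)) = (\<Sum>i<m. hinner H x (v i) * cnj (hinner H y (v i)))"
begin

text \<open>Here \<open>'b\<close> is the index type of the tuple. Dividing by the weight cancels
  the weight of the inner product, so that pairing f with K_i x yields the sum of f_\<alpha>
  <T^\<alpha> v_i, x>.\<close>

definition poisson :: "nat \<Rightarrow> 'a \<Rightarrow> complex ^ 'b \<Rightarrow> complex" where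
  "poisson i x = da_fun (\<lambda>\<alpha>. hinner H (madj \<alpha> x) (v i) / of_real (da_weight \<alpha>))"

lemma poisson_l2:
  assumes x: "x \<in> hcarrier H" and i: "i < m"
  shows "l2_coeff (\<lambda>\<alpha>. hinner H (madj \<alpha> x) (v i) / of_real (da_weight \<alpha>))"
  unfolding l2_coeff_def
proof (rule summable_on_comparison_test)
  show "(\<lambda>\<alpha>. (tau \<alpha>)\<^sup>2 / da_weight \<alpha> * (hnorm H x * hnorm H (v i))\<^sup>2) summable_on UNIV"
    by (intro summable_on_cmult_left tau_summable)
  fix \<alpha>
  have "cmod (hinner H (madj \<alpha> x) (v i)) \<le> hnorm H (madj \<alpha> x) * hnorm H (v i)"
    using x i by (intro hinner_le) auto
  also have "\<dots> \<le> tau \<alpha> * hnorm H x * hnorm H (v i)"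
    using x i by (intro mult_right_mono madj_bound) auto
  finally have "(cmod (hinner H (madj \<alpha> x) (v i)))\<^sup>2 \<le> (tau \<alpha> * (hnorm H x * hnorm H (v i)))\<^sup>2"
    by (intro power_mono) (auto simp: mult.assoc)
  then have "(cmod (hinner H (madj \<alpha> x) (v i)))\<^sup>2 / da_weight \<alpha> \<le> (tau \<alpha> * (hnorm H x * hnorm H (v i)))\<^sup>2 / da_weight \<alpha>"
    using da_weight_pos[of \<alpha>] by (intro divide_right_mono) auto
  then show "da_weight \<alpha> * (cmod (hinner H (madj \<alpha> x) (v i) / of_real (da_weight \<alpha>)))\<^sup>2
      \<le> (tau \<alpha>)\<^sup>2 / da_weight \<alpha> * (hnorm H x * hnorm H (v i))\<^sup>2"
    using da_weight_pos[of \<alpha>] by (simp add: norm_divide power_divide power_mult_distrib power2_eq_square mult_ac)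
qed (simp add: da_weight_pos less_imp_le)

lemma poisson_in [simp]: "\<lbrakk>x \<in> hcarrier H; i < m\<rbrakk> \<Longrightarrow> poisson i x \<in> da_space"
  unfolding poisson_def by (intro da_fun_in poisson_l2)

lemma da_coeff_poisson:
  "\<lbrakk>x \<in> hcarrier H; i < m\<rbrakk> \<Longrightarrow> da_coeff (poisson i x) = (\<lambda>\<alpha>. hinner H (madj \<alpha> x) (v i) / of_real (da_weight \<alpha>))"
  unfolding poisson_def by (intro da_coeff_da_fun poisson_l2)

text \<open>The adjoint of \<open>poisson i\<close> is the map \<open>f \<mapsto> f(T) v\<^sub>i\<close>.\<close>

lemma hinner_poisson:
  assumes f: "f \<in> da_space" and x: "x \<in> hcarrier H" and i: "i < m"
  shows "hinner drury_arveson f (poisson i x) = hinner H (calc (da_coeff f) (v i)) x"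
proof -
  have eq: "of_real (da_weight \<alpha>) * da_coeff f \<alpha> * cnj (da_coeff (poisson i x) \<alpha>) =
      da_coeff f \<alpha> * hinner H (monop \<alpha> (v i)) x" for \<alpha>
    using x i da_weight_pos[of \<alpha>] commute[of "madj \<alpha> x" "v i"]
    by (simp add: da_coeff_poisson adj_monop)
  show ?thesis
    unfolding drury_arveson_simps eq by (rule infsumI[OF calc_has_sum[OF da_space_l2[OF f] v_in[OF i] x]])
qed

text \<open>The polarization of \<open>energy n\<close>.\<close>

definition graded_inner :: "'a \<Rightarrow> 'a \<Rightarrow> nat \<Rightarrow> complex" where
  "graded_inner x y n = (\<Sum>\<alpha>\<in>midx n. inverse (da_weight \<alpha>) *\<^sub>R hinner H (madj \<alpha> x) (madj \<alpha> y))"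

lemma graded_inner_limit:
  assumes x: "x \<in> hcarrier H" and y: "y \<in> hcarrier H"
  shows "graded_inner x y \<longlonglongrightarrow> 0"
proof -
  have bound: "cmod (graded_inner x y n) \<le> energy n x + energy n y" for n
  proof -
    have "cmod (graded_inner x y n) \<le> (\<Sum>\<alpha>\<in>midx n. cmod (inverse (da_weight \<alpha>) *\<^sub>R hinner H (madj \<alpha> x) (madj \<alpha> y)))"
      unfolding graded_inner_def by (rule norm_sum)
    also have "\<dots> \<le> (\<Sum>\<alpha>\<in>midx n. (hnorm H (madj \<alpha> x))\<^sup>2 / da_weight \<alpha> + (hnorm H (madj \<alpha> y))\<^sup>2 / da_weight \<alpha>)"
    proof (rule sum_mono)
      fix \<alpha>
      have "cmod (hinner H (madj \<alpha> x) (madj \<alpha> y)) \<le> hnorm H (madj \<alpha> x) * hnorm H (madj \<alpha> y)"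
        using x y by (intro hinner_le) auto
      also have "\<dots> \<le> (hnorm H (madj \<alpha> x))\<^sup>2 + (hnorm H (madj \<alpha> y))\<^sup>2"
        using weighted_product_le[of 1] by simp
      finally have le: "cmod (hinner H (madj \<alpha> x) (madj \<alpha> y)) / da_weight \<alpha> \<le> ((hnorm H (madj \<alpha> x))\<^sup>2 + (hnorm H (madj \<alpha> y))\<^sup>2) / da_weight \<alpha>"
        using da_weight_pos[of \<alpha>] by (intro divide_right_mono) auto
      have "cmod (inverse (da_weight \<alpha>) *\<^sub>R hinner H (madj \<alpha> x) (madj \<alpha> y)) =
          cmod (hinner H (madj \<alpha> x) (madj \<alpha> y)) / da_weight \<alpha>"
        using da_weight_pos[of \<alpha>] by (simp add: divide_inverse mult.commute)
      with le show "cmod (inverse (da_weight \<alpha>) *\<^sub>R hinner H (madj \<alpha> x) (madj \<alpha> y))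
          \<le> (hnorm H (madj \<alpha> x))\<^sup>2 / da_weight \<alpha> + (hnorm H (madj \<alpha> y))\<^sup>2 / da_weight \<alpha>"
        by (simp only: add_divide_distrib)
    qed
    also have "\<dots> = energy n x + energy n y"
      using x y by (simp add: energy_midx sum.distrib)
    finally show ?thesis .
  qed
  have "(\<lambda>n. energy n x + energy n y) \<longlonglongrightarrow> 0 + 0"
    unfolding energy_def using x y by (intro tendsto_add pure)
  then have lim: "(\<lambda>n. energy n x + energy n y) \<longlonglongrightarrow> 0" by simp
  show "graded_inner x y \<longlonglongrightarrow> 0"
    by (rule Lim_null_comparison[OF _ lim]) (use bound in auto)
qed

lemma graded_inner_0: "\<lbrakk>x \<in> hcarrier H; y \<in> hcarrier H\<rbrakk> \<Longrightarrow> graded_inner x y 0 = hinner H x y"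
  by (simp add: graded_inner_def midx_0 da_weight_0 madj_0)

text \<open>
  The Poisson kernel \<open>(poisson i)\<^sub>i\<close> is isometric: by the choice of the \<open>v\<^sub>i\<close>, the terms of degree \<open>n\<close>
  telescope, and purity makes the remainder vanish.
\<close>

lemma poisson_isometry:
  assumes x: "x \<in> hcarrier H" and y: "y \<in> hcarrier H"
  shows "(\<Sum>i<m. hinner drury_arveson (poisson i x) (poisson i y)) = hinner H x y"
proof -
  define g where "g = (\<lambda>\<alpha>. inverse (da_weight \<alpha>) *\<^sub>R
     (hinner H (madj \<alpha> x) (madj \<alpha> y) - (\<Sum>k\<in>UNIV. hinner H (S k (madj \<alpha> x)) (S k (madj \<alpha> y)))))"
  have "((\<lambda>\<alpha>. \<Sum>i<m. of_real (da_weight \<alpha>) * da_coeff (poisson i x) \<alpha> * cnj (da_coeff (poisson i y) \<alpha>)) has_sum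
      (\<Sum>i<m. hinner drury_arveson (poisson i x) (poisson i y))) UNIV"
    unfolding drury_arveson_simps
    using x y by (intro has_sum_finite_sum has_sum_infsum l2_coeff_inner da_space_l2) auto
  moreover have "(\<Sum>i<m. of_real (da_weight \<alpha>) * da_coeff (poisson i x) \<alpha> * cnj (da_coeff (poisson i y) \<alpha>)) = g \<alpha>" for \<alpha>
  proof -
    have "of_real (da_weight \<alpha>) * da_coeff (poisson i x) \<alpha> * cnj (da_coeff (poisson i y) \<alpha>) =
       inverse (da_weight \<alpha>) *\<^sub>R (hinner H (madj \<alpha> x) (v i) * cnj (hinner H (madj \<alpha> y) (v i)))" if "i < m" for i
      using x y that da_weight_pos[of \<alpha>] by (simp add: da_coeff_poisson scaleR_conv_of_real field_simps)
    then show ?thesis using x y by (simp add: g_def defect scaleR_sum_right)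
  qed
  ultimately have "(g has_sum (\<Sum>i<m. hinner drury_arveson (poisson i x) (poisson i y))) UNIV" by simp
  then have "(\<lambda>n. \<Sum>\<alpha>\<in>midx n. g \<alpha>) sums (\<Sum>i<m. hinner drury_arveson (poisson i x) (poisson i y))"
    by (rule graded_sums)
  \<comment> \<open>Pascal's rule turns the terms with S_k T^\<alpha>* in degree n into the form of
    degree n + 1.\<close>
  moreover have "(\<Sum>\<alpha>\<in>midx n. g \<alpha>) = graded_inner x y n - graded_inner x y (Suc n)" for n
    using x y
    by (simp add: g_def graded_inner_def sum_midx_Suc madj_bump scaleR_diff_right sum_subtractf scaleR_sum_right sum.swap[of _ UNIV])
  moreover have "(\<lambda>n. graded_inner x y n - graded_inner x y (Suc n)) sums (graded_inner x y 0 - 0)"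
    by (rule telescope_sums'[OF graded_inner_limit[OF x y]])
  ultimately show ?thesis
    using sums_unique2 graded_inner_0[OF x y] by fastforce
qed

text \<open>The identity sum K_i* K_i = I, with K_i* f = f(T) v_i inserted.\<close>

lemma poisson_reconstruct:
  assumes x: "x \<in> hcarrier H"
  shows "(\<Sum>i<m. calc (da_coeff (poisson i x)) (v i)) = x"
proof (rule eq_if_hinner_eq)
  show "(\<Sum>i<m. calc (da_coeff (poisson i x)) (v i)) \<in> hcarrier H" by (intro V_sum) auto
  fix y assume y: "y \<in> hcarrier H"
  have "hinner H (\<Sum>i<m. calc (da_coeff (poisson i x)) (v i)) y = (\<Sum>i<m. hinner H (calc (da_coeff (poisson i x)) (v i)) y)"
    using y by (intro sum_left) auto
  also have "\<dots> = (\<Sum>i<m. hinner drury_arveson (poisson i x) (poisson i y))"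
    using x y by (intro sum.cong refl hinner_poisson[symmetric]) auto
  finally show "hinner H (\<Sum>i<m. calc (da_coeff (poisson i x)) (v i)) y = hinner H x y"
    using poisson_isometry[OF x y] by simp
qed fact

text \<open>The adjoints intertwine: \<phi>(T) K_i* f = \<phi>(T) f(T) v_i = (\<phi> f)(T) v_i =
  K_i* M_\<phi> f. Apply this to f = K_i x and sum.\<close>

lemma poisson_transform:
  assumes \<phi>: "\<phi> \<in> multipliers" and x: "x \<in> hcarrier H" and y: "y \<in> hcarrier H"
  shows "hinner H (calc (da_coeff \<phi>) x) y = (\<Sum>i<m. hinner drury_arveson (mult_op \<phi> (poisson i x)) (poisson i y))"
proof -
  have b: "calc (da_coeff \<phi>) \<in> bops H" by (intro calc_bops da_space_l2 multiplier_da \<phi>)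
  have "calc (da_coeff \<phi>) x = calc (da_coeff \<phi>) (\<Sum>i<m. calc (da_coeff (poisson i x)) (v i))"
    using poisson_reconstruct[OF x] by simp
  also have "\<dots> = (\<Sum>i<m. calc (da_coeff \<phi>) (calc (da_coeff (poisson i x)) (v i)))"
    by (rule bops_sum[OF b]) auto
  also have "\<dots> = (\<Sum>i<m. calc (da_coeff (mult_op \<phi> (poisson i x))) (v i))"
    using x by (intro sum.cong refl) (simp add: mult_op_apply calc_da_mult multiplier_da[OF \<phi>] multiplier_mult[OF \<phi>])
  finally have "hinner H (calc (da_coeff \<phi>) x) y = (\<Sum>i<m. hinner H (calc (da_coeff (mult_op \<phi> (poisson i x))) (v i)) y)"
    using x y multiplier_mult[OF \<phi>] by (simp only:) (intro sum_left, auto)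
  also have "\<dots> = (\<Sum>i<m. hinner drury_arveson (mult_op \<phi> (poisson i x)) (poisson i y))"
    using x y multiplier_mult[OF \<phi>] by (intro sum.cong refl hinner_poisson[symmetric]) (auto simp: mult_op_apply)
  finally show ?thesis .
qed

lemma poisson_norm:
  assumes x: "x \<in> hcarrier H"
  shows "(\<Sum>i<m. (hnorm drury_arveson (poisson i x))\<^sup>2) = (hnorm H x)\<^sup>2"
proof -
  have "(\<Sum>i<m. (hnorm drury_arveson (poisson i x))\<^sup>2) = (\<Sum>i<m. Re (hinner drury_arveson (poisson i x) (poisson i x)))"
    using x by (intro sum.cong refl DA.hnorm_power2) auto
  also have "\<dots> = Re (hinner H x x)" unfolding Re_sum[symmetric] by (simp only: poisson_isometry[OF x x])
  finally show ?thesis using x by (simp add: hnorm_power2)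
qed

text \<open>The image z of the column x is tested against itself: its squared norm is a sum over l
  of pairings of M_\<phi> K_l x with K_l z. Cauchy-Schwarz over i and the matrix norm treat each l
  separately, Cauchy-Schwarz over l collects them, and one factor of the norm of z cancels.\<close>

lemma von_neumann:
  assumes \<phi>: "\<And>i j. \<lbrakk>i < n; j < n\<rbrakk> \<Longrightarrow> \<phi> i j \<in> multipliers"
    and x: "\<And>j. j < n \<Longrightarrow> x j \<in> hcarrier H"
  shows "L2_set (\<lambda>i. hnorm H (\<Sum>j<n. calc (da_coeff (\<phi> i j)) (x j))) {..<n} \<le>
     matrix_norm drury_arveson n (\<lambda>i j. mult_op (\<phi> i j)) * L2_set (\<lambda>j. hnorm H (x j)) {..<n}"
proof -
  define C where "C = matrix_norm drury_arveson n (\<lambda>i j. mult_op (\<phi> i j))"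
  define z where "z = (\<lambda>i. \<Sum>j<n. calc (da_coeff (\<phi> i j)) (x j))"
  define g where "g = (\<lambda>l i. \<Sum>j<n. mult_op (\<phi> i j) (poisson l (x j)))"
  let ?X = "L2_set (\<lambda>j. hnorm H (x j)) {..<n}" and ?Z = "L2_set (\<lambda>i. hnorm H (z i)) {..<n}"
  have bops: "mult_op (\<phi> i j) \<in> bops drury_arveson" if "i < n" "j < n" for i j
    using \<phi>[OF that] by (rule multiplier_bops)
  have C: "0 \<le> C" unfolding C_def using bops by (rule DA.matrix_norm_nonneg)
  have zH: "z i \<in> hcarrier H" if "i < n" for i
    unfolding z_def using x by (intro V_sum) auto
  have mp: "mult_op (\<phi> i j) (poisson l (x j)) \<in> da_space" if "i < n" "j < n" "l < m" for i j l
    using DA.bops_in[OF bops[OF that(1,2)], of "poisson l (x j)"] x that by simp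
  have gda: "g l i \<in> da_space" if "l < m" "i < n" for l i
    using DA.V_sum[of "{..<n}" "\<lambda>j. mult_op (\<phi> i j) (poisson l (x j))"] mp that by (simp add: g_def)
  have zz: "hinner H (z i) (z i) = (\<Sum>l<m. hinner drury_arveson (g l i) (poisson l (z i)))" if i: "i < n" for i
  proof -
    have "hinner H (z i) (z i) = (\<Sum>j<n. hinner H (calc (da_coeff (\<phi> i j)) (x j)) (z i))"
      using zH[OF i] x by (subst (1) z_def) (auto intro!: sum_left)
    also have "\<dots> = (\<Sum>j<n. \<Sum>l<m. hinner drury_arveson (mult_op (\<phi> i j) (poisson l (x j))) (poisson l (z i)))"
      using zH[OF i] x \<phi>[OF i] by (intro sum.cong refl poisson_transform) auto
    also have "\<dots> = (\<Sum>l<m. \<Sum>j<n. hinner drury_arveson (mult_op (\<phi> i j) (poisson l (x j))) (poisson l (z i)))"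
      by (rule sum.swap)
    also have "\<dots> = (\<Sum>l<m. hinner drury_arveson (g l i) (poisson l (z i)))"
      unfolding g_def using zH[OF i] mp i by (intro sum.cong refl DA.sum_left[symmetric]) auto
    finally show ?thesis .
  qed
  have "?Z\<^sup>2 = (\<Sum>i<n. (hnorm H (z i))\<^sup>2)"
    by (simp add: L2_set_def sum_nonneg)
  also have "\<dots> = (\<Sum>i<n. \<Sum>l<m. Re (hinner drury_arveson (g l i) (poisson l (z i))))"
    using zH by (intro sum.cong refl) (simp add: hnorm_power2 zz del: drury_arveson_simps)
  also have "\<dots> \<le> (\<Sum>i<n. \<Sum>l<m. hnorm drury_arveson (g l i) * hnorm drury_arveson (poisson l (z i)))"
  proof (intro sum_mono)
    fix i l assume "i \<in> {..<n}" "l \<in> {..<m}"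
    then have "cmod (hinner drury_arveson (g l i) (poisson l (z i))) \<le> hnorm drury_arveson (g l i) * hnorm drury_arveson (poisson l (z i))"
      using gda zH by (intro DA.hinner_le) auto
    then show "Re (hinner drury_arveson (g l i) (poisson l (z i))) \<le> hnorm drury_arveson (g l i) * hnorm drury_arveson (poisson l (z i))"
      using complex_Re_le_cmod order_trans by blast
  qed
  also have "\<dots> = (\<Sum>l<m. \<Sum>i<n. hnorm drury_arveson (g l i) * hnorm drury_arveson (poisson l (z i)))"
    by (rule sum.swap)
  also have "\<dots> \<le> (\<Sum>l<m. (C * L2_set (\<lambda>j. hnorm drury_arveson (poisson l (x j))) {..<n}) * L2_set (\<lambda>i. hnorm drury_arveson (poisson l (z i))) {..<n})"
  proof (intro sum_mono)
    fix l assume l: "l \<in> {..<m}"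
    have "(\<Sum>i<n. hnorm drury_arveson (g l i) * hnorm drury_arveson (poisson l (z i))) \<le>
       (\<Sum>i<n. \<bar>hnorm drury_arveson (g l i)\<bar> * \<bar>hnorm drury_arveson (poisson l (z i))\<bar>)"
      by (intro sum_mono) (simp flip: abs_mult)
    also have "\<dots> \<le> L2_set (\<lambda>i. hnorm drury_arveson (g l i)) {..<n} * L2_set (\<lambda>i. hnorm drury_arveson (poisson l (z i))) {..<n}"
      by (rule L2_set_mult_ineq)
    also have "\<dots> \<le> (C * L2_set (\<lambda>j. hnorm drury_arveson (poisson l (x j))) {..<n}) * L2_set (\<lambda>i. hnorm drury_arveson (poisson l (z i))) {..<n}"
      unfolding g_def C_def using bops x l
      by (intro mult_right_mono DA.matrix_norm_bound L2_set_nonneg) auto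
    finally show "(\<Sum>i<n. hnorm drury_arveson (g l i) * hnorm drury_arveson (poisson l (z i))) \<le> \<dots>" .
  qed
  also have "\<dots> = C * (\<Sum>l<m. \<bar>L2_set (\<lambda>j. hnorm drury_arveson (poisson l (x j))) {..<n}\<bar> * \<bar>L2_set (\<lambda>i. hnorm drury_arveson (poisson l (z i))) {..<n}\<bar>)"
    by (simp add: sum_distrib_left mult.assoc abs_of_nonneg[OF L2_set_nonneg])
  also have "\<dots> \<le> C * (L2_set (\<lambda>l. L2_set (\<lambda>j. hnorm drury_arveson (poisson l (x j))) {..<n}) {..<m} *
      L2_set (\<lambda>l. L2_set (\<lambda>i. hnorm drury_arveson (poisson l (z i))) {..<n}) {..<m})"
    using C by (intro mult_left_mono L2_set_mult_ineq)
  \<comment> \<open>After exchanging the sums over l and j, the isometry of the Poisson kernel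
    applies to each entry.\<close>
  also have "\<dots> = C * (?X * ?Z)"
  proof -
    have "L2_set (\<lambda>l. L2_set (\<lambda>j. hnorm drury_arveson (poisson l (u j))) {..<n}) {..<m} = L2_set (\<lambda>j. hnorm H (u j)) {..<n}"
      if u: "\<And>j. j < n \<Longrightarrow> u j \<in> hcarrier H" for u
    proof -
      have "(\<Sum>l<m. \<Sum>j<n. (hnorm drury_arveson (poisson l (u j)))\<^sup>2) = (\<Sum>j<n. (hnorm H (u j))\<^sup>2)"
        using u by (subst sum.swap) (simp add: poisson_norm)
      then show ?thesis by (simp add: L2_set_def sum_nonneg)
    qed
    then show ?thesis using x zH by simp
  qed
  finally have "?Z * ?Z \<le> (C * ?X) * ?Z" by (simp add: power2_eq_square mult.assoc)
  moreover have "0 \<le> ?Z" "0 \<le> C * ?X" using C by (auto intro: L2_set_nonneg mult_nonneg_nonneg)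
  ultimately have "?Z \<le> C * ?X"
    by (cases "?Z = 0") auto
  then show ?thesis by (simp add: z_def C_def)
qed

end


subsection \<open>The functional calculus\<close>

lemma suminf_single: "(\<And>n. n \<noteq> 0 \<Longrightarrow> h n = 0) \<Longrightarrow> (\<Sum>n. h n) = (h 0 :: 'b::real_normed_vector)"
  using suminf_finite[of "{0}" h] by simp

text \<open>\<open>bops H\<close> is itself a subbasic set, for f = g = 0 and U = UNIV.\<close>

lemma topspace_weak_star: "inner_space H \<Longrightarrow> topspace (weak_star H) = bops H"
proof -
  assume "inner_space H"
  then interpret inner_space H .
  have "square_summable H (\<lambda>_. 0)" by (simp add: square_summable_def)
  then have "bops H \<in> {{A \<in> bops H. (\<Sum>n. hinner H (A (f n)) (g n)) \<in> U} | f g U.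
        square_summable H f \<and> square_summable H g \<and> open U}"
    by (intro CollectI exI[of _ "\<lambda>_. 0"] exI[of _ UNIV]) auto
  then show ?thesis unfolding weak_star_def topology_generated_by_topspace by blast
qed

lemma functional_calculusD:
  assumes "is_functional_calculus H T \<Phi>"
  shows "\<phi> \<in> multipliers \<Longrightarrow> \<Phi> \<phi> \<in> bops H"
    "\<lbrakk>\<phi> \<in> multipliers; \<psi> \<in> multipliers\<rbrakk> \<Longrightarrow> \<Phi> (\<lambda>x. \<phi> x + \<psi> x) = (\<lambda>h. \<Phi> \<phi> h + \<Phi> \<psi> h)"
    "\<phi> \<in> multipliers \<Longrightarrow> \<Phi> (\<lambda>x. c * \<phi> x) = (\<lambda>h. hscale H c (\<Phi> \<phi> h))"
    "\<lbrakk>\<phi> \<in> multipliers; \<psi> \<in> multipliers\<rbrakk> \<Longrightarrow> \<Phi> (\<lambda>x. \<phi> x * \<psi> x) = \<Phi> \<phi> \<circ> \<Phi> \<psi>"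
    "\<Phi> ball_one = hid H" "\<Phi> (ball_coord k) = T k"
  using assms unfolding is_functional_calculus_def by (elim conjE; blast)+

context pure_row
begin

text \<open>
  A trace class functional on \<open>B(H)\<close> pulls back to the functional \<open>\<phi> \<mapsto> \<langle>M\<^sub>\<phi> 1, G\<rangle>\<close>, which has rank one.
\<close>

lemma trace_functional_pullback:
  assumes f: "square_summable H f" and g: "square_summable H g"
  obtains G where "G \<in> da_space"
    "\<And>\<phi>. \<phi> \<in> da_space \<Longrightarrow> (\<Sum>n. hinner H (calc (da_coeff \<phi>) (f n)) (g n)) = hinner drury_arveson \<phi> G"
proof -
  have fH: "f n \<in> hcarrier H" and gH: "g n \<in> hcarrier H" for n
    using f g by (auto simp: square_summable_def)
  define b where "b = (\<lambda>n. hnorm H (f n) * hnorm H (g n))"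
  have b0: "0 \<le> b n" for n using fH gH by (simp add: b_def)
  have "summable b"
  proof (rule summable_comparison_test')
    show "summable (\<lambda>n. (hnorm H (f n))\<^sup>2 + (hnorm H (g n))\<^sup>2)"
      using f g by (intro summable_add) (auto simp: square_summable_def)
    show "norm (b n) \<le> (hnorm H (f n))\<^sup>2 + (hnorm H (g n))\<^sup>2" for n
      using b0[of n] weighted_product_le[of 1 "hnorm H (f n)" "hnorm H (g n)"] by (simp add: b_def)
  qed
  then have b: "b summable_on UNIV" by (rule summable_nonneg_imp_summable_on) (rule b0)
  define t where "t = (\<lambda>\<alpha>. \<Sum>\<^sub>\<infinity>n. hinner H (monop \<alpha> (f n)) (g n))"
  have le: "cmod (hinner H (monop \<alpha> (f n)) (g n)) \<le> tau \<alpha> * b n" for \<alpha> n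
    unfolding b_def using fH gH by (rule hinner_monop_bound)
  have t: "((\<lambda>n. hinner H (monop \<alpha> (f n)) (g n)) has_sum t \<alpha>) UNIV" for \<alpha>
    unfolding t_def
  proof (rule has_sum_infsum, rule Infinite_Sum.abs_summable_summable, rule summable_on_comparison_test)
    show "(\<lambda>n. tau \<alpha> * b n) summable_on UNIV" by (rule summable_on_cmult_right[OF b])
    show "cmod (hinner H (monop \<alpha> (f n)) (g n)) \<le> tau \<alpha> * b n" for n by (rule le)
  qed simp
  have t_le: "cmod (t \<alpha>) \<le> tau \<alpha> * infsum b UNIV" for \<alpha>
    by (rule norm_infsum_le[OF t has_sum_cmult_right[OF has_sum_infsum[OF b]]]) (rule le)
  have t2: "(cmod (t \<alpha>))\<^sup>2 \<le> (tau \<alpha>)\<^sup>2 * (infsum b UNIV)\<^sup>2" for \<alpha>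
    using power_mono[OF t_le[of \<alpha>], of 2] by (simp add: power_mult_distrib)
  \<comment> \<open>Weight and conjugation are arranged to cancel in the inner product: \<phi>
    paired with \<open>da_fun c\<close> is the sum of a_\<alpha> t_\<alpha>, where t_\<alpha> is the
    trace functional at T^\<alpha>.\<close>
  define c where "c = (\<lambda>\<alpha>. cnj (t \<alpha>) / of_real (da_weight \<alpha>))"
  have c: "l2_coeff c"
    unfolding l2_coeff_def
  proof (rule summable_on_comparison_test)
    show "(\<lambda>\<alpha>. (tau \<alpha>)\<^sup>2 / da_weight \<alpha> * (infsum b UNIV)\<^sup>2) summable_on UNIV"
      by (intro summable_on_cmult_left tau_summable)
    fix \<alpha>
    have "da_weight \<alpha> * (cmod (c \<alpha>))\<^sup>2 = (cmod (t \<alpha>))\<^sup>2 / da_weight \<alpha>"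
      using da_weight_pos[of \<alpha>] by (simp add: c_def norm_divide power_divide power2_eq_square)
    also have "\<dots> \<le> (tau \<alpha>)\<^sup>2 * (infsum b UNIV)\<^sup>2 / da_weight \<alpha>"
      using t2 da_weight_pos[of \<alpha>] by (intro divide_right_mono) auto
    finally show "da_weight \<alpha> * (cmod (c \<alpha>))\<^sup>2 \<le> (tau \<alpha>)\<^sup>2 / da_weight \<alpha> * (infsum b UNIV)\<^sup>2" by simp
  qed (simp add: da_weight_pos less_imp_le)
  show thesis
  proof (rule that[OF da_fun_in[OF c]])
    fix \<phi> :: "complex ^ 'd \<Rightarrow> complex" assume \<phi>: "\<phi> \<in> da_space"
    define a where "a = da_coeff \<phi>"
    have a: "l2_coeff a" unfolding a_def by (rule da_space_l2[OF \<phi>])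
    \<comment> \<open>Summing over n first gives the pairing with G, summing over \<alpha> first
      gives the trace functional at \<phi>(T).\<close>
    define F where "F = (\<lambda>(\<alpha>, n). a \<alpha> * hinner H (monop \<alpha> (f n)) (g n))"
    have "(\<lambda>p. norm (F p)) summable_on (UNIV \<times> UNIV)"
    proof (rule summable_on_comparison_test)
      show "(\<lambda>(\<alpha>, n). (cmod (a \<alpha>) * tau \<alpha>) * b n) summable_on (UNIV \<times> UNIV)"
        by (intro summable_on_product coeff_tau_summable a b b0) (simp add: tau_nonneg)
      show "norm (F p) \<le> (case p of (\<alpha>, n) \<Rightarrow> (cmod (a \<alpha>) * tau \<alpha>) * b n)" for p
        using mult_left_mono[OF le, of "cmod (a (fst p))" "fst p" "snd p"]
        by (cases p) (simp add: F_def norm_mult mult.assoc)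
    qed simp
    then have "F summable_on (UNIV \<times> UNIV)" by (rule Infinite_Sum.abs_summable_summable)
    then obtain s where s: "(F has_sum s) (UNIV \<times> UNIV)" by (auto simp: summable_on_def)
    then have "((\<lambda>\<alpha>. a \<alpha> * t \<alpha>) has_sum s) UNIV"
      by (rule has_sum_SigmaD) (auto simp: F_def intro!: has_sum_cmult_right t)
    moreover have "of_real (da_weight \<alpha>) * da_coeff \<phi> \<alpha> * cnj (da_coeff (da_fun c) \<alpha>) = a \<alpha> * t \<alpha>" for \<alpha>
      using da_weight_pos[of \<alpha>] by (simp add: da_coeff_da_fun[OF c]) (simp add: c_def a_def)
    ultimately have 1: "hinner drury_arveson \<phi> (da_fun c) = s"
      unfolding drury_arveson_simps by (simp add: infsumI)
    have "((\<lambda>(n, \<alpha>). F (\<alpha>, n)) has_sum s) (UNIV \<times> UNIV)"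
      using s by (subst has_sum_reindex_bij_witness[where i = prod.swap and j = prod.swap and h = F and T = "UNIV \<times> UNIV" and s' = s]) auto
    then have "((\<lambda>n. hinner H (calc a (f n)) (g n)) has_sum s) UNIV"
      by (rule has_sum_SigmaD) (use calc_has_sum[OF a fH gH] in \<open>simp add: F_def\<close>)
    then have "(\<lambda>n. hinner H (calc a (f n)) (g n)) sums s" by (rule has_sum_imp_sums)
    then show "(\<Sum>n. hinner H (calc (da_coeff \<phi>) (f n)) (g n)) = hinner drury_arveson \<phi> (da_fun c)"
      using 1 by (simp add: a_def sums_unique[symmetric] del: drury_arveson_simps)
  qed
qed

lemma calc_continuous: "continuous_map multiplier_topology (weak_star H) (\<lambda>\<phi>. calc (da_coeff \<phi>))"
proof -
  have top: "topspace multiplier_topology = (multipliers :: (complex ^ 'd \<Rightarrow> complex) set)"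
    unfolding multiplier_topology_def topspace_pullback_topology topspace_weak_star[OF da_inner_space]
    by (auto simp: multipliers_def)
  have bops: "calc (da_coeff \<phi>) \<in> bops H" if "\<phi> \<in> multipliers" for \<phi>
    using that by (intro calc_bops da_space_l2 multiplier_da)
  show ?thesis
    unfolding weak_star_def
  proof (rule continuous_on_generated_topo)
    fix W
    assume "W \<in> {{A \<in> bops H. (\<Sum>n. hinner H (A (f n)) (g n)) \<in> U} | f g U.
        square_summable H f \<and> square_summable H g \<and> open U}"
    then obtain f g U where W: "W = {A \<in> bops H. (\<Sum>n. hinner H (A (f n)) (g n)) \<in> U}"
      and fg: "square_summable H f" "square_summable H g" and U: "open U" by blast
    obtain G where G: "G \<in> da_space"
      "\<And>\<phi> :: complex ^ 'd \<Rightarrow> complex. \<phi> \<in> da_space \<Longrightarrow>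
         (\<Sum>n. hinner H (calc (da_coeff \<phi>) (f n)) (g n)) = hinner drury_arveson \<phi> G"
      using trace_functional_pullback[OF fg] by blast
    \<comment> \<open>Concentrating both sequences at index 0 reduces the series to <M_\<phi> 1, G>,
      so the preimage of W is the trace of a subbasic set.\<close>
    define f' where "f' = (\<lambda>n::nat. if n = 0 then ball_one else (0 :: complex ^ 'd \<Rightarrow> complex))"
    define g' where "g' = (\<lambda>n::nat. if n = 0 then G else 0)"
    define V where "V = {A \<in> bops drury_arveson. (\<Sum>n. hinner drury_arveson (A (f' n)) (g' n)) \<in> U}"
    have "summable (\<lambda>n. (hnorm drury_arveson (h n))\<^sup>2)"
      if "\<And>n. n \<noteq> 0 \<Longrightarrow> h n = 0" for h :: "nat \<Rightarrow> complex ^ 'd \<Rightarrow> complex"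
      using that by (intro summable_finite[of "{0}"]) auto
    then have "square_summable drury_arveson f'" "square_summable drury_arveson g'"
      using G(1) ball_one_da DA.V_closed(1) by (auto simp: square_summable_def f'_def g'_def)
    then have V: "openin (weak_star drury_arveson) V"
      unfolding weak_star_def V_def using U by (intro topology_generated_by_Basis) blast
    have "(\<Sum>n. hinner drury_arveson (mult_op \<phi> (f' n)) (g' n)) = (\<Sum>n. hinner H (calc (da_coeff \<phi>) (f n)) (g n))"
      if \<phi>: "\<phi> \<in> multipliers" for \<phi>
    proof -
      have "(\<Sum>n. hinner drury_arveson (mult_op \<phi> (f' n)) (g' n)) = hinner drury_arveson (mult_op \<phi> (f' 0)) (g' 0)"
      proof (rule suminf_single)
        fix n :: nat assume "n \<noteq> 0"
        then show "hinner drury_arveson (mult_op \<phi> (f' n)) (g' n) = 0"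
          using DA.bops_0[OF multiplier_bops[OF \<phi>]] DA.zero_left[of 0] DA.V_closed(1)
          by (simp add: f'_def g'_def del: drury_arveson_simps(3))
      qed
      then show ?thesis
        using G(2)[OF multiplier_da[OF \<phi>]] by (simp add: f'_def g'_def mult_op_one[OF \<phi>])
    qed
    then have "(\<lambda>\<phi>. calc (da_coeff \<phi>)) -` W \<inter> topspace multiplier_topology = mult_op -` V \<inter> multipliers"
      unfolding top using bops multiplier_bops by (auto simp: W V_def)
    then show "openin multiplier_topology ((\<lambda>\<phi>. calc (da_coeff \<phi>)) -` W \<inter> topspace multiplier_topology)"
      unfolding multiplier_topology_def openin_pullback_topology using V by auto
  next
    show "(\<lambda>\<phi>. calc (da_coeff \<phi>)) ` topspace multiplier_topology \<subseteq>
       \<Union> {{A \<in> bops H. (\<Sum>n. hinner H (A (f n)) (g n)) \<in> U} | f g U.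
        square_summable H f \<and> square_summable H g \<and> open U}"
      using topspace_weak_star[OF inner_space_axioms] bops
      unfolding top weak_star_def topology_generated_by_topspace by auto
  qed
qed

lemma calc_completely_contractive:
  assumes "\<And>i j. \<lbrakk>i < n; j < n\<rbrakk> \<Longrightarrow> \<phi> i j \<in> multipliers"
  shows "matrix_norm H n (\<lambda>i j. calc (da_coeff (\<phi> i j))) \<le> matrix_norm drury_arveson n (\<lambda>i j. mult_op (\<phi> i j))"
proof -
  obtain m :: nat and v where v: "\<And>i. i < m \<Longrightarrow> v i \<in> hcarrier H"
    "\<And>x y. \<lbrakk>x \<in> hcarrier H; y \<in> hcarrier H\<rbrakk> \<Longrightarrow>
       hinner H x y - (\<Sum>k\<in>UNIV. hinner H (S k x) (S k y)) = (\<Sum>i<m. hinner H x (v i) * cnj (hinner H y (v i)))"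
    using defect_exists by blast
  interpret pure_row_defect H T S m v by unfold_locales (use v in auto)
  let ?C = "matrix_norm drury_arveson n (\<lambda>i j. mult_op (\<phi> i j))"
  have C: "0 \<le> ?C" using assms by (intro DA.matrix_norm_nonneg multiplier_bops)
  show ?thesis
    unfolding matrix_norm_def[of H]
  proof (rule cSup_least)
    show "{sqrt (\<Sum>i<n. (hnorm H (\<Sum>j<n. calc (da_coeff (\<phi> i j)) (x j)))\<^sup>2) | x.
            (\<forall>j<n. x j \<in> hcarrier H) \<and> (\<Sum>j<n. (hnorm H (x j))\<^sup>2) \<le> 1} \<noteq> {}"
      by (auto intro!: exI[of _ "\<lambda>_. 0"])
    fix r
    assume "r \<in> {sqrt (\<Sum>i<n. (hnorm H (\<Sum>j<n. calc (da_coeff (\<phi> i j)) (x j)))\<^sup>2) | x.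
            (\<forall>j<n. x j \<in> hcarrier H) \<and> (\<Sum>j<n. (hnorm H (x j))\<^sup>2) \<le> 1}"
    then obtain x where r: "r = L2_set (\<lambda>i. hnorm H (\<Sum>j<n. calc (da_coeff (\<phi> i j)) (x j))) {..<n}"
      and x: "\<And>j. j < n \<Longrightarrow> x j \<in> hcarrier H" and le: "(\<Sum>j<n. (hnorm H (x j))\<^sup>2) \<le> 1"
      by (auto simp: L2_set_def)
    have "r \<le> ?C * L2_set (\<lambda>j. hnorm H (x j)) {..<n}"
      unfolding r by (rule von_neumann) (use assms x in auto)
    also have "\<dots> \<le> ?C * 1"
      using C le by (intro mult_left_mono) (auto simp: L2_set_def)
    finally show "r \<le> ?C" by simp
  qed
qed

lemma functional_calculus: "is_functional_calculus H T (\<lambda>\<phi>. calc (da_coeff \<phi>))"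
proof -
  have l2: "l2_coeff (da_coeff \<phi>)" if "\<phi> \<in> multipliers" for \<phi> :: "complex ^ 'd \<Rightarrow> complex"
    using that by (intro da_space_l2 multiplier_da)
  show ?thesis
    unfolding is_functional_calculus_def
  proof (intro conjI ballI allI impI)
    show "(\<lambda>\<phi>. calc (da_coeff \<phi>)) ` multipliers \<subseteq> bops H"
      using calc_bops l2 by auto
    show "continuous_map multiplier_topology (weak_star H) (\<lambda>\<phi>. calc (da_coeff \<phi>))"
      by (rule calc_continuous)
    show "calc (da_coeff ball_one) = hid H"
      unfolding da_coeff_ball_one calc_delta by (rule monop_0)
    show "calc (da_coeff (ball_coord k)) = T k" for k
      unfolding da_coeff_ball_coord calc_delta by (rule monop_unit)
    show "matrix_norm H n (\<lambda>i j. calc (da_coeff (\<phi> i j))) \<le> matrix_norm drury_arveson n (\<lambda>i j. mult_op (\<phi> i j))"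
      if "\<forall>i<n. \<forall>j<n. \<phi> i j \<in> multipliers" for n \<phi>
      using that by (intro calc_completely_contractive) auto
  next
    fix \<phi> :: "complex ^ 'd \<Rightarrow> complex" assume \<phi>: "\<phi> \<in> multipliers"
    show "calc (da_coeff (\<lambda>x. c * \<phi> x)) = (\<lambda>h. hscale H c (calc (da_coeff \<phi>) h))" for c
      using calc_cmult[OF l2[OF \<phi>]] by (simp add: da_cmult[OF multiplier_da[OF \<phi>]] fun_eq_iff)
    fix \<psi> :: "complex ^ 'd \<Rightarrow> complex" assume \<psi>: "\<psi> \<in> multipliers"
    show "calc (da_coeff (\<lambda>x. \<phi> x + \<psi> x)) = (\<lambda>h. calc (da_coeff \<phi>) h + calc (da_coeff \<psi>) h)"
      using calc_add[OF l2[OF \<phi>] l2[OF \<psi>]]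
      by (simp add: da_add[OF multiplier_da[OF \<phi>] multiplier_da[OF \<psi>]] fun_eq_iff)
    show "calc (da_coeff (\<lambda>x. \<phi> x * \<psi> x)) = calc (da_coeff \<phi>) \<circ> calc (da_coeff \<psi>)"
      using calc_da_mult[OF multiplier_da[OF \<phi>] multiplier_da[OF \<psi>]] multiplier_mult[OF \<phi> multiplier_da[OF \<psi>]]
      by (simp add: fun_eq_iff)
  qed
qed

text \<open>\<open>calc\<close> serves as the witness for \<open>SOME\<close>; from here on
  \<open>fun_calc\<close> is handled only through the properties of a functional calculus.\<close>

lemma fun_calc_is_functional_calculus: "is_functional_calculus H T (fun_calc H T)"
  unfolding fun_calc_def by (rule someI[of "is_functional_calculus H T", OF functional_calculus])

end


subsection \<open>Compressions to co-invariant subspaces\<close>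

lemma sub_hspace_simps [simp]:
  "hcarrier (sub_hspace H M) = M" "hscale (sub_hspace H M) = hscale H" "hinner (sub_hspace H M) = hinner H"
  "hnorm (sub_hspace H M) = hnorm H"
  by (simp_all add: sub_hspace_def hnorm_def fun_eq_iff)

context findim_inner_space
begin

lemma findim_sub_hspace:
  assumes "subspace M" "M \<subseteq> hcarrier H"
  shows "findim_inner_space (sub_hspace H M)"
proof (intro findim_inner_space.intro inner_space.intro inner_space_axioms.intro findim_inner_space_axioms.intro)
  show "psd_form (hscale (sub_hspace H M)) (hcarrier (sub_hspace H M)) (hinner (sub_hspace H M))"
    unfolding sub_hspace_simps
  proof unfold_locales
    show "hinner H y x = cnj (hinner H x y)" if "x \<in> M" "y \<in> M" for x y
      using that assms(2) commute by blast
  qed (use assms in \<open>simp_all add: subset_iff add_left scale_left nonneg\<close>)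
  show "0 < Re (hinner (sub_hspace H M) x x)" if "x \<in> hcarrier (sub_hspace H M)" "x \<noteq> 0" for x
    using pos_def[of x] that assms by auto
  obtain E where E: "orthonormal_basis M E" using orthonormal_basis_exists[OF assms] .
  then have fin: "finite E" "E \<subseteq> M" and ex: "\<And>x. x \<in> M \<Longrightarrow> x = (\<Sum>e\<in>E. hscale H (hinner H x e) e)"
    unfolding orthonormal_basis_def by blast+
  have "x \<in> span E" if "x \<in> M" for x
    by (subst ex[OF that]) (intro span_sum span_scale span_base)
  then have "span E = M" using span_minimal[OF fin(2) assms(1)] by auto
  then show "finite_dimensional (sub_hspace H M)"
    using fin by (auto simp: finite_dimensional_def)
qed

lemma hproj_add:
  "\<lbrakk>subspace M; M \<subseteq> hcarrier H; x \<in> hcarrier H; y \<in> hcarrier H\<rbrakk> \<Longrightarrow> hproj H M (x + y) = hproj H M x + hproj H M y"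
  using hproj_in[of M x] hproj_in[of M y]
  by (intro hproj_unique) (auto simp: subspace_add add_left hinner_hproj subset_iff)

lemma hproj_scale:
  "\<lbrakk>subspace M; M \<subseteq> hcarrier H; x \<in> hcarrier H\<rbrakk> \<Longrightarrow> hproj H M (hscale H c x) = hscale H c (hproj H M x)"
  using hproj_in[of M x]
  by (intro hproj_unique) (auto simp: subspace_scale scale_left hinner_hproj subset_iff)

end

locale row_contraction_findim = findim_inner_space H
  for H :: "'a::ab_group_add hspace" +
  fixes T :: "'d::finite \<Rightarrow> 'a \<Rightarrow> 'a"
  assumes row: "row_contraction H T" and comm: "commuting T" and pure_T: "pure_tuple H T"
begin

lemma T_bops: "T k \<in> bops H"
  using row by (simp add: row_contraction_def)

lemma op_tuple: "op_tuple H T (\<lambda>k. hadj H (T k))"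
  by unfold_locales (auto intro: T_bops bops_in hadj_bops hinner_hadj)

sublocale op_tuple H T "\<lambda>k. hadj H (T k)"
  by (rule op_tuple)

lemma coinvariant_subspace:
  assumes "coinvariant H T M"
  shows "subspace M" "M \<subseteq> hcarrier H" "\<And>k x. x \<in> M \<Longrightarrow> hadj H (T k) x \<in> M"
  using assms unfolding coinvariant_def closed_subspace_def by blast+

text \<open>For x and y in M, <P_M T_k x, y> = <T_k x, y> = <x, T_k* y>, and T_k* y is again in
  M.\<close>

lemma compression_op_tuple:
  assumes "coinvariant H T M"
  shows "op_tuple (sub_hspace H M) (compression H M T) (\<lambda>k. hadj H (T k))"
proof -
  note M = coinvariant_subspace[OF assms]
  interpret sub: findim_inner_space "sub_hspace H M" by (rule findim_sub_hspace[OF M(1,2)])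
  have MH: "x \<in> hcarrier H" if "x \<in> M" for x using that M(2) by auto
  show ?thesis
  proof unfold_locales
    fix k
    show "compression H M T k \<in> bops (sub_hspace H M)"
      by (rule sub.bopsI)
        (auto simp: compression_def MH hproj_in M(1,2) bops_add[OF T_bops] bops_scale[OF T_bops] hproj_add hproj_scale
          subspace_add[OF M(1)] subspace_scale[OF M(1)])
    fix x assume x: "x \<in> hcarrier (sub_hspace H M)"
    then show "hadj H (T k) x \<in> hcarrier (sub_hspace H M)" using M(3) by simp
    fix y assume "y \<in> hcarrier (sub_hspace H M)"
    then show "hinner (sub_hspace H M) (compression H M T k x) y = hinner (sub_hspace H M) x (hadj H (T k) y)"
      using x by (simp add: compression_def hinner_hproj M(1,2) MH hinner_hadj[OF T_bops])
  qed
qed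

text \<open>Both sides lie in M and have the same inner products with M, since the adjoint of either
  word acts there as the same product of the T_k*.\<close>

lemma compression_word_op:
  assumes "coinvariant H T M" and x: "x \<in> M"
  shows "word_op (sub_hspace H M) (compression H M T) w x = hproj H M (word_op H T w x)"
proof -
  note M = coinvariant_subspace[OF assms(1)]
  interpret sub: op_tuple "sub_hspace H M" "compression H M T" "\<lambda>k. hadj H (T k)"
    by (rule compression_op_tuple[OF assms(1)])
  have MH: "x \<in> hcarrier H" if "x \<in> M" for x using that M(2) by auto
  show ?thesis
    using x sub.word_op_in[of x w] sub.adj_word[of x _ w] adj_word[of x _ w]
    by (intro hproj_unique[OF M(1,2), symmetric]) (auto simp: MH)
qed

text \<open>Commutativity follows from the word formula for words of length two; the norm conditions
  are those of \<open>T\<close> restricted to M.\<close>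

lemma compression_pure_row:
  assumes "coinvariant H T M"
  shows "pure_row (sub_hspace H M) (compression H M T) (\<lambda>k. hadj H (T k))"
proof -
  note M = coinvariant_subspace[OF assms]
  interpret sub: op_tuple "sub_hspace H M" "compression H M T" "\<lambda>k. hadj H (T k)"
    by (rule compression_op_tuple[OF assms])
  have MH: "x \<in> hcarrier H" if "x \<in> M" for x using that M(2) by auto
  show ?thesis
  proof unfold_locales
    have "compression H M T j \<circ> compression H M T k = compression H M T k \<circ> compression H M T j" for j k
    proof
      fix x
      show "(compression H M T j \<circ> compression H M T k) x = (compression H M T k \<circ> compression H M T j) x"
      proof (cases "x \<in> M")
        case True
        have two: "compression H M T i (compression H M T l x) = hproj H M (T i (T l x))" for i l
          using compression_word_op[OF assms True, of "[i, l]"] True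
          by (simp add: sub.word_op_Cons sub.word_op_Nil word_op_Cons word_op_Nil hid_def MH)
        show ?thesis using comm True by (simp add: two commuting_def fun_eq_iff)
      next
        case False
        then have "compression H M T i x = 0" for i by (simp add: compression_def)
        then show ?thesis by (simp add: sub.bops_0[OF sub.T_bops])
      qed
    qed
    then show "commuting (compression H M T)" by (simp add: commuting_def)
  next
    fix x assume "x \<in> hcarrier (sub_hspace H M)"
    then have x: "x \<in> hcarrier H" using MH by simp
    have "hinner H (hid H x - (\<Sum>k\<in>UNIV. T k (hadj H (T k) x))) x \<in> \<real>\<^sub>\<ge>\<^sub>0"
      using row x by (auto simp: row_contraction_def op_le_def)
    then have "0 \<le> Re (hinner H (hid H x - (\<Sum>k\<in>UNIV. T k (hadj H (T k) x))) x)"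
      by (auto simp: complex_nonneg_Reals_iff)
    also have "hinner H (hid H x - (\<Sum>k\<in>UNIV. T k (hadj H (T k) x))) x =
        hinner H x x - (\<Sum>k\<in>UNIV. hinner H (hadj H (T k) x) (hadj H (T k) x))"
      using x by (simp add: hid_def diff_left V_sum sum_left adj S_in)
    finally show "(\<Sum>k\<in>UNIV. (hnorm (sub_hspace H M) (hadj H (T k) x))\<^sup>2) \<le> (hnorm (sub_hspace H M) x)\<^sup>2"
      using x by (simp add: hnorm_power2 S_in)
    have eq: "hadj H (word_op H T w) x = fold (\<lambda>k. hadj H (T k)) w x" for w
      using x by (intro hadj_unique word_op_bops adj_word) auto
    show "(\<lambda>n. \<Sum>w | length w = n. (hnorm (sub_hspace H M) (fold (\<lambda>k. hadj H (T k)) w x))\<^sup>2) \<longlonglongrightarrow> 0"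
      using pure_T x unfolding pure_tuple_def sub_hspace_simps eq[symmetric] by blast
  qed
qed

lemma compression_calculus:
  assumes "coinvariant H T M"
  shows "is_functional_calculus (sub_hspace H M) (compression H M T) (fun_calc (sub_hspace H M) (compression H M T))"
  by (rule pure_row.fun_calc_is_functional_calculus[OF compression_pure_row[OF assms]])


subsection \<open>Co-invariant subspaces are determined by their annihilators\<close>

text \<open>The multiplier is the product of coordinate functions along w. It comes before the
  quantifier over M because one multiplier must serve both annihilators.\<close>

lemma word_multiplier:
  "\<exists>\<phi>\<in>multipliers. \<forall>M. coinvariant H T M \<longrightarrow>
     fun_calc (sub_hspace H M) (compression H M T) \<phi> = word_op (sub_hspace H M) (compression H M T) w"
proof (induction w)
  case Nil
  show ?case
    using ball_one_multiplier functional_calculusD(5)[OF compression_calculus]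
    by (intro bexI[of _ ball_one]) (auto simp: word_op_def)
next
  case (Cons k w)
  then obtain \<phi> where \<phi>: "\<phi> \<in> multipliers" "\<And>M. coinvariant H T M \<Longrightarrow>
     fun_calc (sub_hspace H M) (compression H M T) \<phi> = word_op (sub_hspace H M) (compression H M T) w" by blast
  show ?case
  proof (intro bexI[of _ "\<lambda>x. ball_coord k x * \<phi> x"] allI impI)
    show "(\<lambda>x. ball_coord k x * \<phi> x) \<in> multipliers" by (intro multipliers_mult ball_coord_multiplier \<phi>)
    fix M assume M: "coinvariant H T M"
    let ?\<Phi> = "fun_calc (sub_hspace H M) (compression H M T)"
    note D = functional_calculusD[OF compression_calculus[OF M]]
    have "?\<Phi> (\<lambda>x. ball_coord k x * \<phi> x) = compression H M T k \<circ> ?\<Phi> \<phi>"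
      using D(4)[OF ball_coord_multiplier \<phi>(1)] by (simp only: D(6))
    then show "?\<Phi> (\<lambda>x. ball_coord k x * \<phi> x) = word_op (sub_hspace H M) (compression H M T) (k # w)"
      using \<phi>(2)[OF M] by (simp add: word_op_def)
  qed
qed

definition orth :: "'a set \<Rightarrow> 'a set" where
  "orth M = {x \<in> hcarrier H. \<forall>y\<in>M. hinner H x y = 0}"

lemma subspace_orth: "M \<subseteq> hcarrier H \<Longrightarrow> subspace (orth M)"
  unfolding subspace_def orth_def by (auto simp: add_left scale_left subset_iff)

lemma word_op_orth: "\<lbrakk>coinvariant H T M; x \<in> orth M\<rbrakk> \<Longrightarrow> word_op H T w x \<in> orth M"
proof -
  assume M: "coinvariant H T M" and x: "x \<in> orth M"
  note M' = coinvariant_subspace[OF M]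
  have "fold (\<lambda>k. hadj H (T k)) w y \<in> M" if "y \<in> M" for y
    using that by (induction w arbitrary: y) (auto intro: M'(3))
  then show ?thesis using x M'(2) by (auto simp: orth_def adj_word subset_iff)
qed

lemma hproj_eq_0_iff:
  assumes "subspace M" "M \<subseteq> hcarrier H" "x \<in> hcarrier H"
  shows "hproj H M x = 0 \<longleftrightarrow> x \<in> orth M"
proof
  assume "hproj H M x = 0"
  then show "x \<in> orth M" using hinner_hproj[OF assms] assms by (auto simp: orth_def subset_iff)
next
  assume "x \<in> orth M"
  then show "hproj H M x = 0" using assms subspace_0[OF assms(1)]
    by (intro hproj_unique) (auto simp: orth_def subset_iff)
qed

text \<open>In effect \<open>\<phi>\<close> is a polynomial \<open>p\<close> and \<open>A = p(T)\<close>.\<close>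

lemma polynomial_representation:
  assumes \<xi>: "\<xi> \<in> hcarrier H" and h: "h \<in> span (range (\<lambda>w. word_op H T w \<xi>))"
  shows "\<exists>\<phi>\<in>multipliers. \<exists>A\<in>bops H. A \<xi> = h \<and> (\<forall>w. A (word_op H T w \<xi>) = word_op H T w h) \<and>
     (\<forall>M. coinvariant H T M \<longrightarrow>
        A ` orth M \<subseteq> orth M \<and> (\<forall>x\<in>M. fun_calc (sub_hspace H M) (compression H M T) \<phi> x = hproj H M (A x)))"
  using h
proof (induction rule: span_induct_alt)
  case base
  \<comment> \<open>Writing zero as a scalar multiple lets homogeneity of the functional calculus
    compute its value.\<close>
  let ?\<phi> = "\<lambda>x. 0 * ball_one x :: complex"
  have 1: "?\<phi> \<in> multipliers" by (intro multipliers_cmult ball_one_multiplier)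
  have 2: "(\<lambda>x. 0) \<in> bops H" using bops_scale_op[OF bops_hid, of 0] by simp
  have 3: "fun_calc (sub_hspace H M) (compression H M T) ?\<phi> x = hproj H M 0"
    if M: "coinvariant H T M" for M x
  proof -
    have "fun_calc (sub_hspace H M) (compression H M T) ?\<phi> x = 0"
      using functional_calculusD(3)[OF compression_calculus[OF M] ball_one_multiplier, of 0] by simp
    moreover have "hproj H M 0 = 0"
      using coinvariant_subspace[OF M] by (subst hproj_eq_0_iff) (auto simp: orth_def subset_iff)
    ultimately show ?thesis by simp
  qed
  show ?case
    using coinvariant_subspace(2)
    by (intro bexI[OF _ 1] bexI[OF _ 2] conjI allI impI ballI 3) 
      (auto simp: bops_0[OF word_op_bops] subspace_0[OF subspace_orth])
next
  case (step c b h)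
  then obtain w where b: "b = word_op H T w \<xi>" by auto
  from step.IH obtain \<phi> A
    where \<phi>: "\<phi> \<in> multipliers" and A1: "A \<in> bops H" and
      R: "A \<xi> = h \<and> (\<forall>w. A (word_op H T w \<xi>) = word_op H T w h) \<and>
        (\<forall>M. coinvariant H T M \<longrightarrow> A ` orth M \<subseteq> orth M \<and>
          (\<forall>x\<in>M. fun_calc (sub_hspace H M) (compression H M T) \<phi> x = hproj H M (A x)))"
    by (elim bexE) (rule that)
  have A: "A \<in> bops H" "A \<xi> = h" "\<And>w. A (word_op H T w \<xi>) = word_op H T w h"
    "\<And>M. coinvariant H T M \<Longrightarrow> A ` orth M \<subseteq> orth M"
    "\<And>M x. \<lbrakk>coinvariant H T M; x \<in> M\<rbrakk> \<Longrightarrow> fun_calc (sub_hspace H M) (compression H M T) \<phi> x = hproj H M (A x)"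
    using A1 R by blast+
  obtain \<psi> where \<psi>: "\<psi> \<in> multipliers" "\<And>M. coinvariant H T M \<Longrightarrow>
     fun_calc (sub_hspace H M) (compression H M T) \<psi> = word_op (sub_hspace H M) (compression H M T) w"
    using word_multiplier by blast
  define B where "B = (\<lambda>x. hscale H c (word_op H T w x) + A x)"
  define \<theta> where "\<theta> = (\<lambda>x. c * \<psi> x + \<phi> x)"
  have hH: "h \<in> hcarrier H" using A(1,2) \<xi> bops_in by blast
  have c\<psi>: "(\<lambda>x. c * \<psi> x) \<in> multipliers" by (intro multipliers_cmult \<psi>)
  have \<theta>: "\<theta> \<in> multipliers" unfolding \<theta>_def by (intro multipliers_add c\<psi> \<phi>)
  have B: "B \<in> bops H" unfolding B_def by (intro bops_add_op bops_scale_op word_op_bops A(1))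
  show ?case
  proof (intro bexI[OF _ \<theta>] bexI[OF _ B] conjI allI impI ballI)
    show "B \<xi> = hscale H c b + h" by (simp add: B_def A(2) b)
    fix u
    \<comment> \<open>The words \<open>w @ u\<close> and \<open>u @ w\<close> have the same letter
      counts.\<close>
    have swap: "word_op H T w (word_op H T u \<xi>) = word_op H T u b"
      using word_op_cong[OF comm, of "w @ u" "u @ w"] by (simp add: b word_op_append fun_eq_iff)
    show "B (word_op H T u \<xi>) = word_op H T u (hscale H c b + h)"
      using \<xi> hH by (simp add: B_def A(3) swap b bops_add[OF word_op_bops] bops_scale[OF word_op_bops])
  next
    fix M assume M: "coinvariant H T M"
    note M' = coinvariant_subspace[OF M]
    show "B ` orth M \<subseteq> orth M"
      using A(4)[OF M] word_op_orth[OF M] subspace_orth[OF M'(2)]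
      by (auto simp: B_def intro!: subspace_add subspace_scale)
    fix x assume x: "x \<in> M"
    then have xH: "x \<in> hcarrier H" using M' by auto
    let ?\<Phi> = "fun_calc (sub_hspace H M) (compression H M T)"
    note D = functional_calculusD[OF compression_calculus[OF M]]
    have "?\<Phi> \<theta> = (\<lambda>h. hscale H c (?\<Phi> \<psi> h) + ?\<Phi> \<phi> h)"
      unfolding \<theta>_def D(2)[OF c\<psi> \<phi>] D(3)[OF \<psi>(1)] by simp
    then have "?\<Phi> \<theta> x = hscale H c (hproj H M (word_op H T w x)) + hproj H M (A x)"
      using compression_word_op[OF M x] A(5)[OF M x] by (simp add: \<psi>(2)[OF M])
    also have "\<dots> = hproj H M (B x)"
      using M'(1,2) xH by (simp add: B_def hproj_add hproj_scale bops_in[OF A(1)])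
    finally show "?\<Phi> \<theta> x = hproj H M (B x)" .
  qed
qed

lemma orth_subset_if_Ann_eq:
  assumes cyc: "cyclic_tuple H T" and M: "coinvariant H T M" and N: "coinvariant H T N"
    and Ann: "Ann_c (sub_hspace H M) (compression H M T) = Ann_c (sub_hspace H N) (compression H N T)"
  shows "orth M \<subseteq> orth N"
proof
  note M' = coinvariant_subspace[OF M] and N' = coinvariant_subspace[OF N]
  fix h assume h: "h \<in> orth M"
  obtain \<xi> where \<xi>: "\<xi> \<in> hcarrier H"
    and clos: "hclosure H (span (range (\<lambda>w. word_op H T w \<xi>))) = hcarrier H"
    using cyc by (auto simp: cyclic_tuple_def)
  have sp: "span (range (\<lambda>w. word_op H T w \<xi>)) = hcarrier H"
  proof (rule hclosure_full_imp_eq[OF subspace_span _ clos])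
    show "span (range (\<lambda>w. word_op H T w \<xi>)) \<subseteq> hcarrier H"
      by (rule span_minimal[OF _ subspace_V]) (use \<xi> in auto)
  qed
  have hspan: "h \<in> span (range (\<lambda>w. word_op H T w \<xi>))" using h unfolding sp by (simp add: orth_def)
  from polynomial_representation[OF \<xi> hspan] obtain \<phi> A
    where \<phi>: "\<phi> \<in> multipliers" and A1: "A \<in> bops H" and
      R: "A \<xi> = h \<and> (\<forall>w. A (word_op H T w \<xi>) = word_op H T w h) \<and>
        (\<forall>M. coinvariant H T M \<longrightarrow> A ` orth M \<subseteq> orth M \<and>
          (\<forall>x\<in>M. fun_calc (sub_hspace H M) (compression H M T) \<phi> x = hproj H M (A x)))"
    by (elim bexE) (rule that)
  have A: "A \<in> bops H" "A \<xi> = h" "\<And>w. A (word_op H T w \<xi>) = word_op H T w h"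
    "\<And>M. coinvariant H T M \<Longrightarrow> A ` orth M \<subseteq> orth M"
    "\<And>M x. \<lbrakk>coinvariant H T M; x \<in> M\<rbrakk> \<Longrightarrow> fun_calc (sub_hspace H M) (compression H M T) \<phi> x = hproj H M (A x)"
    using A1 R by blast+
  \<comment> \<open>A T_w \<xi> = T_w h stays in the invariant subspace \<open>orth M\<close>, and
    the vectors T_w \<xi> span H.\<close>
  have "A x \<in> orth M" if "x \<in> hcarrier H" for x
  proof -
    have "x \<in> span (range (\<lambda>w. word_op H T w \<xi>))" using that sp by simp
    then have "x \<in> hcarrier H \<and> A x \<in> orth M"
    proof (induction rule: span_induct_alt)
      case base
      then show ?case using subspace_0[OF subspace_orth[OF M'(2)]] by (simp add: bops_0[OF A(1)])
    next
      case (step c b x)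
      then obtain w where b: "b = word_op H T w \<xi>" by auto
      have bH: "b \<in> hcarrier H" using \<xi> by (simp add: b)
      have "A b \<in> orth M" unfolding b A(3) by (rule word_op_orth[OF M h])
      then show ?case
        using step bH subspace_orth[OF M'(2)]
        by (auto simp: bops_add[OF A(1)] bops_scale[OF A(1)] intro!: subspace_add subspace_scale)
    qed
    then show ?thesis by simp
  qed
  then have zero: "fun_calc (sub_hspace H M) (compression H M T) \<phi> x = 0" if "x \<in> M" for x
    using A(5)[OF M that] that M'(1,2) bops_in[OF A(1)] hproj_eq_0_iff[OF M'(1,2)] by (simp add: subset_iff)
  interpret subM: pure_row "sub_hspace H M" "compression H M T" "\<lambda>k. hadj H (T k)"
    by (rule compression_pure_row[OF M])
  have "fun_calc (sub_hspace H M) (compression H M T) \<phi> \<in> bops (sub_hspace H M)"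
    by (rule functional_calculusD(1)[OF compression_calculus[OF M] \<phi>])
  \<comment> \<open>\<open>Ann_c\<close> asks for the zero function on the whole ambient type; off M
    the convention for \<open>bops\<close> supplies the value 0.\<close>
  then have "fun_calc (sub_hspace H M) (compression H M T) \<phi> x = 0" for x
    using zero subM.bops_off[of _ x] by (cases "x \<in> M") auto
  then have "\<phi> \<in> Ann_c (sub_hspace H M) (compression H M T)"
    using \<phi> by (auto simp: Ann_c_def)
  then have "fun_calc (sub_hspace H N) (compression H N T) \<phi> = (\<lambda>_. 0)"
    unfolding Ann by (simp add: Ann_c_def)
  then have AN: "A x \<in> orth N" if "x \<in> N" for x
    using A(5)[OF N that] that N'(1,2) bops_in[OF A(1)] hproj_eq_0_iff[OF N'(1,2)] by (auto simp: subset_iff)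
  \<comment> \<open>Vanishing of \<phi> on the compression to N controls A on N only. Hence \<xi> is
    split: A p is in \<open>orth N\<close> by that vanishing, and A (\<xi> - p) by invariance of
    \<open>orth N\<close>.\<close>
  define p where "p = hproj H N \<xi>"
  have p: "p \<in> N" unfolding p_def using N' \<xi> by (intro hproj_in)
  have "\<xi> - p \<in> orth N"
    using hproj_orth[OF N'(1,2) \<xi>] p N'(2) \<xi> by (auto simp: orth_def p_def)
  then have "A (\<xi> - p) \<in> orth N" using A(4)[OF N] by auto
  moreover have "h = A p + A (\<xi> - p)"
    using bops_add[OF A(1), of p "\<xi> - p"] p N'(2) \<xi> A(2) by auto
  ultimately show "h \<in> orth N"
    using AN[OF p] subspace_orth[OF N'(2)] by (auto intro: subspace_add)
qed

text \<open>For x in M and p its projection to N, x - p lies in \<open>orth N\<close>, hence in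
  \<open>orth M\<close>; it is orthogonal to p and to x, so to itself.\<close>

lemma subset_if_orth_subset:
  assumes M: "coinvariant H T M" and N: "coinvariant H T N" and "orth N \<subseteq> orth M"
  shows "M \<subseteq> N"
proof
  note M' = coinvariant_subspace[OF M] and N' = coinvariant_subspace[OF N]
  fix x assume x: "x \<in> M"
  then have xH: "x \<in> hcarrier H" using M' by auto
  define p where "p = hproj H N x"
  have p: "p \<in> N" unfolding p_def using N' xH by (intro hproj_in)
  then have pH: "p \<in> hcarrier H" using N' by auto
  have o: "x - p \<in> orth N"
    using hproj_orth[OF N'(1,2) xH] pH xH by (auto simp: orth_def p_def)
  then have "hinner H (x - p) x = 0" using assms(3) x by (auto simp: orth_def)
  moreover have "hinner H (x - p) p = 0" using o p by (auto simp: orth_def)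
  ultimately have "hinner H (x - p) (x - p) = 0" using xH pH by (simp add: diff_right)
  then have "x - p = 0" using pos_def[of "x - p"] xH pH by force
  then show "x \<in> N" using p by simp
qed

end

theorem theorem1p3:
  fixes H :: "'a::ab_group_add hspace"
    and T :: "'d::finite \<Rightarrow> 'a \<Rightarrow> 'a"
    and M N :: "'a set"
  assumes "complex_hilbert_space H" and "finite_dimensional H"
    and "row_contraction H T" and "commuting T" and "pure_tuple H T" and "cyclic_tuple H T"
    and "coinvariant H T M" and "coinvariant H T N"
    and "Ann_c (sub_hspace H M) (compression H M T) = Ann_c (sub_hspace H N) (compression H N T)"
  shows "M = N"
proof -
  interpret inner_space H by (rule complex_hilbert_space.inner_space[OF assms(1)])
  interpret row_contraction_findim H T by unfold_locales (fact assms)+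
  show ?thesis
    using orth_subset_if_Ann_eq[OF assms(6-9)] orth_subset_if_Ann_eq[OF assms(6,8,7) assms(9)[symmetric]]
      subset_if_orth_subset[OF assms(7,8)] subset_if_orth_subset[OF assms(8,7)] by blast
qed

end
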